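(* Let $(M,\Delta)$ and $(M',\Delta')$ be decorated matrices with the same row sums $\mathbf b=(b_1,\dots,b_q)$ and column sums $\mathbf c=(c_1,\dots,c_r)$. Then the degeneration order and the rank order are equivalent: $$(M,\Delta)\le_{\mathrm{deg}}(M',\Delta')\quad\Longleftrightarrow\quad (M,\Delta)\le_{\mathrm{rk}}(M',\Delta').$$ That is, for triple flags $(A,B_\bullet,C_\bullet)\in F_{M,\Delta}$ and $(A',B'_\bullet,C'_\bullet)\in F_{M',\Delta'}$, the triple $(A,B_\bullet,C_\bullet)$ is a degeneration of $(A',B'_\bullet,C'_\bullet)$ (meaning $F_{M,\Delta}\subset\overline{F}_{M',\Delta'}$) if and only if, for all $(i,j)\in[0,q]\times[0,r]$, $$\dim(B_i\cap C_j)\ \ge\ \dim(B'_i\cap C'_j)$$ and $$\dim(B_i\cap C_j)+\dim(A\cap(B_i+C_j))\ \ge\ \dim(B'_i\cap C'_j)+\dim(A'\cap(B'_i+C'_j)).$$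
   Context: Let $\mathbf k$ be an infinite field (of arbitrary characteristic, not necessarily algebraically closed) and $V$ a vector space over $\mathbf k$ of dimension $n$. Write $[a,b]=\{a,a+1,\dots,b\}$. Fix two compositions of $n$, i.e. lists of positive integers $\mathbf b=(b_1,\dots,b_q)$ and $\mathbf c=(c_1,\dots,c_r)$ each with sum $n$. $\mathrm{Flag}(\mathbf b)$ is the variety of partial flags $B_\bullet=(0=B_0\subset B_1\subset\cdots\subset B_q=V)$ with $\dim(B_i/B_{i-1})=b_i$ for $i=1,\dots,q$; similarly $\mathrm{Flag}(\mathbf c)$. $\mathbb P(V)$ is the variety of lines ($1$-dimensional subspaces) $A\subset V$. $\mathrm{GL}(V)$ acts diagonally on $\mathbb P(V)\times\mathrm{Flag}(\mathbf b)\times\mathrm{Flag}(\mathbf c)$; elements $(A,B_\bullet,C_\bullet)$ are called triple flags. A transport matrix is a $q\times r$ matrix $M=(m_{ij})$ of nonnegative integers with row sums $b_i=\sum_j m_{ij}$ and column sums $c_j=\sum_i m_{ij}$. A decorated matrix is a pair $(M,\Delta)$ where $M$ is a transport matrix and $\Delta=\{(i_1,j_1),\dots,(i_t,j_t)\}\subset[1,q]\times[1,r]$ is a nonempty set of positions with $i_1<\cdots<i_t$, $j_1>\cdots>j_t$, and $m_{ij}>0$ for all $(i,j)\in\Delta$. The orbit $F_{M,\Delta}$ is the set of all triple flags $(A,B_\bullet,C_\bullet)$ obtained as follows: take any basis $(v_{ijk})$ of $V$ indexed by $(i,j)\in[1,q]\times[1,r]$, $1\le k\le m_{ij}$, and put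 $B_i=\langle v_{i'jk}\mid i'\le i\rangle$, $C_j=\langle v_{ij'k}\mid j'\le j\rangle$, $A=\langle\sum_{(i,j)\in\Delta}v_{ij1}\rangle$, where $\langle\ \rangle$ is linear span. The sets $F_{M,\Delta}$ are the $\mathrm{GL}(V)$-orbits, indexed by decorated matrices. Degeneration order: $(M,\Delta)\le_{\mathrm{deg}}(M',\Delta')$ iff $F_{M,\Delta}\subset\overline{F}_{M',\Delta'}$, the bar denoting Zariski closure in $\mathbb P(V)\times\mathrm{Flag}(\mathbf b)\times\mathrm{Flag}(\mathbf c)$. Order on positions: $(i,j)\le(i',j')$ iff $i\le i'$ and $j\le j'$. For a position $p$ and a set of positions $\Delta$, $p\le\Delta$ means $p\le p'$ for some $p'\in\Delta$. Rank numbers: for $(i,j)\in[0,q]\times[0,r]$, $r_{ij}(M)=\sum_{k\le i,\,l\le j}m_{kl}$ (so $r_{ij}(M)=0$ if $i=0$ or $j=0$), and $r_{\langle ij\rangle}(M,\Delta)=r_{ij}(M)+\delta_{ij}(\Delta)$, where $\delta_{ij}(\Delta)=0$ if $(i+1,j+1)\le\Delta$ and $\delta_{ij}(\Delta)=1$ otherwise (equivalently, $\delta_{ij}(\Delta)=1$ iff every $(k,l)\in\Delta$ has $k\le i$ or $l\le j$). For $(A,B_\bullet,C_\bullet)\in F_{M,\Delta}$ one has $r_{ij}(M)=\dim(B_i\cap C_j)$ and $r_{\langle ij\rangle}(M,\Delta)=\dim(B_i\cap C_j)+\dim(A\cap(B_i+C_j))$. Rank order: $(M,\Delta)\le_{\mathrm{rk}}(M',\Delta')$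 iff $r_{ij}(M)\ge r_{ij}(M')$ and $r_{\langle ij\rangle}(M,\Delta)\ge r_{\langle ij\rangle}(M',\Delta')$ for all $(i,j)\in[0,q]\times[0,r]$. *)

theory Defs
  imports
    "HOL-Analysis.Abstract_Topology"
    "HOL-Library.Poly_Mapping"
    "Jordan_Normal_Form.Determinant"
begin

section \<open>Decorated matrices\<close>

text \<open>
  Matrices are functions of two indices; positions are 1-based and only the entries in
  \<open>{1..q} \<times> {1..r}\<close> are ever looked at. Since lists are 0-based, the part \<open>b\<^sub>i\<close> of a
  composition \<open>b\<close> is \<open>b ! (i - 1)\<close>.
\<close>

definition composition :: "nat \<Rightarrow> nat list \<Rightarrow> bool" where
  "composition n b \<longleftrightarrow> (\<forall>x\<in>set b. 0 < x) \<and> sum_list b = n"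

definition transport_matrix :: "nat list \<Rightarrow> nat list \<Rightarrow> (nat \<Rightarrow> nat \<Rightarrow> nat) \<Rightarrow> bool" where
  "transport_matrix b c M \<longleftrightarrow>
     (\<forall>i\<in>{1..length b}. b ! (i - 1) = (\<Sum>j\<in>{1..length c}. M i j)) \<and>
     (\<forall>j\<in>{1..length c}. c ! (j - 1) = (\<Sum>i\<in>{1..length b}. M i j))"

definition decorated_matrix ::
    "nat list \<Rightarrow> nat list \<Rightarrow> (nat \<Rightarrow> nat \<Rightarrow> nat) \<Rightarrow> (nat \<times> nat) set \<Rightarrow> bool" where
  "decorated_matrix b c M \<Delta> \<longleftrightarrow>
     transport_matrix b c M \<and>
     \<Delta> \<noteq> {} \<and> \<Delta> \<subseteq> {1..length b} \<times> {1..length c} \<and>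
     (\<exists>ps. set ps = \<Delta> \<and> sorted_wrt (\<lambda>(i, j) (i', j'). i < i' \<and> j > j') ps) \<and>
     (\<forall>(i, j)\<in>\<Delta>. M i j > 0)"

definition pos_le :: "nat \<times> nat \<Rightarrow> nat \<times> nat \<Rightarrow> bool" where
  "pos_le p p' \<longleftrightarrow> fst p \<le> fst p' \<and> snd p \<le> snd p'"

definition pos_le_set :: "nat \<times> nat \<Rightarrow> (nat \<times> nat) set \<Rightarrow> bool" where
  "pos_le_set p \<Delta> \<longleftrightarrow> (\<exists>p'\<in>\<Delta>. pos_le p p')"

definition rank_num :: "(nat \<Rightarrow> nat \<Rightarrow> nat) \<Rightarrow> nat \<Rightarrow> nat \<Rightarrow> nat" where
  "rank_num M i j = (\<Sum>k\<in>{1..i}. \<Sum>l\<in>{1..j}. M k l)"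

definition delta_num :: "(nat \<times> nat) set \<Rightarrow> nat \<Rightarrow> nat \<Rightarrow> nat" where
  "delta_num \<Delta> i j = (if pos_le_set (i + 1, j + 1) \<Delta> then 0 else 1)"

definition rank_num_dec ::
    "(nat \<Rightarrow> nat \<Rightarrow> nat) \<Rightarrow> (nat \<times> nat) set \<Rightarrow> nat \<Rightarrow> nat \<Rightarrow> nat" where
  "rank_num_dec M \<Delta> i j = rank_num M i j + delta_num \<Delta> i j"

definition rk_le ::
    "nat list \<Rightarrow> nat list \<Rightarrow>
     (nat \<Rightarrow> nat \<Rightarrow> nat) \<Rightarrow> (nat \<times> nat) set \<Rightarrow> (nat \<Rightarrow> nat \<Rightarrow> nat) \<Rightarrow> (nat \<times> nat) set \<Rightarrow> bool" where
  "rk_le b c M \<Delta> M' \<Delta>' \<longleftrightarrow>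
     (\<forall>i\<in>{0..length b}. \<forall>j\<in>{0..length c}.
        rank_num M i j \<ge> rank_num M' i j \<and>
        rank_num_dec M \<Delta> i j \<ge> rank_num_dec M' \<Delta>' i j)"


section \<open>Multihomogeneous polynomials\<close>

text \<open>
  Polynomials over \<open>'k\<close> in variables from \<open>'x\<close> are finitely supported maps from monomials
  (finitely supported exponent functions) to coefficients.
\<close>

type_synonym ('x, 'k) mpolynomial = "('x \<Rightarrow>\<^sub>0 nat) \<Rightarrow>\<^sub>0 'k"

definition mpoly_vars :: "('x, 'k::zero) mpolynomial \<Rightarrow> 'x set" where
  "mpoly_vars P = (\<Union>m\<in>Poly_Mapping.keys P. Poly_Mapping.keys m)"

definition mpoly_eval :: "('x \<Rightarrow> 'k) \<Rightarrow> ('x, 'k::comm_semiring_1) mpolynomial \<Rightarrow> 'k" where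
  "mpoly_eval \<alpha> P =
     (\<Sum>m\<in>Poly_Mapping.keys P. Poly_Mapping.lookup P m *
        (\<Prod>x\<in>Poly_Mapping.keys m. \<alpha> x ^ Poly_Mapping.lookup m x))"

text \<open>
  The variables are partitioned into groups by their first component, and the polynomial is
  homogeneous separately in every group.
\<close>

definition multihomogeneous :: "('g \<times> 'x, 'k::zero) mpolynomial \<Rightarrow> bool" where
  "multihomogeneous P \<longleftrightarrow>
     (\<forall>g. \<exists>e. \<forall>m\<in>Poly_Mapping.keys P.
        (\<Sum>x\<in>{x \<in> Poly_Mapping.keys m. fst x = g}. Poly_Mapping.lookup m x) = e)"


section \<open>Triple flags and their orbits\<close>

text \<open>The vector space \<open>V\<close> is the whole type \<open>'v\<close>. A flag is the list of \<open>B\<^sub>0, \<dots>, B\<^sub>q\<close>.\<close>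

type_synonym 'v triple = "'v set \<times> 'v set list \<times> 'v set list"

definition basis_index :: "nat \<Rightarrow> nat \<Rightarrow> (nat \<Rightarrow> nat \<Rightarrow> nat) \<Rightarrow> (nat \<times> nat \<times> nat) set" where
  "basis_index q r M = {(i, j, k). i \<in> {1..q} \<and> j \<in> {1..r} \<and> k \<in> {1..M i j}}"

text \<open>
  A locale of its own, because new constants of \<open>vector_space\<close> and \<open>finite_dimensional_vector_space\<close>
  would clash with their copies in the library's global interpretations of these locales.
\<close>

locale flag_space = finite_dimensional_vector_space scale Basis
  for scale :: "'a::field \<Rightarrow> 'b::ab_group_add \<Rightarrow> 'b" and Basis :: "'b set"
begin

definition lines :: "'b set set" where
  "lines = {A. subspace A \<and> dim A = 1}"

definition flags :: "nat list \<Rightarrow> 'b set list set" where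
  "flags b = {B. length B = length b + 1 \<and> B ! 0 = {0} \<and> B ! length b = UNIV \<and>
     (\<forall>i\<in>{0..length b}. subspace (B ! i)) \<and>
     (\<forall>i\<in>{1..length b}. B ! (i - 1) \<subseteq> B ! i \<and> dim (B ! i) = dim (B ! (i - 1)) + b ! (i - 1))}"

definition triple_flags :: "nat list \<Rightarrow> nat list \<Rightarrow> 'b triple set" where
  "triple_flags b c = lines \<times> flags b \<times> flags c"

definition indexed_basis :: "'i set \<Rightarrow> ('i \<Rightarrow> 'b) \<Rightarrow> bool" where
  "indexed_basis I v \<longleftrightarrow> inj_on v I \<and> independent (v ` I) \<and> span (v ` I) = UNIV"

definition triple_orbit ::
    "nat list \<Rightarrow> nat list \<Rightarrow> (nat \<Rightarrow> nat \<Rightarrow> nat) \<Rightarrow> (nat \<times> nat) set \<Rightarrow> 'b triple set" where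
  "triple_orbit b c M \<Delta> =
     {(A, B, C). \<exists>v. indexed_basis (basis_index (length b) (length c) M) v \<and>
        A = span {\<Sum>(i, j)\<in>\<Delta>. v (i, j, 1)} \<and>
        length B = length b + 1 \<and>
        (\<forall>i\<in>{0..length b}.
           B ! i = span {v (i', j, k) | i' j k.
             (i', j, k) \<in> basis_index (length b) (length c) M \<and> i' \<le> i}) \<and>
        length C = length c + 1 \<and>
        (\<forall>j\<in>{0..length c}.
           C ! j = span {v (i, j', k) | i j' k.
             (i, j', k) \<in> basis_index (length b) (length c) M \<and> j' \<le> j})}"

end


section \<open>The Zariski topology\<close>

text \<open>
  \<open>\<P>(V) \<times> Flag(b) \<times> Flag(c)\<close> carries the topology induced by the Pluecker embedding of
  \<open>A\<close> and of each \<open>B\<^sub>i\<close> and \<open>C\<^sub>j\<close> into its own projective space.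
\<close>

datatype component = Line | FlagB nat | FlagC nat

fun component_space :: "'v triple \<Rightarrow> component \<Rightarrow> 'v set" where
  "component_space (A, B, C) Line = A"
| "component_space (A, B, C) (FlagB i) = B ! i"
| "component_space (A, B, C) (FlagC j) = C ! j"

fun component_dim :: "nat list \<Rightarrow> nat list \<Rightarrow> component \<Rightarrow> nat" where
  "component_dim b c Line = 1"
| "component_dim b c (FlagB i) = sum_list (take i b)"
| "component_dim b c (FlagC j) = sum_list (take j c)"

definition components :: "nat list \<Rightarrow> nat list \<Rightarrow> component set" where
  "components b c = {Line} \<union> FlagB ` {0..length b} \<union> FlagC ` {0..length c}"

context flag_space
begin

text \<open>
  Choosing an ordered basis \<open>u x\<close> of each component \<open>x\<close> gives homogeneous coordinates. The
  Pluecker coordinates of a \<open>d\<close>-dimensional subspace are indexed here by all \<open>d\<close>-tuples \<open>w\<close> of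
  elements of \<open>Basis\<close>, not only by the increasing ones: the others are \<open>0\<close> or agree up to sign
  with an increasing one, so the zero loci are the same. For \<open>d = 1\<close> these are the usual
  homogeneous coordinates on \<open>\<P>(V)\<close>.
\<close>

definition frame :: "nat list \<Rightarrow> nat list \<Rightarrow> 'b triple \<Rightarrow> (component \<Rightarrow> 'b list) \<Rightarrow> bool" where
  "frame b c T u \<longleftrightarrow>
     (\<forall>x\<in>components b c. distinct (u x) \<and> independent (set (u x)) \<and>
        span (set (u x)) = component_space T x)"

definition pluecker :: "(component \<Rightarrow> 'b list) \<Rightarrow> component \<times> 'b list \<Rightarrow> 'a" where
  "pluecker u = (\<lambda>(x, w).
     det (mat (length (u x)) (length (u x)) (\<lambda>(k, l). representation Basis (u x ! l) (w ! k))))"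

definition pluecker_vars :: "nat list \<Rightarrow> nat list \<Rightarrow> (component \<times> 'b list) set" where
  "pluecker_vars b c =
     {(x, w). x \<in> components b c \<and> length w = component_dim b c x \<and> set w \<subseteq> Basis}"

definition multihomogeneous_polys ::
    "nat list \<Rightarrow> nat list \<Rightarrow> (component \<times> 'b list, 'a) mpolynomial set" where
  "multihomogeneous_polys b c = {P. multihomogeneous P \<and> mpoly_vars P \<subseteq> pluecker_vars b c}"

text \<open>
  A different choice of \<open>u\<close> rescales the coordinates of each component by a nonzero factor, so
  whether a multihomogeneous polynomial vanishes at a triple flag does not depend on \<open>u\<close>.
\<close>

definition zero_locus ::
    "nat list \<Rightarrow> nat list \<Rightarrow> (component \<times> 'b list, 'a) mpolynomial \<Rightarrow> 'b triple set" where
  "zero_locus b c P =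
     {T \<in> triple_flags b c. \<forall>u. frame b c T u \<longrightarrow> mpoly_eval (pluecker u) P = 0}"

text \<open>
  The closed sets are the intersections of finite unions of zero loci. As zero loci are stable
  under finite unions (multiply the polynomials), these are exactly the common zero loci of
  families of multihomogeneous polynomials.
\<close>

definition zariski_topology :: "nat list \<Rightarrow> nat list \<Rightarrow> 'b triple topology" where
  "zariski_topology b c =
     topology_generated_by
       {triple_flags b c - zero_locus b c P | P. P \<in> multihomogeneous_polys b c}"

definition deg_le ::
    "nat list \<Rightarrow> nat list \<Rightarrow>
     (nat \<Rightarrow> nat \<Rightarrow> nat) \<Rightarrow> (nat \<times> nat) set \<Rightarrow> (nat \<Rightarrow> nat \<Rightarrow> nat) \<Rightarrow> (nat \<times> nat) set \<Rightarrow> bool" where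
  "deg_le b c M \<Delta> M' \<Delta>' \<longleftrightarrow>
     triple_orbit b c M \<Delta> \<subseteq> zariski_topology b c closure_of triple_orbit b c M' \<Delta>'"

lemma ex_frame:
  assumes "T \<in> triple_flags b c"
  shows "\<exists>u. frame b c T u"
proof -
  obtain A B C where T: "T = (A, B, C)" by (cases T)
  have "subspace A" "\<forall>i\<in>{0..length b}. subspace (B ! i)" "\<forall>j\<in>{0..length c}. subspace (C ! j)"
    using assms by (simp_all add: T triple_flags_def lines_def flags_def)
  then have sub: "\<forall>x\<in>components b c. subspace (component_space T x)"
    by (simp add: T components_def ball_Un)
  have "\<exists>us. distinct us \<and> independent (set us) \<and> span (set us) = S" if "subspace S" for S
  proof -
    obtain X where X: "X \<subseteq> S" "independent X" "S \<subseteq> span X"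
      by (rule basis_exists)
    obtain us where "set us = X" "distinct us"
      using finite_distinct_list[OF finiteI_independent[OF X(2)]] by blast
    moreover have "span X = S" by (rule span_subspace[OF X(1,3) that])
    ultimately show ?thesis using X(2) by blast
  qed
  then have "\<forall>x\<in>components b c. \<exists>us. distinct us \<and> independent (set us) \<and>
      span (set us) = component_space T x" using sub by simp
  then show ?thesis unfolding frame_def by (rule bchoice)
qed

lemma topspace_zariski_topology: "topspace (zariski_topology b c) = triple_flags b c"
proof -
  define P :: "(component \<times> 'b list, 'a) mpolynomial" where "P = 1"
  have keys: "Poly_Mapping.keys P = {0}" unfolding P_def by simp
  have "P \<in> multihomogeneous_polys b c"
    by (simp add: multihomogeneous_polys_def multihomogeneous_def mpoly_vars_def keys)
  moreover have "mpoly_eval \<alpha> P = 1" for \<alpha>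
    by (simp add: mpoly_eval_def keys) (simp add: P_def)
  then have "zero_locus b c P = {}"
    unfolding zero_locus_def using ex_frame by auto
  ultimately show ?thesis
    unfolding zariski_topology_def topology_generated_by_topspace by blast
qed

end

end

theory Submission
  imports Defs
begin

text \<open>
  In terms of sums of subspaces, the rank order says that \<open>dim (B\<^sub>i + C\<^sub>j)\<close> and
  \<open>dim (A + B\<^sub>i + C\<^sub>j)\<close> only drop under degeneration. This is necessary: contracting Pluecker vectors
  gives spanning vectors of \<open>A\<close>, \<open>B\<^sub>i\<close>, \<open>C\<^sub>j\<close> that are linear in the Pluecker coordinates, so minors
  formed from them are multihomogeneous polynomials that bound these dimensions.

  Conversely, let a triple flag \<open>T\<close> satisfy the rank conditions of \<open>(M', \<Delta>')\<close>. Every triple flag has an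
  adapted basis, so \<open>T\<close> lies in some orbit \<open>(M, \<Delta>)\<close>. By induction on the dimensions of the sums it is enough
  to move \<open>A\<close>, \<open>B\<close>, \<open>C\<close> separately by maps \<open>1 + t f\<close> with \<open>f\<^sup>2 = 0\<close> such that for \<open>t \<noteq> 0\<close> the moved
  triple still satisfies the rank conditions and some \<open>dim (B\<^sub>i + C\<^sub>j)\<close> grows: a polynomial that does not
  vanish at \<open>t = 0\<close> has finitely many zeros, and the field is infinite. If the matrices agree, moving \<open>A\<close>
  leads into the target orbit. Otherwise one of two moves works. The first adds to one basis vector of \<open>B\<close>
  a multiple of the sum of several basis vectors of larger position, usually those of \<open>\<Delta>\<close> that are
  reachable through cells where \<open>r(M) > r(M')\<close>. The second adds multiples of one basis vector \<open>y\<close> to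
  several vectors of \<open>\<Delta>\<close> in \<open>C\<close> and to the generator of \<open>A\<close>; it is needed only if everything below \<open>\<Delta>\<close>
  lies below \<open>\<Delta>'\<close> and all entries of \<open>M\<close> at positive cells are single and belong to \<open>\<Delta>\<close>.
\<close>

section \<open>Regions where the rank difference is positive\<close>

text \<open>The obstacle is the slack at each cell. Let \<open>R\<close> be the difference of the
  rank numbers and \<open>D\<close>, \<open>D'\<close> the cells below \<open>\<Delta>\<close>,
  \<open>\<Delta>'\<close>. At \<open>(i, j)\<close> a move may raise the dimension of
  \<open>B_i + C_j\<close> by at most \<open>R i j\<close>, and that of \<open>A + B_i + C_j\<close>
  by at most \<open>R i j + [D'] - [D]\<close>. So a vector can only be sent across cells with
  \<open>R > 0\<close>, and at a cell of \<open>D\<close> outside \<open>D'\<close> with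
  \<open>R = 1\<close> the sum with \<open>A\<close> must not grow at all. Adding a sum over
  \<open>\<Delta>\<close> achieves this: modulo the summands already in \<open>B_i + C_j\<close> it
  is the generator of \<open>A\<close>. Starting from a maximal position guarantees that all of
  \<open>\<Delta>\<close> above such a cell takes part. If the moved vector itself occurs in the
  generator of \<open>A\<close>, then \<open>A\<close> is disturbed even at cells with
  \<open>R = 0\<close>; the second move compensates this by a displacement of \<open>A\<close>, and
  its coefficients must fit all these cells at once. The induction runs over triple flags satisfying
  inequalities, so the orbit reached by a move never has to be determined.\<close>

text \<open>Inverts two-dimensional partial sums, so it recovers matrix entries from rank numbers.
  Since \<open>k - 1\<close> is truncated, it has this meaning only at positive indices.\<close>

definition mixed_diff :: "(nat \<Rightarrow> nat \<Rightarrow> int) \<Rightarrow> nat \<Rightarrow> nat \<Rightarrow> int" where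
  "mixed_diff R k l = R k l - R (k - 1) l - R k (l - 1) + R (k - 1) (l - 1)"

text \<open>The rectangle from \<open>(a, b)\<close> to \<open>(c, d)\<close>, vacuous if empty: the
  cells crossed when a vector at position \<open>(a, b)\<close> is sent to position
  \<open>(c + 1, d + 1)\<close>.\<close>

definition pos_on :: "(nat \<Rightarrow> nat \<Rightarrow> int) \<Rightarrow> nat \<Rightarrow> nat \<Rightarrow> nat \<Rightarrow> nat \<Rightarrow> bool" where
  "pos_on R a b c d \<longleftrightarrow> (\<forall>i j. a \<le> i \<longrightarrow> i \<le> c \<longrightarrow> b \<le> j \<longrightarrow> j \<le> d \<longrightarrow> 0 < R i j)"

lemma mixed_diff_indicator:
  assumes "0 < k" "0 < l" "0 < k'" "0 < l'"
  shows "mixed_diff (\<lambda>i j. if k \<le> i \<and> l \<le> j then 1 else 0) k' l' = (if (k', l') = (k, l) then 1 else 0)"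
  using assms
  by (cases k' k rule: linorder_cases; cases l' l rule: linorder_cases) (auto simp: mixed_diff_def)

text \<open>Left side minus right side telescopes to the sum of the mixed differences of row
  \<open>Suc i\<close> over the columns \<open>l + 1\<close> to \<open>l'\<close>.\<close>

lemma row_step:
  assumes "l \<le> l'" and "\<And>j. \<lbrakk>l < j; j \<le> l'\<rbrakk> \<Longrightarrow> mixed_diff R (Suc i) j \<le> 0"
  shows "R (Suc i) l' - R (Suc i) l \<le> R i l' - R i l"
  using assms
proof (induction rule: dec_induct)
  case base
  then show ?case by simp
next
  case (step n)
  have "R (Suc i) n - R (Suc i) l \<le> R i n - R i l"
    using step by (meson le_Suc_eq)
  moreover have "mixed_diff R (Suc i) (Suc n) \<le> 0"
    using step by simp
  ultimately show ?case by (simp add: mixed_diff_def)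
qed

lemma last_zero_below:
  fixes g :: "nat \<Rightarrow> int"
  assumes "\<And>j. j \<le> u \<Longrightarrow> 0 \<le> g j" and "l \<le> u" and "g l = 0"
  obtains m where "l \<le> m" "m \<le> u" "g m = 0" "\<And>j. \<lbrakk>m < j; j \<le> u\<rbrakk> \<Longrightarrow> 0 < g j"
proof -
  let ?S = "{m. l \<le> m \<and> m \<le> u \<and> g m = 0}"
  have fin: "finite ?S" by (rule finite_subset[of _ "{..u}"]) auto
  have ne: "?S \<noteq> {}" using assms by auto
  have "Max ?S \<in> ?S" using Max_in[OF fin ne] .
  moreover have "0 < g j" if "Max ?S < j" "j \<le> u" for j
  proof -
    have "j \<notin> ?S" using Max_ge[OF fin, of j] that(1) leD by blast
    then show ?thesis using assms(1)[of j] that \<open>Max ?S \<in> ?S\<close> by auto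
  qed
  ultimately show ?thesis using that by blast
qed

lemma first_zero_above:
  fixes g :: "nat \<Rightarrow> int"
  assumes "\<And>j. \<lbrakk>u \<le> j; j \<le> l\<rbrakk> \<Longrightarrow> 0 \<le> g j" and "u \<le> l" and "g l = 0"
  obtains m where "u \<le> m" "m \<le> l" "g m = 0" "\<And>j. \<lbrakk>u \<le> j; j < m\<rbrakk> \<Longrightarrow> 0 < g j"
proof -
  define m where "m = (LEAST m. u \<le> m \<and> g m = 0)"
  have m: "u \<le> m \<and> g m = 0" unfolding m_def
    by (rule LeastI[of _ l]) (use assms in auto)
  have le: "m \<le> l" unfolding m_def by (rule Least_le) (use assms in auto)
  have "0 < g j" if "u \<le> j" "j < m" for j
    using not_less_Least[of j "\<lambda>m. u \<le> m \<and> g m = 0"] that assms(1)[of j] le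
    unfolding m_def[symmetric] by force
  then show ?thesis using that m le by blast
qed

text \<open>
  Scanning the rows downwards: as long as no entry of \<open>M - M'\<close> in the reached region is positive,
  \<open>R i j0 - R i l\<close> cannot decrease, where \<open>l\<close> is the first column at which the region stops.
\<close>

lemma forward_scan:
  assumes nonneg: "\<And>i j. \<lbrakk>i0 \<le> i; i \<le> i1; j0 \<le> j; j \<le> b\<rbrakk> \<Longrightarrow> 0 \<le> R i j"
    and start: "0 < R i0 j0" and "j0 < b" and zero: "R i0 b = 0" and "i0 \<le> i1"
    and none: "\<And>e f. \<lbrakk>i0 < e; e \<le> i1; j0 < f; f \<le> b; pos_on R i0 j0 (e - 1) (f - 1)\<rbrakk>
      \<Longrightarrow> mixed_diff R e f \<le> 0"
  shows "\<exists>l. j0 < l \<and> l \<le> b \<and> pos_on R i0 j0 i1 (l - 1) \<and> R i1 l + R i0 j0 \<le> R i1 j0"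
  using \<open>i0 \<le> i1\<close> nonneg none
proof (induction rule: dec_induct)
  case base
  obtain m where m: "j0 \<le> m" "m \<le> b" "R i0 m = 0" "\<And>j. \<lbrakk>j0 \<le> j; j < m\<rbrakk> \<Longrightarrow> 0 < R i0 j"
    by (rule first_zero_above[of j0 b "R i0"]) (use base \<open>j0 < b\<close> zero in auto)
  have "j0 < m" using m start by (metis less_le_not_le nat_less_le)
  moreover have "pos_on R i0 j0 i0 (m - 1)"
    unfolding pos_on_def
  proof (intro allI impI)
    fix i j assume "i0 \<le> i" "i \<le> i0" "j0 \<le> j" "j \<le> m - 1"
    then have "i = i0" "j < m" using \<open>j0 < m\<close> by auto
    then show "0 < R i j" using m(4)[of j] \<open>j0 \<le> j\<close> by simp
  qed
  ultimately show ?case using m by auto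
next
  case (step i)
  have "\<exists>l>j0. l \<le> b \<and> pos_on R i0 j0 i (l - 1) \<and> R i l + R i0 j0 \<le> R i j0"
    by (rule step.IH) (use step.prems in auto)
  then obtain l where l: "j0 < l" "l \<le> b" "pos_on R i0 j0 i (l - 1)" "R i l + R i0 j0 \<le> R i j0"
    by blast
  have "R (Suc i) l - R (Suc i) j0 \<le> R i l - R i j0"
  proof (rule row_step)
    fix j assume j: "j0 < j" "j \<le> l"
    have "pos_on R i0 j0 i (j - 1)" using l(3) j unfolding pos_on_def by auto
    then show "mixed_diff R (Suc i) j \<le> 0"
      using step.prems(2)[of "Suc i" j] step.hyps j l by auto
  qed (use l in simp)
  then have k: "R (Suc i) l + R i0 j0 \<le> R (Suc i) j0" using l by simp
  have nn: "\<And>j. \<lbrakk>j0 \<le> j; j \<le> b\<rbrakk> \<Longrightarrow> 0 \<le> R (Suc i) j" using step by auto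
  have ext: "pos_on R i0 j0 (Suc i) (m - 1)"
    if "j0 < m" "m \<le> l" "\<And>j. \<lbrakk>j0 \<le> j; j < m\<rbrakk> \<Longrightarrow> 0 < R (Suc i) j" for m
    unfolding pos_on_def
  proof (intro allI impI)
    fix i' j assume *: "i0 \<le> i'" "i' \<le> Suc i" "j0 \<le> j" "j \<le> m - 1"
    then have "j < m" using \<open>j0 < m\<close> by auto
    then show "0 < R i' j"
      using that l(3) * unfolding pos_on_def by (cases "i' = Suc i") auto
  qed
  \<comment> \<open>The front \<open>l\<close> is kept unless the new row has a zero before it. Then
    it retreats to the first zero \<open>m\<close>, where the inequality reduces to
    \<open>R i0 j0 \<le> R (Suc i) j0\<close>; this follows from \<open>k\<close> because
    \<open>R (Suc i) l\<close> is nonnegative.\<close>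
  show ?case
  proof (cases "\<exists>l'. j0 < l' \<and> l' < l \<and> R (Suc i) l' = 0")
    case False
    have "0 < R (Suc i) j" if "j0 \<le> j" "j < l" for j
      using False nn[of j] that l k start nn[of l] by (cases "j = j0") force+
    then have "pos_on R i0 j0 (Suc i) (l - 1)"
      using ext[of l] l by blast
    then show ?thesis using l k by blast
  next
    case True
    then obtain l' where l': "j0 < l'" "l' < l" "R (Suc i) l' = 0" by blast
    obtain m where m: "j0 \<le> m" "m \<le> l'" "R (Suc i) m = 0" "\<And>j. \<lbrakk>j0 \<le> j; j < m\<rbrakk> \<Longrightarrow> 0 < R (Suc i) j"
      by (rule first_zero_above[of j0 l' "R (Suc i)"]) (use nn l' l in auto)
    have "R i0 j0 \<le> R (Suc i) j0" using k nn[of l] l by simp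
    then have "j0 < m" using m start by (metis le_less leD)
    moreover have "pos_on R i0 j0 (Suc i) (m - 1)"
      using ext[of m] m l' \<open>j0 < m\<close> by simp
    ultimately show ?thesis using m l' l \<open>R i0 j0 \<le> R (Suc i) j0\<close> by (intro exI[of _ m]) auto
  qed
qed

text \<open>If the scan met no positive entry down to row \<open>q\<close>, its inequality would
  read \<open>R i0 j0 \<le> 0\<close>, as \<open>R\<close> vanishes in that row. The position found
  has \<open>M > M'\<close> in the application, so it carries a basis vector, and only cells
  strictly before it are required to be positive.\<close>

lemma forward_exists:
  assumes nonneg: "\<And>i j. \<lbrakk>i \<le> q; j \<le> r\<rbrakk> \<Longrightarrow> 0 \<le> R i j"
    and zq: "\<And>j. j \<le> r \<Longrightarrow> R q j = 0" and zr: "\<And>i. i \<le> q \<Longrightarrow> R i r = 0"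
    and start: "0 < R i0 j0" and "i0 \<le> q" "j0 \<le> r"
  obtains e f where "i0 < e" "e \<le> q" "j0 < f" "f \<le> r" "pos_on R i0 j0 (e - 1) (f - 1)"
    "0 < mixed_diff R e f"
proof (rule ccontr)
  assume no: "\<not> thesis"
  have "j0 \<noteq> r" using start zr[of i0] assms by auto
  then have "j0 < r" using assms by simp
  have "\<exists>l. j0 < l \<and> l \<le> r \<and> pos_on R i0 j0 q (l - 1) \<and> R q l + R i0 j0 \<le> R q j0"
  proof (rule forward_scan)
    fix e f assume "i0 < e" "e \<le> q" "j0 < f" "f \<le> r" "pos_on R i0 j0 (e - 1) (f - 1)"
    then show "mixed_diff R e f \<le> 0" using that no by force
  qed (use assms \<open>j0 < r\<close> in auto)
  then show False using zq start \<open>j0 < r\<close> by (metis add_0 less_imp_le_nat not_less)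
qed

text \<open>Mirror image of the forward search, with a contradiction in row \<open>0\<close>. Here
  the positive rectangle contains \<open>(k, l)\<close> itself, since an entry at
  \<open>(k, l)\<close> counts in \<open>R i j\<close> as soon as \<open>k \<le> i\<close> and
  \<open>l \<le> j\<close>.\<close>

lemma backward_exists:
  assumes nonneg: "\<And>i j. \<lbrakk>i \<le> i1; j \<le> j1\<rbrakk> \<Longrightarrow> 0 \<le> R i j"
    and z0: "\<And>j. j \<le> j1 \<Longrightarrow> R 0 j = 0" and zc: "\<And>i. i \<le> i1 \<Longrightarrow> R i 0 = 0"
    and start: "0 < R i1 j1"
  obtains k l where "0 < k" "k \<le> i1" "0 < l" "l \<le> j1" "pos_on R k l i1 j1" "0 < mixed_diff R k l"
proof (rule ccontr)
  assume no: "\<not> thesis"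
  note found = that
  have none: "mixed_diff R k l \<le> 0"
    if "0 < k" "k \<le> i1" "0 < l" "l \<le> j1" "pos_on R k l i1 j1" for k l
    using found[OF that] no by linarith
  \<comment> \<open>\<open>d\<close> counts the rows climbed from \<open>i1\<close>, and
    \<open>l\<close> is the last column before the reached region. At \<open>d = i1\<close> the
    inequality lives in row \<open>0\<close>, where \<open>R\<close> vanishes.\<close>
  have "\<exists>l<j1. pos_on R (i1 - d) (Suc l) i1 j1 \<and> R (i1 - d) l + R i1 j1 \<le> R (i1 - d) j1" if "d \<le> i1" for d
    using that
  proof (induction d)
    case 0
    obtain m where m: "0 \<le> m" "m \<le> j1" "R i1 m = 0" "\<And>j. \<lbrakk>m < j; j \<le> j1\<rbrakk> \<Longrightarrow> 0 < R i1 j"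
      by (rule last_zero_below[of j1 "R i1" 0]) (use nonneg zc in auto)
    have "m < j1" using m start by (metis le_neq_implies_less less_irrefl)
    moreover have "pos_on R i1 (Suc m) i1 j1"
      using m unfolding pos_on_def by (metis Suc_le_eq le_antisym)
    ultimately show ?case using m by auto
  next
    case (Suc d)
    then obtain l where l: "l < j1" "pos_on R (i1 - d) (Suc l) i1 j1" "R (i1 - d) l + R i1 j1 \<le> R (i1 - d) j1"
      by auto
    define i where "i = i1 - Suc d"
    have i: "Suc i = i1 - d" using Suc.prems unfolding i_def by simp
    have nn: "\<And>j. j \<le> j1 \<Longrightarrow> 0 \<le> R i j" using nonneg i_def by auto
    have "R (Suc i) j1 - R (Suc i) l \<le> R i j1 - R i l"
    proof (rule row_step)
      fix j assume j: "l < j" "j \<le> j1"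
      have "pos_on R (Suc i) j i1 j1" using l(2) j i unfolding pos_on_def by auto
      then show "mixed_diff R (Suc i) j \<le> 0" using none[of "Suc i" j] i j by auto
    qed (use l in simp)
    then have k: "R i l + R i1 j1 \<le> R i j1" using l i by simp
    have ext: "pos_on R i (Suc m) i1 j1" if "l \<le> m" "\<And>j. \<lbrakk>m < j; j \<le> j1\<rbrakk> \<Longrightarrow> 0 < R i j" for m
      unfolding pos_on_def
    proof (intro allI impI)
      fix i' j assume *: "i \<le> i'" "i' \<le> i1" "Suc m \<le> j" "j \<le> j1"
      show "0 < R i' j"
      proof (cases "i' = i")
        case True
        then show ?thesis using that * by simp
      next
        case False
        then have "i1 - d \<le> i'" using * i by linarith
        then show ?thesis using l(2) * that(1) unfolding pos_on_def by auto
      qed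
    qed
    show ?case
    proof (cases "\<exists>l'. l < l' \<and> l' \<le> j1 \<and> R i l' = 0")
      case False
      then have "\<And>j. \<lbrakk>l < j; j \<le> j1\<rbrakk> \<Longrightarrow> 0 < R i j" using nn by force
      then show ?thesis using ext[of l] l k unfolding i_def by blast
    next
      case True
      then obtain l' where l': "l < l'" "l' \<le> j1" "R i l' = 0" by blast
      obtain m where m: "l' \<le> m" "m \<le> j1" "R i m = 0" "\<And>j. \<lbrakk>m < j; j \<le> j1\<rbrakk> \<Longrightarrow> 0 < R i j"
        by (rule last_zero_below[of j1 "R i" l']) (use nn l' in auto)
      have *: "R i1 j1 \<le> R i j1" using k nn[of l] l by simp
      then have "m < j1" using m start by (metis le_less leD)
      then show ?thesis using ext[of m] m l' * unfolding i_def by (intro exI[of _ m]) auto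
    qed
  qed
  from this[of i1] obtain l where "l < j1" "R 0 l + R i1 j1 \<le> R 0 j1" by auto
  then show False using z0 start by (metis add_0 less_imp_le_nat not_less order_refl)
qed

text \<open>
  Cell \<open>(i, j)\<close> stands for position \<open>(i + 1, j + 1)\<close>. In the application \<open>D\<close> and \<open>D'\<close> are the sets of
  cells whose position lies below \<open>\<Delta>\<close> and \<open>\<Delta>'\<close>, and \<open>R\<close> is the difference of the rank numbers
  of \<open>M\<close> and \<open>M'\<close>, so that \<open>mixed_diff R\<close> is \<open>M - M'\<close>; \<open>P\<close> is the support of \<open>M\<close>.
\<close>

locale staircase =
  fixes R :: "nat \<Rightarrow> nat \<Rightarrow> int" and q r :: nat and P D D' :: "nat \<Rightarrow> nat \<Rightarrow> bool"
  assumes nonneg: "\<And>i j. \<lbrakk>i \<le> q; j \<le> r\<rbrakk> \<Longrightarrow> 0 \<le> R i j"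
    and supp: "\<And>k l. \<lbrakk>0 < k; k \<le> q; 0 < l; l \<le> r; 0 < mixed_diff R k l\<rbrakk> \<Longrightarrow> P k l"
    and Dbd: "\<And>i j. D i j \<Longrightarrow> i < q \<and> j < r"
    and Ddown: "\<And>i j i' j'. \<lbrakk>D i j; i' \<le> i; j' \<le> j\<rbrakk> \<Longrightarrow> D i' j'"
    and D'down: "\<And>i j i' j'. \<lbrakk>D' i j; i' \<le> i; j' \<le> j\<rbrakk> \<Longrightarrow> D' i' j'"
    and posD: "\<And>i j. \<lbrakk>D i j; \<not> D' i j\<rbrakk> \<Longrightarrow> 0 < R i j"
begin

text \<open>The cells of row \<open>c\<close> from column \<open>d\<close> to the zero lie in
  \<open>D\<close> but outside \<open>D'\<close>, so \<open>R\<close> is positive on them. Were no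
  entry between the row of the zero and row \<open>c\<close> positive, the scan would bound a sum of
  two positive values of \<open>R\<close> by \<open>R c d = 1\<close>. So there is a positive entry,
  and from it a cell of \<open>D\<close> outside \<open>D'\<close> in row \<open>c\<close> can be
  reached, against maximality.\<close>

lemma reachable_half:
  assumes pos: "pos_on R i0 j0 c d" and "j0 \<le> d" and N: "\<not> D' c d" and one: "R c d = 1"
    and maxim: "\<And>k l c' d'. \<lbrakk>i0 < k; j0 < l; P k l; D c' d'; \<not> D' c' d'; k \<le> c'; l \<le> d';
       pos_on R k l c' d'\<rbrakk> \<Longrightarrow> False"
    and z: "i0 \<le> a" "a < c" "d < b" "D c b" "R a b = 0"
  shows False
proof -
  \<comment> \<open>The last row above \<open>c\<close> with such a zero is taken, so that the
    column of the entry found later has no zeros between that entry and row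
    \<open>c\<close>.\<close>
  define A where "A = {a. i0 \<le> a \<and> a < c \<and> (\<exists>b. d < b \<and> D c b \<and> R a b = 0)}"
  have fin: "finite A" unfolding A_def by (rule finite_subset[of _ "{..c}"]) auto
  have "a \<in> A" using z unfolding A_def by auto
  then have MA: "Max A \<in> A" using Max_in[OF fin] by auto
  define a' where "a' = Max A"
  obtain b' where a': "i0 \<le> a'" "a' < c" and b': "d < b'" "D c b'" "R a' b' = 0"
    using MA unfolding A_def a'_def by auto
  have bd: "c < q" "b' < r" using Dbd[OF b'(2)] by auto
  have pcol: "0 < R i d" if "a' \<le> i" "i \<le> c" for i
    using pos a' that \<open>j0 \<le> d\<close> unfolding pos_on_def by auto
  have rowc: "0 < R c l" if "d \<le> l" "l \<le> b'" for l
    using posD[of c l] Ddown[OF b'(2)] D'down[of c l c d] N that by blast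
  have "\<exists>e f. a' < e \<and> e \<le> c \<and> d < f \<and> f \<le> b' \<and> 0 < mixed_diff R e f \<and> pos_on R a' d (e - 1) (f - 1)"
  proof (rule ccontr)
    assume no: "\<not> ?thesis"
    have "\<exists>l. d < l \<and> l \<le> b' \<and> pos_on R a' d c (l - 1) \<and> R c l + R a' d \<le> R c d"
    proof (rule forward_scan)
      fix e f assume "a' < e" "e \<le> c" "d < f" "f \<le> b'" "pos_on R a' d (e - 1) (f - 1)"
      then show "mixed_diff R e f \<le> 0" using no by force
    qed (use nonneg bd a' b' pcol in auto)
    then obtain l where "d < l" "l \<le> b'" "R c l + R a' d \<le> R c d" by blast
    then show False using pcol[of a'] rowc[of l] one a' by simp
  qed
  then obtain e f where ef: "a' < e" "e \<le> c" "d < f" "f \<le> b'" "0 < mixed_diff R e f" by blast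
  have "P e f" using supp[of e f] ef bd by auto
  have "0 < R g f" if "e \<le> g" "g \<le> c" for g
  proof (cases "g = c")
    case True
    then show ?thesis using rowc[of f] ef by simp
  next
    case False
    then have "g < c" using that by simp
    have "g \<notin> A" using Max_ge[OF fin, of g] that ef unfolding a'_def by auto
    then have "R g f \<noteq> 0" using \<open>g < c\<close> a' ef that Ddown[OF b'(2), of c f] unfolding A_def by auto
    then show ?thesis using nonneg[of g f] that ef bd by simp
  qed
  then have "pos_on R e f c f" unfolding pos_on_def by (metis le_antisym)
  moreover have "D c f" "\<not> D' c f" using Ddown[OF b'(2), of c f] D'down[of c f c d] N ef by auto
  ultimately show False using maxim[of e f c f] \<open>P e f\<close> ef a' \<open>j0 \<le> d\<close> by auto
qed

text \<open>A zero in the larger rectangle lies in \<open>D\<close>, hence in \<open>D'\<close> by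
  \<open>posD\<close>. So it is not above \<open>(c, d)\<close>, and it is not in the given positive
  rectangle either. What remains are the two regions excluded by \<open>reachable_half\<close> and
  its transpose.\<close>

lemma reachable_above:
  assumes pos: "pos_on R i0 j0 c d" and "i0 \<le> c" "j0 \<le> d" and N: "\<not> D' c d" and one: "R c d = 1"
    and maxim: "\<And>k l c' d'. \<lbrakk>i0 < k; j0 < l; P k l; D c' d'; \<not> D' c' d'; k \<le> c'; l \<le> d';
       pos_on R k l c' d'\<rbrakk> \<Longrightarrow> False"
    and u: "c \<le> u" "d \<le> w" "D u w"
  shows "pos_on R i0 j0 u w"
proof (rule ccontr)
  assume "\<not> ?thesis"
  then obtain a b where ab: "i0 \<le> a" "a \<le> u" "j0 \<le> b" "b \<le> w" "\<not> 0 < R a b"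
    unfolding pos_on_def by auto
  have "D a b" using Ddown[OF u(3)] ab by blast
  then have R0: "R a b = 0" using nonneg[of a b] Dbd[of a b] ab by auto
  have D': "D' a b" using posD[OF \<open>D a b\<close>] ab by blast
  have "\<not> (a \<le> c \<and> b \<le> d)" using pos ab unfolding pos_on_def by auto
  moreover have "\<not> (c \<le> a \<and> d \<le> b)" using D'down[OF D'] N by blast
  ultimately consider "a < c" "d < b" | "c < a" "b < d" by linarith
  then show False
  proof cases
    case 1
    have "D c b" using Ddown[OF u(3), of c b] ab u by simp
    show False
      by (rule reachable_half[OF pos \<open>j0 \<le> d\<close> N one maxim ab(1) 1 \<open>D c b\<close> R0])
  next
    case 2
    \<comment> \<open>The zero is below and to the left of \<open>(c, d)\<close>. Exchanging rows
      and columns reduces this to the other case.\<close>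
    define R2 where "R2 = (\<lambda>i j. R j i)"
    have md: "mixed_diff R2 k l = mixed_diff R l k" for k l
      unfolding R2_def mixed_diff_def by simp
    have po: "pos_on R2 k l i j \<longleftrightarrow> pos_on R l k j i" for k l i j
      unfolding R2_def pos_on_def by blast
    interpret transpose: staircase R2 r q "\<lambda>i j. P j i" "\<lambda>i j. D j i" "\<lambda>i j. D' j i"
    proof
      show "P l k" if "0 < k" "k \<le> r" "0 < l" "l \<le> q" "0 < mixed_diff R2 k l" for k l
        using supp[of l k] that md by simp
      show "0 \<le> R2 i j" if "i \<le> r" "j \<le> q" for i j using nonneg that unfolding R2_def by simp
      show "i < r \<and> j < q" if "D j i" for i j using Dbd that by blast
      show "D j' i'" if "D j i" "i' \<le> i" "j' \<le> j" for i j i' j' using Ddown that by blast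
      show "D' j' i'" if "D' j i" "i' \<le> i" "j' \<le> j" for i j i' j' using D'down that by blast
      show "0 < R2 i j" if "D j i" "\<not> D' j i" for i j using posD that unfolding R2_def by simp
    qed
    show False
    proof (rule transpose.reachable_half[of j0 i0 d c b a])
      show "pos_on R2 j0 i0 d c" using pos po by simp
      show False if "j0 < k" "i0 < l" "P l k" "D d' c'" "\<not> D' d' c'" "k \<le> c'" "l \<le> d'"
        "pos_on R2 k l c' d'" for k l c' d'
        using maxim[of l k d' c'] that po by simp
      show "D a d" using Ddown[OF u(3)] ab u by simp
    qed (use assms ab 2 R0 in \<open>simp_all add: R2_def\<close>)
  qed
qed

end

section \<open>Bad cells and coefficients of the second move\<close>

text \<open>The situation of the second move, with \<open>m\<close>, \<open>m'\<close> for
  \<open>M\<close>, \<open>M'\<close> and \<open>(i1, j1)\<close> for the position of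
  \<open>y\<close>. All that is kept of \<open>\<Delta>'\<close> is \<open>below\<close>: each
  position of \<open>\<Delta>\<close> lies under a position where \<open>m'\<close> is positive and
  whose smaller cells are all in \<open>D'\<close>.\<close>

locale blocked_cells =
  fixes R :: "nat \<Rightarrow> nat \<Rightarrow> int" and q r i1 j1 :: nat and m m' :: "nat \<Rightarrow> nat \<Rightarrow> nat"
    and \<Delta> :: "(nat \<times> nat) set" and D' :: "nat \<Rightarrow> nat \<Rightarrow> bool"
  assumes nonneg: "\<And>i j. \<lbrakk>i \<le> q; j \<le> r\<rbrakk> \<Longrightarrow> 0 \<le> R i j"
    and R0: "\<And>j. j \<le> r \<Longrightarrow> R 0 j = 0" "\<And>i. i \<le> q \<Longrightarrow> R i 0 = 0"
    and y: "i1 \<le> q" "j1 \<le> r"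
    and D'down: "\<And>i j i' j'. \<lbrakk>D' i j; i' \<le> i; j' \<le> j\<rbrakk> \<Longrightarrow> D' i' j'"
    and anti: "\<And>k l k' l'. \<lbrakk>(k, l) \<in> \<Delta>; (k', l') \<in> \<Delta>; (k, l) \<noteq> (k', l')\<rbrakk>
      \<Longrightarrow> k < k' \<and> l' < l \<or> k' < k \<and> l < l'"
    and \<Delta>bd: "\<And>k l. (k, l) \<in> \<Delta> \<Longrightarrow> 0 < k \<and> k \<le> q \<and> 0 < l \<and> l \<le> r"
    and md: "\<And>k l. \<lbrakk>0 < k; k \<le> q; 0 < l; l \<le> r\<rbrakk> \<Longrightarrow> mixed_diff R k l = int (m k l) - int (m' k l)"
    and supp: "\<And>k l. \<lbrakk>0 < k; k \<le> q; 0 < l; l \<le> r; 0 < m k l; 0 < R k l\<rbrakk> \<Longrightarrow> (k, l) \<in> \<Delta> \<and> m k l = 1"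
    and below: "\<And>k l. (k, l) \<in> \<Delta> \<Longrightarrow> \<exists>k' l'. k \<le> k' \<and> k' \<le> q \<and> l \<le> l' \<and> l' \<le> r \<and> 0 < m' k' l'
      \<and> (\<forall>i j. i < k' \<longrightarrow> j < l' \<longrightarrow> D' i j)"
begin

text \<open>Moving \<open>x\<close> by a multiple of \<open>y\<close> raises the dimension of
  \<open>B_i + C_j\<close> at all cells from \<open>x\<close> up to \<open>(i1 - 1, j1 - 1)\<close>,
  so \<open>R\<close> must be positive on that whole rectangle.\<close>

definition X :: "(nat \<times> nat) set" where
  "X = {(k, l) \<in> \<Delta>. k < i1 \<and> l < j1 \<and> pos_on R k l (i1 - 1) (j1 - 1)}"

text \<open>
  Moving \<open>C\<close> by \<open>x \<mapsto> x + t \<beta>\<^sub>x y\<close> for \<open>x \<in> X\<close>, with \<open>y\<close> at position \<open>(i1, j1)\<close>, and \<open>A\<close> by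
  \<open>a \<mapsto> a + t \<gamma> y\<close> respects the rank condition of \<open>(M', \<Delta>')\<close> at a bad cell \<open>(i, j)\<close> only if \<open>\<gamma>\<close> is the
  sum of the \<open>\<beta>\<^sub>x\<close> over the \<open>x\<close> in columns up to \<open>j\<close>. Such sums can be prescribed with all \<open>\<beta>\<^sub>x\<close> nonzero
  because two bad cells never differ by exactly one \<open>x\<close>.
\<close>

definition bad :: "nat \<Rightarrow> nat \<Rightarrow> bool" where
  "bad i j \<longleftrightarrow> i < i1 \<and> j < j1 \<and> R i j = 0 \<and> \<not> D' i j"

lemma X_pos:
  assumes "(k, l) \<in> X" "k \<le> i" "l \<le> j" "i < i1" "j < j1"
  shows "0 < R i j"
  using assms unfolding X_def pos_on_def by auto

text \<open>A bad cell is not above \<open>x\<close>, because \<open>R\<close> is positive there,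
  and not strictly below \<open>x\<close> in both coordinates, because by \<open>below\<close> it
  would lie in \<open>D'\<close>. So each bad cell separates \<open>X\<close> into the elements to
  its left and those beyond its row.\<close>

lemma bad_sides:
  assumes "bad i j" "(k, l) \<in> X"
  shows "l \<le> j \<longleftrightarrow> i < k"
proof
  assume "l \<le> j"
  then show "i < k" using X_pos[OF assms(2), of i j] assms(1) unfolding bad_def by force
next
  assume "i < k"
  have "(k, l) \<in> \<Delta>" using assms(2) unfolding X_def by auto
  from below[OF this] obtain k' l' where "k \<le> k'" "l \<le> l'" "\<forall>i j. i < k' \<longrightarrow> j < l' \<longrightarrow> D' i j" by blast
  then show "l \<le> j" using assms(1) \<open>i < k\<close> unfolding bad_def by (meson less_le_trans not_le)
qed

text \<open>Bad cells that cut \<open>X\<close> at the same column form a class in a finite set. It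
  is used with \<open>h\<close> the row and with \<open>h\<close> the column.\<close>

lemma extremal_bad:
  fixes h :: "nat \<Rightarrow> nat \<Rightarrow> nat"
  assumes "bad i j"
  obtains i' j' where "bad i' j'" "\<forall>x\<in>X. snd x \<le> j' \<longleftrightarrow> snd x \<le> j"
    "\<And>i'' j''. \<lbrakk>bad i'' j''; \<forall>x\<in>X. snd x \<le> j'' \<longleftrightarrow> snd x \<le> j\<rbrakk> \<Longrightarrow> h i'' j'' \<le> h i' j'"
proof -
  define S where "S = {p. bad (fst p) (snd p) \<and> (\<forall>x\<in>X. snd x \<le> snd p \<longleftrightarrow> snd x \<le> j)}"
  define H where "H = (\<lambda>p. h (fst p) (snd p)) ` S"
  have "finite S" by (rule finite_subset[of _ "{..i1} \<times> {..j1}"]) (auto simp: S_def bad_def)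
  then have fin: "finite H" unfolding H_def by (rule finite_imageI)
  have "(i, j) \<in> S" using assms unfolding S_def by simp
  then have "Max H \<in> H" using Max_in[OF fin] unfolding H_def by blast
  then obtain p where p: "p \<in> S" "Max H = h (fst p) (snd p)" unfolding H_def by blast
  show ?thesis
  proof (rule that[of "fst p" "snd p"])
    fix i'' j'' assume "bad i'' j''" "\<forall>x\<in>X. snd x \<le> j'' \<longleftrightarrow> snd x \<le> j"
    then have "(i'', j'') \<in> S" unfolding S_def by simp
    then have "h i'' j'' \<in> H" unfolding H_def by force
    then show "h i'' j'' \<le> h (fst p) (snd p)" using Max_ge[OF fin] p(2) by metis
  qed (use p(1) in \<open>auto simp: S_def\<close>)
qed

text \<open>After removing \<open>x\<close> from \<open>M\<close> and one entry of \<open>M'\<close>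
  at a position of \<open>below\<close>, the modified difference \<open>S\<close> is still
  nonnegative on the rectangle up to \<open>(i, j2)\<close> and positive at its corner; badness of
  the two cells puts \<open>(a, b)\<close> inside that rectangle. The backward search for
  \<open>S\<close> finds a position of \<open>M\<close> other than \<open>x\<close>: the entry at
  \<open>x\<close> is single and has been removed.\<close>

lemma second_support:
  assumes x: "(k, l) \<in> X" and e: "bad i j" "bad i2 j2" and s: "i2 < k" "k \<le> i" "j < l" "l \<le> j2"
  obtains k' l' where "(k', l') \<in> \<Delta>" "(k', l') \<noteq> (k, l)" "k' \<le> i" "l' \<le> j2" "pos_on R k' l' i j2"
proof -
  have bd: "i < i1" "j2 < j1" using e unfolding bad_def by auto
  have x\<Delta>: "(k, l) \<in> \<Delta>" using x unfolding X_def by auto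
  obtain a b where ab: "k \<le> a" "a \<le> q" "l \<le> b" "b \<le> r" "0 < m' a b"
    "\<forall>i j. i < a \<longrightarrow> j < b \<longrightarrow> D' i j" using below[OF x\<Delta>] by blast
  have "a \<le> i" using ab(6) e(1) s ab(3) unfolding bad_def by (meson less_le_trans not_le)
  have "b \<le> j2" using ab(6) e(2) s ab(1) unfolding bad_def by (meson less_le_trans not_le)
  \<comment> \<open>remove \<open>x\<close> from \<open>M\<close> and one entry at \<open>(a, b)\<close> from \<open>M'\<close>\<close>
  define S where "S = (\<lambda>i j. R i j - (if k \<le> i \<and> l \<le> j then 1 else 0) + (if a \<le> i \<and> b \<le> j then 1 else 0))"
  have Rpos: "0 < R u v" if "k \<le> u" "u \<le> i" "l \<le> v" "v \<le> j2" for u v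
    using X_pos[OF x, of u v] that bd by simp
  have SR: "S u v \<le> R u v" for u v using ab unfolding S_def by auto
  have k0: "0 < k" "0 < l" "k \<le> q" "l \<le> r" using \<Delta>bd[OF x\<Delta>] by auto
  obtain k' l' where kl: "0 < k'" "k' \<le> i" "0 < l'" "l' \<le> j2" "pos_on S k' l' i j2" "0 < mixed_diff S k' l'"
  proof (rule backward_exists[of i j2 S])
    show "0 \<le> S u v" if "u \<le> i" "v \<le> j2" for u v
      using Rpos[of u v] nonneg[of u v] that bd y unfolding S_def by auto
    show "S 0 v = 0" if "v \<le> j2" for v using R0 that bd y k0 ab unfolding S_def by auto
    show "S u 0 = 0" if "u \<le> i" for u using R0 that bd y k0 ab unfolding S_def by auto
    show "0 < S i j2" using Rpos[of i j2] s \<open>a \<le> i\<close> \<open>b \<le> j2\<close> unfolding S_def by auto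
  qed blast
  have pos: "pos_on R k' l' i j2" using kl(5) SR unfolding pos_on_def by (meson less_le_trans)
  have "mixed_diff S k' l' = mixed_diff R k' l' - (if (k', l') = (k, l) then 1 else 0)
      + (if (k', l') = (a, b) then 1 else 0)"
    using mixed_diff_indicator[of k l k' l'] mixed_diff_indicator[of a b k' l'] kl k0 ab
    unfolding mixed_diff_def S_def by linarith
  also have "mixed_diff R k' l' = int (m k' l') - int (m' k' l')"
    by (rule md) (use kl bd y in auto)
  finally have eq: "mixed_diff S k' l' = int (m k' l') - int (m' k' l')
      - (if (k', l') = (k, l) then 1 else 0) + (if (k', l') = (a, b) then 1 else 0)" .
  have m0: "0 < m k' l'" using eq kl(6) ab(5) by (auto split: if_splits)
  have "0 < R k' l'" using pos kl unfolding pos_on_def by auto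
  then have "(k', l') \<in> \<Delta>" "m k' l' = 1" using supp[of k' l'] m0 kl bd y by auto
  moreover have "(k', l') \<noteq> (k, l)" using eq kl(6) ab(5) \<open>m k' l' = 1\<close> by (auto split: if_splits)
  ultimately show ?thesis using that kl pos by blast
qed

text \<open>Take the lowest bad cell \<open>(a, b)\<close> of the first class and the rightmost
  \<open>(c, d)\<close> of the second. Then \<open>second_support\<close> gives another position of
  \<open>\<Delta>\<close> between them. It is not in \<open>X\<close> by \<open>adj\<close>, so its
  rectangle towards \<open>y\<close> contains a zero \<open>(f, g)\<close>, which is not above
  \<open>x\<close>. By the antichain property there are two cases, and in each the zero is a bad
  cell of one of the two classes that lies beyond its extremal cell.\<close>

lemma bad_not_adjacent:
  assumes "bad i j" "bad i2 j2" and x: "(k, l) \<in> X" and s: "j < l" "l \<le> j2"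
    and adj: "\<And>x'. \<lbrakk>x' \<in> X; x' \<noteq> (k, l)\<rbrakk> \<Longrightarrow> snd x' \<le> j \<longleftrightarrow> snd x' \<le> j2"
  shows False
proof -
  obtain a b where ab: "bad a b" "\<forall>x\<in>X. snd x \<le> b \<longleftrightarrow> snd x \<le> j"
    "\<And>i'' j''. \<lbrakk>bad i'' j''; \<forall>x\<in>X. snd x \<le> j'' \<longleftrightarrow> snd x \<le> j\<rbrakk> \<Longrightarrow> i'' \<le> a"
    by (rule extremal_bad[OF assms(1), of "\<lambda>i j. i"]) (rule that)
  obtain c d where cd: "bad c d" "\<forall>x\<in>X. snd x \<le> d \<longleftrightarrow> snd x \<le> j2"
    "\<And>i'' j''. \<lbrakk>bad i'' j''; \<forall>x\<in>X. snd x \<le> j'' \<longleftrightarrow> snd x \<le> j2\<rbrakk> \<Longrightarrow> j'' \<le> d"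
    by (rule extremal_bad[OF assms(2), of "\<lambda>i j. j"]) (rule that)
  have bl: "b < l" and ld: "l \<le> d" using ab(2) cd(2) x s by (auto dest: bspec[of X _ "(k, l)"])
  have ck: "c < k" using bad_sides[OF cd(1) x] ld by simp
  have ka: "k \<le> a" using bad_sides[OF ab(1) x] bl by simp
  have bds: "a < i1" "b < j1" "c < i1" "d < j1" "R a b = 0" "R c d = 0" "\<not> D' a b" "\<not> D' c d"
    using ab(1) cd(1) unfolding bad_def by auto
  obtain k' l' where kl: "(k', l') \<in> \<Delta>" "(k', l') \<noteq> (k, l)" "k' \<le> a" "l' \<le> d" "pos_on R k' l' a d"
    by (rule second_support[OF x ab(1) cd(1) ck ka bl ld])
  have bl': "b < l'" using kl(5,3) bds(5) bl ld unfolding pos_on_def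
    by (metis less_irrefl less_le_trans less_or_eq_imp_le not_le order_refl)
  have ck': "c < k'" using kl(5,4) bds(6) ck ka unfolding pos_on_def
    by (metis less_irrefl less_le_trans less_or_eq_imp_le not_le order_refl)
  have notX: "(k', l') \<notin> X"
  proof
    assume "(k', l') \<in> X"
    then have "l' \<le> b \<longleftrightarrow> l' \<le> d" using adj[of "(k', l')"] kl(2) ab(2) cd(2) by force
    then show False using bl' kl(4) by simp
  qed
  then obtain f g where fg: "k' \<le> f" "f < i1" "l' \<le> g" "g < j1" "\<not> 0 < R f g"
    using kl bds unfolding X_def pos_on_def by fastforce
  have R0: "R f g = 0" using fg nonneg[of f g] y by simp
  have notx: "\<not> (k \<le> f \<and> l \<le> g)" using X_pos[OF x, of f g] fg R0 by auto
  have notin: "\<not> (f \<le> a \<and> g \<le> d)" using kl(5) fg(1,3) R0 unfolding pos_on_def by fastforce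
  have x\<Delta>: "(k, l) \<in> \<Delta>" using x unfolding X_def by auto
  from anti[OF kl(1) x\<Delta> kl(2)] consider "k < k'" "l' < l" | "k' < k" "l < l'" by blast
  then show False
  proof cases
    case 1
    have "g < l" using notx fg 1 by auto
    then have "a < f" using notin ld by auto
    have "\<not> D' f g" using bds(7) D'down[of f g a b] \<open>a < f\<close> bl' fg by auto
    then have b: "bad f g" using fg R0 unfolding bad_def by auto
    have "\<forall>x\<in>X. snd x \<le> g \<longleftrightarrow> snd x \<le> j"
    proof
      fix x' assume x': "x' \<in> X"
      show "snd x' \<le> g \<longleftrightarrow> snd x' \<le> j"
      proof
        assume "snd x' \<le> g"
        then have "snd x' \<le> d" "x' \<noteq> (k, l)" using \<open>g < l\<close> ld by auto
        then show "snd x' \<le> j" using adj[OF x'] cd(2) x' by auto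
      next
        assume "snd x' \<le> j"
        then have "snd x' \<le> b" using ab(2) x' by auto
        then show "snd x' \<le> g" using bl' fg by simp
      qed
    qed
    from ab(3)[OF b this] show False using \<open>a < f\<close> by simp
  next
    case 2
    have "f < k" using notx fg 2 by auto
    then have "d < g" using notin ka by auto
    have "\<not> D' f g" using bds(8) D'down[of f g c d] \<open>d < g\<close> ck' fg by auto
    then have b: "bad f g" using fg R0 unfolding bad_def by auto
    have "\<forall>x\<in>X. snd x \<le> g \<longleftrightarrow> snd x \<le> j2"
    proof
      fix x' assume x': "x' \<in> X"
      obtain k2 l2 where [simp]: "x' = (k2, l2)" by (cases x')
      show "snd x' \<le> g \<longleftrightarrow> snd x' \<le> j2"
      proof
        assume "snd x' \<le> g"
        then have "f < k2" using bad_sides[OF b] x' by simp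
        then have "c < k2" using ck' fg by simp
        then have "l2 \<le> d" using bad_sides[OF cd(1)] x' by simp
        then show "snd x' \<le> j2" using cd(2) x' by auto
      next
        assume "snd x' \<le> j2"
        then have "snd x' \<le> d" using cd(2) x' by auto
        then show "snd x' \<le> g" using \<open>d < g\<close> by simp
      qed
    qed
    from cd(3)[OF b this] show False using \<open>d < g\<close> by simp
  qed
qed

lemma finite_X: "finite X"
  by (rule finite_subset[of _ "{..q} \<times> {..r}"]) (use \<Delta>bd in \<open>auto simp: X_def\<close>)

text \<open>The coefficients are successive differences of a function \<open>F\<close> of the number
  of elements of \<open>X\<close> already passed, so partial sums telescope to
  \<open>F 0 - F (N j)\<close>. It suffices that \<open>F\<close> vanishes at the counts of bad
  cells and that consecutive values differ.\<close>

lemma gap_coefficients: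
  assumes inf: "infinite (UNIV :: 'k::field set)"
  obtains \<beta> :: "nat \<times> nat \<Rightarrow> 'k::field" and \<gamma> :: "'k::field" where "\<And>x. x \<in> X \<Longrightarrow> \<beta> x \<noteq> 0"
    "\<And>i j. bad i j \<Longrightarrow> (\<Sum>x\<in>{x \<in> X. snd x \<le> j}. \<beta> x) = \<gamma>"
proof -
  define N where "N j = card {x \<in> X. snd x \<le> j}" for j
  define B where "B u \<longleftrightarrow> (\<exists>i j. bad i j \<and> N j = u)" for u
  have "infinite (UNIV - {0 :: 'k})" using inf by simp
  then obtain g :: "nat \<Rightarrow> 'k" where g: "inj g" "range g \<subseteq> UNIV - {0}"
    using infinite_countable_subset by blast
  \<comment> \<open>Distinct nonzero values \<open>g u\<close> away from bad counts: consecutive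
    values can then agree only if both counts are bad, which \<open>nadj\<close> excludes. The
    infinite field supplies \<open>g\<close>.\<close>
  define F where "F u = (if B u then 0 else g u)" for u
  define \<beta> where "\<beta> x = F (N (snd x - 1)) - F (N (snd x))" for x :: "nat \<times> nat"
  have inj: "x = x'" if "x \<in> X" "x' \<in> X" "snd x = snd x'" for x x'
  proof -
    have "x \<in> \<Delta>" "x' \<in> \<Delta>" using that unfolding X_def by auto
    then show ?thesis using anti[of "fst x" "snd x" "fst x'" "snd x'"] that(3)
      by (metis less_irrefl prod.collapse)
  qed
  have split: "{x \<in> X. snd x \<le> Suc j} = insert x {x \<in> X. snd x \<le> j}" if "x \<in> X" "snd x = Suc j" for x j
    using inj[OF that(1)] that unfolding le_Suc_eq by fastforce
  have N_step: "N (Suc j) = Suc (N j)" if "x \<in> X" "snd x = Suc j" for x j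
    unfolding N_def split[OF that] using finite_X that by simp
  have pos: "0 < snd x" if "x \<in> X" for x using \<Delta>bd[of "fst x" "snd x"] that unfolding X_def by auto
  have sum: "(\<Sum>x\<in>{x \<in> X. snd x \<le> j}. \<beta> x) = F 0 - F (N j)" for j
  proof (induction j)
    case 0
    have "{x \<in> X. snd x \<le> 0} = {}" using pos by force
    then show ?case unfolding N_def by (simp only: sum.empty card.empty diff_self)
  next
    case (Suc j)
    show ?case
    proof (cases "\<exists>x\<in>X. snd x = Suc j")
      case True
      then obtain x where x: "x \<in> X" "snd x = Suc j" by blast
      have "(\<Sum>x\<in>{x \<in> X. snd x \<le> Suc j}. \<beta> x) = \<beta> x + (\<Sum>x\<in>{x \<in> X. snd x \<le> j}. \<beta> x)"
        unfolding split[OF x] using finite_X x by simp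
      then show ?thesis using Suc x by (simp add: \<beta>_def)
    next
      case False
      then have "{x \<in> X. snd x \<le> Suc j} = {x \<in> X. snd x \<le> j}" by (auto simp: le_Suc_eq)
      then show ?thesis using Suc by (simp add: N_def)
    qed
  qed
  \<comment> \<open>Counts \<open>u\<close> and \<open>Suc u\<close> of two bad cells would mean
    that exactly one element of \<open>X\<close> lies between them.\<close>
  have nadj: "\<not> (B u \<and> B (Suc u))" for u
  proof
    assume "B u \<and> B (Suc u)"
    then obtain i j i2 j2 where b: "bad i j" "bad i2 j2" "N j = u" "N j2 = Suc u" unfolding B_def by blast
    have "j < j2"
    proof (rule ccontr)
      assume "\<not> j < j2"
      then have "N j2 \<le> N j" unfolding N_def by (intro card_mono) (use finite_X in auto)
      then show False using b by simp
    qed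
    then have sub: "{x \<in> X. snd x \<le> j} \<subseteq> {x \<in> X. snd x \<le> j2}" by auto
    have "card ({x \<in> X. snd x \<le> j2} - {x \<in> X. snd x \<le> j}) = 1"
      using card_Diff_subset[OF _ sub] finite_X b unfolding N_def by simp
    then obtain x where x: "{x \<in> X. snd x \<le> j2} - {x \<in> X. snd x \<le> j} = {x}" by (rule card_1_singletonE)
    have *: "x \<in> X" "snd x \<le> j2" "\<not> snd x \<le> j" using x by auto
    show False
      by (rule bad_not_adjacent[OF b(1,2), of "fst x" "snd x"]) (use * x sub in auto)
  qed
  show ?thesis
  proof (rule that[of \<beta> "F 0"])
    fix x assume x: "x \<in> X"
    have "N (snd x) = Suc (N (snd x - 1))" using N_step[of x "snd x - 1"] x pos[OF x] by simp
    then have "\<beta> x = F (N (snd x - 1)) - F (Suc (N (snd x - 1)))" unfolding \<beta>_def by simp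
    moreover have "F u \<noteq> F (Suc u)" for u
      using nadj[of u] g injD[OF g(1), of u "Suc u"] unfolding F_def by (auto simp: image_subset_iff) 
    ultimately show "\<beta> x \<noteq> 0" by simp
  next
    fix i j assume "bad i j"
    then have "F (N j) = 0" unfolding F_def B_def by auto
    then show "(\<Sum>x\<in>{x \<in> X. snd x \<le> j}. \<beta> x) = F 0" unfolding sum by simp
  qed
qed

end

section \<open>Curves of triple flags\<close>

lemma poly_eval_ring_hom: "comm_ring_hom (\<lambda>p. poly p (a :: 'a::comm_ring_1))"
  by unfold_locales auto

lemma det_poly_entries:
  fixes Q :: "nat \<Rightarrow> nat \<Rightarrow> 'a::comm_ring_1 poly"
  shows "det (mat n n (\<lambda>(k, l). poly (Q k l) t)) = poly (det (mat n n (\<lambda>(k, l). Q k l))) t"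
proof -
  interpret comm_ring_hom "\<lambda>p. poly p t" by (rule poly_eval_ring_hom)
  have "mat n n (\<lambda>(k, l). poly (Q k l) t) = map_mat (\<lambda>p. poly p t) (mat n n (\<lambda>(k, l). Q k l))"
    by (rule eq_matI) auto
  then show ?thesis by (simp only: hom_det)
qed

context flag_space
begin

abbreviation lin :: "('b \<Rightarrow> 'b) \<Rightarrow> bool" where
  "lin \<equiv> Vector_Spaces.linear scale scale"

lemma rep_add: "representation Basis (x + y) e = representation Basis x e + representation Basis y e"
  using representation_add[OF independent_Basis, of y x] by (simp add: span_Basis)

lemma rep_scale: "representation Basis (scale a x) e = a * representation Basis x e"
  using representation_scale[OF independent_Basis, of x a] by (simp add: span_Basis)

lemma rep_zero: "representation Basis 0 e = 0"
  by (simp add: representation_zero)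

lemma rep_sum: "representation Basis (\<Sum>i\<in>S. g i) e = (\<Sum>i\<in>S. representation Basis (g i) e)"
  by (induction S rule: infinite_finite_induct) (auto simp: rep_add rep_zero)

lemma rep_expand: "(\<Sum>e\<in>Basis. scale (representation Basis x e) e) = x"
  using sum_representation_eq[OF independent_Basis _ finite_Basis order_refl] by (simp add: span_Basis)

lemma rep_eqI:
  assumes "\<And>e. e \<in> Basis \<Longrightarrow> representation Basis x e = representation Basis y e"
  shows "x = y"
proof -
  have "(\<Sum>e\<in>Basis. scale (representation Basis x e) e) = (\<Sum>e\<in>Basis. scale (representation Basis y e) e)"
    using assms by (intro sum.cong) auto
  then show ?thesis by (simp only: rep_expand)
qed

text \<open>The entries of the coordinate matrices are affine in \<open>t\<close>, so their
  determinants, and polynomials in these, are polynomials in \<open>t\<close>.\<close>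

lemma pluecker_curve_poly:
  "\<exists>p. \<forall>t. mpoly_eval (pluecker (\<lambda>x. map (\<lambda>v. v + scale t (f x v)) (u x))) P = poly p t"
proof -
  define q where "q = (\<lambda>(x, w). det (mat (length (u x)) (length (u x)) (\<lambda>(k, l).
      [:representation Basis (u x ! l) (w ! k), representation Basis (f x (u x ! l)) (w ! k):])))"
  have q: "pluecker (\<lambda>x. map (\<lambda>v. v + scale t (f x v)) (u x)) y = poly (q y) t" for t y
  proof -
    obtain x w where y: "y = (x, w)" by (cases y)
    have "mat (length (u x)) (length (u x)) (\<lambda>(k, l). representation Basis
        (map (\<lambda>v. v + scale t (f x v)) (u x) ! l) (w ! k)) = mat (length (u x)) (length (u x)) (\<lambda>(k, l).
        poly [:representation Basis (u x ! l) (w ! k), representation Basis (f x (u x ! l)) (w ! k):] t)"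
      by (rule eq_matI) (auto simp: rep_add rep_scale)
    then show ?thesis unfolding pluecker_def q_def y prod.case length_map
      by (simp only: det_poly_entries)
  qed
  show ?thesis unfolding mpoly_eval_def q
    by (rule exI[of _ "\<Sum>m\<in>Poly_Mapping.keys P. smult (Poly_Mapping.lookup P m)
        (\<Prod>x\<in>Poly_Mapping.keys m. q x ^ Poly_Mapping.lookup m x)"])
      (simp add: poly_sum poly_prod poly_power)
qed

lemma lin_perturb:
  assumes "lin f"
  shows "lin (\<lambda>v. v + scale t (f v))"
proof -
  interpret f: Vector_Spaces.linear scale scale f by fact
  show ?thesis
    by unfold_locales (simp_all add: f.add f.scale algebra_simps scale_right_distrib)
qed

text \<open>As \<open>f\<close> squares to zero, \<open>1 - t f\<close> is the inverse of
  \<open>1 + t f\<close>.\<close>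

lemma inj_perturb:
  assumes "lin f" and sq: "\<And>v. f (f v) = 0"
  shows "inj (\<lambda>v. v + scale t (f v))"
proof -
  interpret f: Vector_Spaces.linear scale scale f by fact
  have "v + scale t (f v) - scale t (f (v + scale t (f v))) = v" for v
    by (simp add: f.add f.scale sq)
  then show ?thesis by (intro inj_on_inverseI[of _ "\<lambda>w. w - scale t (f w)"])
qed

lemma frame_image:
  assumes "frame b c T u"
    and g: "\<And>x. x \<in> components b c \<Longrightarrow> lin (g x) \<and> inj (g x)"
    and T': "\<And>x. x \<in> components b c \<Longrightarrow> component_space T' x = g x ` component_space T x"
  shows "frame b c T' (\<lambda>x. map (g x) (u x))"
  unfolding frame_def
proof
  fix x assume x: "x \<in> components b c"
  interpret g: Vector_Spaces.linear scale scale "g x" using g[OF x] by blast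
  have u: "distinct (u x)" "independent (set (u x))" "span (set (u x)) = component_space T x"
    using assms(1) x unfolding frame_def by auto
  have inj: "inj_on (g x) A" for A using g[OF x] inj_on_subset by blast
  have "distinct (map (g x) (u x))" using u(1) inj by (simp add: distinct_map)
  moreover have "independent (set (map (g x) (u x)))"
    unfolding set_map by (rule g.independent_injective_image[OF u(2) inj])
  moreover have "span (set (map (g x) (u x))) = component_space T' x"
    unfolding set_map T'[OF x] u(3)[symmetric] by (rule g.span_image)
  ultimately show "distinct (map (g x) (u x)) \<and> independent (set (map (g x) (u x))) \<and>
      span (set (map (g x) (u x))) = component_space T' x" by blast
qed

text \<open>Along the curve, the value of a polynomial at the moved frame is a polynomial in \<open>t\<close>.\<close>

lemma curve_leaves_finitely:
  fixes S :: "'a \<Rightarrow> 'b triple"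
  assumes f: "\<And>x. x \<in> components b c \<Longrightarrow> lin (f x)" "\<And>x v. x \<in> components b c \<Longrightarrow> f x (f x v) = 0"
    and S: "\<And>t. S t \<in> triple_flags b c"
    and comp: "\<And>t x. x \<in> components b c \<Longrightarrow>
      component_space (S t) x = (\<lambda>v. v + scale t (f x v)) ` component_space T x"
    and U: "openin (zariski_topology b c) U" "T \<in> U"
  shows "finite {t. S t \<notin> U}"
proof -
  have "generate_topology_on {triple_flags b c - zero_locus b c P | P. P \<in> multihomogeneous_polys b c} U"
    using U(1) unfolding zariski_topology_def openin_topology_generated_by_iff .
  \<comment> \<open>Exceptional parameters of an intersection are the union of those of its members,
    and for a union one member containing \<open>T\<close> suffices. For a generator they are among
    the roots of a polynomial that is nonzero at \<open>0\<close>.\<close>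
  then show ?thesis using U(2)
  proof (induction rule: generate_topology_on.induct)
    case Empty
    then show ?case by simp
  next
    case (Int A B)
    then have "finite ({t. S t \<notin> A} \<union> {t. S t \<notin> B})" by blast
    then show ?case by (rule finite_subset[rotated]) auto
  next
    case (UN K)
    then obtain k where "k \<in> K" "T \<in> k" by blast
    then have "finite {t. S t \<notin> k}" using UN.IH by blast
    then show ?case by (rule finite_subset[rotated]) (use \<open>k \<in> K\<close> in auto)
  next
    case (Basis s)
    then obtain P where s: "s = triple_flags b c - zero_locus b c P" by blast
    then obtain u where u: "frame b c T u" "mpoly_eval (pluecker u) P \<noteq> 0"
      using Basis unfolding zero_locus_def by blast
    define v where "v t = (\<lambda>x. map (\<lambda>v. v + scale t (f x v)) (u x))" for t
    obtain p where p: "\<And>t. mpoly_eval (pluecker (v t)) P = poly p t"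
      using pluecker_curve_poly[of f u P] unfolding v_def by blast
    have "v 0 = u" unfolding v_def by simp
    then have "poly p 0 \<noteq> 0" using p[of 0] u by simp
    then have fin: "finite {t. poly p t = 0}" by (intro poly_roots_finite) auto
    have fr: "frame b c (S t) (v t)" for t
      unfolding v_def
    proof (rule frame_image[OF u(1)])
      fix x assume x: "x \<in> components b c"
      show "lin (\<lambda>v. v + scale t (f x v)) \<and> inj (\<lambda>v. v + scale t (f x v))"
        using lin_perturb inj_perturb f[OF x] by blast
      show "component_space (S t) x = (\<lambda>v. v + scale t (f x v)) ` component_space T x"
        by (rule comp[OF x])
    qed
    have "S t \<in> s" if "poly p t \<noteq> 0" for t
    proof -
      have "\<exists>u. frame b c (S t) u \<and> mpoly_eval (pluecker u) P \<noteq> 0"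
        using fr[of t] that p[of t] by (intro exI[of _ "v t"]) simp
      then show ?thesis using S[of t] unfolding s zero_locus_def by blast
    qed
    then show ?case by (intro finite_subset[OF _ fin]) auto
  qed
qed

text \<open>A neighbourhood of \<open>T\<close> contains \<open>S t\<close> for all but finitely
  many \<open>t\<close>, hence for some \<open>t \<noteq> 0\<close>. The points \<open>S t\<close>
  need only lie in the closure of \<open>W\<close>, so moves can be chained.\<close>

lemma in_closure_if_curve:
  fixes S :: "'a \<Rightarrow> 'b triple"
  assumes inf: "infinite (UNIV :: 'a set)" and T: "T \<in> triple_flags b c"
    and f: "\<And>x. x \<in> components b c \<Longrightarrow> lin (f x)" "\<And>x v. x \<in> components b c \<Longrightarrow> f x (f x v) = 0"
    and S: "\<And>t. S t \<in> triple_flags b c"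
    and comp: "\<And>t x. x \<in> components b c \<Longrightarrow>
      component_space (S t) x = (\<lambda>v. v + scale t (f x v)) ` component_space T x"
    and cl: "\<And>t. t \<noteq> 0 \<Longrightarrow> S t \<in> zariski_topology b c closure_of W"
  shows "T \<in> zariski_topology b c closure_of W"
  unfolding in_closure_of topspace_zariski_topology
proof (intro conjI allI impI T)
  fix U assume U: "T \<in> U \<and> openin (zariski_topology b c) U"
  have "finite {t. S t \<notin> U}"
    by (rule curve_leaves_finitely[of b c f S T U]) (use f S comp U in auto)
  then have "finite (insert 0 {t. S t \<notin> U})" by simp
  then obtain t where "t \<noteq> 0" "S t \<in> U" using inf by (metis (mono_tags, lifting) ex_new_if_finite insertCI mem_Collect_eq)
  then show "\<exists>y. y \<in> W \<and> y \<in> U" using cl[of t] U unfolding in_closure_of by blast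
qed

section \<open>Semicontinuity of dimensions of sums\<close>

text \<open>A kernel vector of the transposed matrix is the same as a linear relation between the
  rows.\<close>

lemma det_rows_iff:
  fixes z :: "nat \<Rightarrow> 'b"
  assumes es: "set es = Basis" "length es = n"
  shows "det (mat n n (\<lambda>(j, i). representation Basis (z j) (es ! i))) = 0 \<longleftrightarrow>
    (\<exists>a. (\<exists>j<n. a j \<noteq> 0) \<and> (\<Sum>j<n. scale (a j) (z j)) = 0)"
proof -
  define A where "A = mat n n (\<lambda>(j, i). representation Basis (z j) (es ! i))"
  have A: "A \<in> carrier_mat n n" unfolding A_def by simp
  have AT: "A\<^sup>T \<in> carrier_mat n n" using A by simp
  have mv: "(A\<^sup>T *\<^sub>v v) $ i = representation Basis (\<Sum>j<n. scale (v $ j) (z j)) (es ! i)"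
    if "v \<in> carrier_vec n" "i < n" for v i
    using that by (auto simp: A_def scalar_prod_def rep_sum rep_scale lessThan_atLeast0 intro!: sum.cong)
  have zero: "A\<^sup>T *\<^sub>v v = 0\<^sub>v n \<longleftrightarrow> (\<Sum>j<n. scale (v $ j) (z j)) = 0" if v: "v \<in> carrier_vec n" for v
  proof
    assume "A\<^sup>T *\<^sub>v v = 0\<^sub>v n"
    then have "representation Basis (\<Sum>j<n. scale (v $ j) (z j)) (es ! i) = 0" if "i < n" for i
      using mv[OF v that] that by simp
    then have "representation Basis (\<Sum>j<n. scale (v $ j) (z j)) e = 0" if "e \<in> Basis" for e
      using that es by (metis in_set_conv_nth)
    then show "(\<Sum>j<n. scale (v $ j) (z j)) = 0" by (intro rep_eqI) (simp add: rep_zero)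
  next
    assume "(\<Sum>j<n. scale (v $ j) (z j)) = 0"
    then show "A\<^sup>T *\<^sub>v v = 0\<^sub>v n" using mv[OF v] A by (intro eq_vecI) (auto simp: rep_zero)
  qed
  have "det A = 0 \<longleftrightarrow> (\<exists>v. v \<in> carrier_vec n \<and> v \<noteq> 0\<^sub>v n \<and> (\<Sum>j<n. scale (v $ j) (z j)) = 0)"
    using det_0_iff_vec_prod_zero_field[OF AT] det_transpose[OF A] zero by auto
  also have "\<dots> \<longleftrightarrow> (\<exists>a. (\<exists>j<n. a j \<noteq> 0) \<and> (\<Sum>j<n. scale (a j) (z j)) = 0)"
  proof
    assume "\<exists>v. v \<in> carrier_vec n \<and> v \<noteq> 0\<^sub>v n \<and> (\<Sum>j<n. scale (v $ j) (z j)) = 0"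
    then obtain v where v: "v \<in> carrier_vec n" "v \<noteq> 0\<^sub>v n" "(\<Sum>j<n. scale (v $ j) (z j)) = 0" by blast
    have "\<exists>j<n. v $ j \<noteq> 0"
    proof (rule ccontr)
      assume "\<not> ?thesis"
      then have "v = 0\<^sub>v n" using v(1) by (intro eq_vecI) auto
      then show False using v(2) by simp
    qed
    then show "\<exists>a. (\<exists>j<n. a j \<noteq> 0) \<and> (\<Sum>j<n. scale (a j) (z j)) = 0" using v(3) by blast
  next
    assume "\<exists>a. (\<exists>j<n. a j \<noteq> 0) \<and> (\<Sum>j<n. scale (a j) (z j)) = 0"
    then obtain a j where a: "j < n" "a j \<noteq> 0" "(\<Sum>j<n. scale (a j) (z j)) = 0" by blast
    have "vec n a \<noteq> 0\<^sub>v n" using a by (metis index_vec index_zero_vec(1))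
    moreover have "(\<Sum>j<n. scale (vec n a $ j) (z j)) = 0" using a(3) by simp
    ultimately show "\<exists>v. v \<in> carrier_vec n \<and> v \<noteq> 0\<^sub>v n \<and> (\<Sum>j<n. scale (v $ j) (z j)) = 0"
      using vec_carrier by blast
  qed
  finally show ?thesis unfolding A_def .
qed

text \<open>Stated for a family with coefficients, not for a set, so that repeated vectors count as
  dependent. This is what the vanishing of a determinant expresses.\<close>

lemma family_dependent:
  fixes z :: "nat \<Rightarrow> 'b"
  assumes "\<And>j. j < k \<Longrightarrow> z j \<in> W" and "dim W < k" and "k \<le> n"
  shows "\<exists>a. (\<exists>j<n. a j \<noteq> 0) \<and> (\<Sum>j<n. scale (a j) (z j)) = 0"
proof (rule ccontr)
  assume no: "\<not> ?thesis"
  then have ind: "\<And>a j. \<lbrakk>(\<Sum>j<n. scale (a j) (z j)) = 0; j < n\<rbrakk> \<Longrightarrow> a j = 0" by blast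
  have inj: "inj_on z {..<n}"
  proof (rule inj_onI, rule ccontr)
    fix i j assume ij: "i \<in> {..<n}" "j \<in> {..<n}" "z i = z j" "i \<noteq> j"
    define a where "a l = (if l = i then 1 else if l = j then -1 else 0 :: 'a)" for l
    have "(\<Sum>l<n. scale (a l) (z l)) = (\<Sum>l\<in>{i, j}. scale (a l) (z l))"
      using ij by (intro sum.mono_neutral_right) (auto simp: a_def)
    also have "\<dots> = 0" using ij by (simp add: a_def)
    finally have "a i = 0" using ind ij by blast
    then show False by (simp add: a_def)
  qed
  have "independent (z ` {..<n})"
  proof (rule independent_if_scalars_zero)
    fix g x assume s: "(\<Sum>x\<in>z ` {..<n}. scale (g x) x) = 0" and x: "x \<in> z ` {..<n}"
    have "(\<Sum>j<n. scale (g (z j)) (z j)) = 0" using s by (simp add: sum.reindex[OF inj])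
    then show "g x = 0" using ind[of "\<lambda>j. g (z j)"] x by auto
  qed simp
  then have "independent (z ` {..<k})" by (rule independent_mono) (use assms in auto)
  then have "card (z ` {..<k}) \<le> dim W"
    using independent_card_le_dim[of "z ` {..<k}" W] assms(1) by auto
  moreover have "card (z ` {..<k}) = k"
    using card_image[OF inj_on_subset[OF inj, of "{..<k}"]] assms(3) by auto
  ultimately show False using assms by simp
qed

lemma family_independent:
  fixes z :: "nat \<Rightarrow> 'b"
  assumes "inj_on z {..<n}" "independent (z ` {..<n})" "(\<Sum>j<n. scale (a j) (z j)) = 0" "j < n"
  shows "a j = 0"
proof -
  have eq: "(\<Sum>x\<in>z ` {..<n}. scale (a (inv_into {..<n} z x)) x) = 0"
    using assms(1,3) by (simp add: sum.reindex[OF assms(1)])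
  have "a (inv_into {..<n} z (z j)) = 0"
    using independentD[of "z ` {..<n}" "z ` {..<n}" "\<lambda>x. a (inv_into {..<n} z x)" "z j",
        OF assms(2) _ subset_refl eq] assms(4) by blast
  then show ?thesis using assms by simp
qed

section \<open>Contractions of Pluecker vectors\<close>

definition frame_mat :: "'b list \<Rightarrow> 'b list \<Rightarrow> 'a mat" where
  "frame_mat us w = mat (length us) (length us) (\<lambda>(k, l). representation Basis (us ! l) (w ! k))"

lemma pluecker_frame_mat: "pluecker u (x, w) = det (frame_mat (u x) w)"
  unfolding pluecker_def frame_mat_def by simp

text \<open>The interior product of the wedge of \<open>us\<close> with the coordinate functionals
  of all entries of \<open>w\<close> except the one at \<open>k\<close>: its
  \<open>e\<close>-coordinate is the Pluecker coordinate at \<open>w[k := e]\<close>.\<close>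

definition contraction :: "'b list \<Rightarrow> 'b list \<Rightarrow> nat \<Rightarrow> 'b" where
  "contraction us w k = (\<Sum>e\<in>Basis. scale (det (frame_mat us (w[k := e]))) e)"

text \<open>Laplace expansion along row \<open>k\<close>. Only that row depends on \<open>e\<close>,
  so the cofactors are common to all coordinates.\<close>

lemma contraction_eq:
  assumes w: "length w = length us" and k: "k < length us"
  shows "contraction us w k = (\<Sum>l<length us. scale (cofactor (frame_mat us w) k l) (us ! l))"
proof -
  have d: "det (frame_mat us (w[k := e])) =
      (\<Sum>l<length us. representation Basis (us ! l) e * cofactor (frame_mat us w) k l)" for e
  proof -
    have "mat_delete (frame_mat us (w[k := e])) k l = mat_delete (frame_mat us w) k l" if "l < length us" for l
      using that k by (intro eq_matI) (auto simp: frame_mat_def mat_delete_def)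
    then have "cofactor (frame_mat us (w[k := e])) k l = cofactor (frame_mat us w) k l" if "l < length us" for l
      using that unfolding cofactor_def by simp
    then show ?thesis
      using k w by (subst laplace_expansion_row[of _ "length us" k]) (auto simp: frame_mat_def intro!: sum.cong)
  qed
  have "contraction us w k = (\<Sum>e\<in>Basis. \<Sum>l<length us. scale (cofactor (frame_mat us w) k l)
      (scale (representation Basis (us ! l) e) e))"
    unfolding contraction_def d by (simp add: scale_sum_left mult.commute)
  also have "\<dots> = (\<Sum>l<length us. \<Sum>e\<in>Basis. scale (cofactor (frame_mat us w) k l)
      (scale (representation Basis (us ! l) e) e))"
    by (rule sum.swap)
  also have "\<dots> = (\<Sum>l<length us. scale (cofactor (frame_mat us w) k l) (us ! l))"
    by (simp del: scale_scale add: scale_sum_right[symmetric] rep_expand)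
  finally show ?thesis .
qed

lemma contraction_in_span:
  assumes "length w = length us" "k < length us"
  shows "contraction us w k \<in> span (set us)"
  unfolding contraction_eq[OF assms] by (intro span_sum span_scale span_base) auto

text \<open>By \<open>contraction_eq\<close> the contractions arise from \<open>us\<close> through
  the matrix of cofactors. Multiplying by the adjugate identity recovers \<open>det\<close> times
  each vector of \<open>us\<close>.\<close>

lemma contraction_spans:
  assumes w: "length w = length us" and det: "det (frame_mat us w) \<noteq> 0" and l: "l < length us"
  shows "us ! l \<in> span (contraction us w ` {..<length us})"
proof -
  define A where "A = frame_mat us w"
  define d where "d = length us"
  have A: "A \<in> carrier_mat d d" unfolding A_def d_def frame_mat_def by simp
  have adj: "(\<Sum>k<d. cofactor A k i * A $$ (k, j)) = (if i = j then det A else 0)" if "i < d" "j < d" for i j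
  proof -
    have "(\<Sum>k<d. cofactor A k i * A $$ (k, j)) = (adj_mat A * A) $$ (i, j)"
      using A that by (simp add: adj_mat_def scalar_prod_def lessThan_atLeast0)
    also have "\<dots> = (if i = j then det A else 0)" unfolding adj_mat(3)[OF A] using that by simp
    finally show ?thesis .
  qed
  have "(\<Sum>k<d. scale (A $$ (k, l)) (contraction us w k)) =
      (\<Sum>k<d. \<Sum>i<d. scale (cofactor A k i * A $$ (k, l)) (us ! i))"
    using contraction_eq[OF w] by (auto simp: A_def d_def scale_sum_right mult.commute intro!: sum.cong)
  also have "\<dots> = (\<Sum>i<d. scale (\<Sum>k<d. cofactor A k i * A $$ (k, l)) (us ! i))"
    by (subst sum.swap) (simp add: scale_sum_left)
  also have "\<dots> = (\<Sum>i<d. scale (if i = l then det A else 0) (us ! i))"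
    using adj l by (intro sum.cong) (auto simp: d_def)
  also have "\<dots> = (\<Sum>i\<in>{l}. scale (if i = l then det A else 0) (us ! i))"
    using l by (intro sum.mono_neutral_right) (auto simp: d_def)
  finally have "scale (det A) (us ! l) = (\<Sum>k<d. scale (A $$ (k, l)) (contraction us w k))" by simp
  then have "us ! l = scale (inverse (det A)) (\<Sum>k<d. scale (A $$ (k, l)) (contraction us w k))"
    using det unfolding A_def by (metis scale_one scale_scale left_inverse)
  also have "\<dots> \<in> span (contraction us w ` {..<length us})"
    by (intro span_scale span_sum span_base) (auto simp: d_def)
  finally show ?thesis .
qed

text \<open>Extend \<open>us\<close> by a part \<open>s\<close> of \<open>Basis\<close> to a basis
  of the space and let \<open>w\<close> list the remaining elements of \<open>Basis\<close>. A
  vector in the span of \<open>us\<close> whose coordinates at \<open>w\<close> vanish also lies in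
  the span of \<open>s\<close>, hence is zero, so the minor has no kernel.\<close>

lemma exists_nonzero_minor:
  assumes "distinct us" "independent (set us)"
  shows "\<exists>w. length w = length us \<and> set w \<subseteq> Basis \<and> det (frame_mat us w) \<noteq> 0"
proof -
  obtain t where t: "card t = card Basis" "finite t" "set us \<subseteq> t" "t \<subseteq> set us \<union> Basis" "Basis \<subseteq> span t"
  proof -
    obtain B where B: "set us \<subseteq> B" "B \<subseteq> set us \<union> Basis" "independent B" "set us \<union> Basis \<subseteq> span B"
      using maximal_independent_subset_extend[of "set us" "set us \<union> Basis"] assms by blast
    have "card B = card Basis"
      using basis_card_eq_dim[of B UNIV] B span_Basis span_mono[of Basis "span B"]
      by (metis basis_card_eq_dim independent_Basis le_sup_iff span_span subset_UNIV top.extremum_uniqueI)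
    then show ?thesis using that B finiteI_independent by blast
  qed
  have ind_t: "independent t"
    using card_eq_dim[of t UNIV] t span_Basis dim_UNIV span_mono[OF t(5)]
    unfolding dimension_def by (simp add: span_span)
  define s where "s = t - set us"
  define K where "K = Basis - s"
  have s: "s \<subseteq> Basis" using t unfolding s_def by auto
  have "card K = card (set us)"
    unfolding K_def using t s card_Diff_subset[of s Basis] card_Diff_subset[of "set us" t]
      finite_subset[OF s finite_Basis] card_mono[OF t(2,3)]
    unfolding s_def by simp
  moreover obtain w where w: "set w = K" "distinct w"
    using finite_distinct_list[of K] finite_Basis unfolding K_def by auto
  ultimately have len: "length w = length us" using assms(1) distinct_card by metis
  have zero: "y = 0" if y: "y \<in> span (set us)" "\<And>e. e \<in> K \<Longrightarrow> representation Basis y e = 0" for y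
  proof -
    have "y = (\<Sum>e\<in>Basis. scale (representation Basis y e) e)" by (simp add: rep_expand)
    also have "\<dots> = (\<Sum>e\<in>s. scale (representation Basis y e) e)"
      using s y(2) by (intro sum.mono_neutral_right finite_Basis) (auto simp: K_def)
    also have "\<dots> \<in> span s" by (intro span_sum span_scale span_base)
    finally have ys: "y \<in> span s" .
    have ts: "t = set us \<union> s" "set us \<inter> s = {}" using t unfolding s_def by auto
    have rs: "representation t y = representation (set us) y" "representation t y = representation s y"
      using representation_extend[OF ind_t y(1)] representation_extend[OF ind_t ys] ts by auto
    have "representation t y e = 0" for e
      using rs representation_ne_zero[of "set us" y e] representation_ne_zero[of s y e] ts(2)
      by (metis disjoint_iff)
    moreover have "y \<in> span t" using y(1) t(3) span_mono by blast
    ultimately have "(\<Sum>e\<in>t. scale 0 e) = y"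
      using sum_representation_eq[OF ind_t _ t(2) order_refl, of y] by simp
    then show "y = 0" by simp
  qed
  have "det (frame_mat us w) \<noteq> 0"
  proof
    assume "det (frame_mat us w) = 0"
    moreover have "frame_mat us w \<in> carrier_mat (length us) (length us)" unfolding frame_mat_def by simp
    ultimately obtain v where v: "v \<in> carrier_vec (length us)" "v \<noteq> 0\<^sub>v (length us)"
      "frame_mat us w *\<^sub>v v = 0\<^sub>v (length us)"
      using det_0_iff_vec_prod_zero_field by blast
    define y where "y = (\<Sum>l<length us. scale (v $ l) (us ! l))"
    have rep: "representation Basis y (w ! k) = 0" if "k < length us" for k
    proof -
      have "representation Basis y (w ! k) = (frame_mat us w *\<^sub>v v) $ k"
        using that v(1) by (auto simp: y_def rep_sum rep_scale frame_mat_def scalar_prod_def lessThan_atLeast0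
            mult.commute intro!: sum.cong)
      then show ?thesis using v(3) that by simp
    qed
    have "y \<in> span (set us)" unfolding y_def by (intro span_sum span_scale span_base) auto
    moreover have "representation Basis y e = 0" if "e \<in> K" for e
      using that rep len w by (metis in_set_conv_nth)
    ultimately have "y = 0" by (rule zero)
    have nth: "inj_on ((!) us) {..<length us}" "(!) us ` {..<length us} = set us"
      using assms(1) by (auto simp: inj_on_nth set_conv_nth)
    have "v $ l = 0" if "l < length us" for l
      by (rule family_independent[of "(!) us" "length us" "\<lambda>l. v $ l"])
        (use nth assms that \<open>y = 0\<close> in \<open>auto simp: y_def\<close>)
    then have "v = 0\<^sub>v (length us)" using v(1) by (intro eq_vecI) auto
    then show False using v by simp
  qed
  then show ?thesis using len w K_def by blast
qed

end

section \<open>Evaluation and group degrees of polynomials\<close>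

definition mono_eval :: "('x \<Rightarrow> 'k::comm_semiring_1) \<Rightarrow> ('x \<Rightarrow>\<^sub>0 nat) \<Rightarrow> 'k" where
  "mono_eval \<alpha> m = (\<Prod>x\<in>Poly_Mapping.keys m. \<alpha> x ^ Poly_Mapping.lookup m x)"

lemma mono_eval_superset:
  assumes "finite F" "Poly_Mapping.keys m \<subseteq> F"
  shows "mono_eval \<alpha> m = (\<Prod>x\<in>F. \<alpha> x ^ Poly_Mapping.lookup m x)"
  unfolding mono_eval_def using assms
  by (intro prod.mono_neutral_left) (auto simp: in_keys_iff)

lemma mono_eval_add: "mono_eval \<alpha> (m + m') = mono_eval \<alpha> m * mono_eval \<alpha> m'"
proof -
  let ?F = "Poly_Mapping.keys m \<union> Poly_Mapping.keys m'"
  have "Poly_Mapping.keys (m + m') \<subseteq> ?F" by (rule keys_add)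
  then show ?thesis
    by (simp add: mono_eval_superset[of ?F] lookup_add power_add prod.distrib)
qed

lemma mono_eval_sum_single:
  "mono_eval \<alpha> (\<Sum>j\<in>J. Poly_Mapping.single (y j) 1) = (\<Prod>j\<in>J. \<alpha> (y j))"
proof (induction J rule: infinite_finite_induct)
  case (insert j J)
  then show ?case by (simp add: mono_eval_add) (simp add: mono_eval_def)
qed (simp_all add: mono_eval_def)

lemma mpoly_eval_superset:
  assumes "finite F" "Poly_Mapping.keys P \<subseteq> F"
  shows "mpoly_eval \<alpha> P = (\<Sum>m\<in>F. Poly_Mapping.lookup P m * mono_eval \<alpha> m)"
  unfolding mpoly_eval_def mono_eval_def[symmetric] using assms
  by (intro sum.mono_neutral_left) (auto simp: in_keys_iff)

lemma mpoly_eval_add: "mpoly_eval \<alpha> (P + Q) = mpoly_eval \<alpha> P + mpoly_eval \<alpha> Q"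
proof -
  let ?F = "Poly_Mapping.keys P \<union> Poly_Mapping.keys Q"
  have "Poly_Mapping.keys (P + Q) \<subseteq> ?F" by (rule keys_add)
  then show ?thesis
    by (simp add: mpoly_eval_superset[of ?F] lookup_add distrib_right sum.distrib)
qed

lemma mpoly_eval_sum: "mpoly_eval \<alpha> (\<Sum>i\<in>S. P i) = (\<Sum>i\<in>S. mpoly_eval \<alpha> (P i))"
  by (induction S rule: infinite_finite_induct) (auto simp: mpoly_eval_add, auto simp: mpoly_eval_def)

lemma mpoly_eval_single: "mpoly_eval \<alpha> (Poly_Mapping.single m c) = c * mono_eval \<alpha> m"
  by (subst mpoly_eval_superset[of "{m}"]) auto

definition group_degree :: "'g \<Rightarrow> ('g \<times> 'x \<Rightarrow>\<^sub>0 nat) \<Rightarrow> nat" where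
  "group_degree g m = (\<Sum>x\<in>{x \<in> Poly_Mapping.keys m. fst x = g}. Poly_Mapping.lookup m x)"

lemma group_degree_add: "group_degree g (m + m') = group_degree g m + group_degree g m'"
proof -
  let ?F = "{x \<in> Poly_Mapping.keys m \<union> Poly_Mapping.keys m'. fst x = g}"
  have *: "group_degree g m'' = (\<Sum>x\<in>?F. Poly_Mapping.lookup m'' x)"
    if "Poly_Mapping.keys m'' \<subseteq> Poly_Mapping.keys m \<union> Poly_Mapping.keys m'" for m''
    unfolding group_degree_def using that
    by (intro sum.mono_neutral_left) (auto simp: in_keys_iff subset_iff)
  have "Poly_Mapping.keys (m + m') \<subseteq> Poly_Mapping.keys m \<union> Poly_Mapping.keys m'" by (rule keys_add)
  then show ?thesis by (simp add: * lookup_add sum.distrib)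
qed

lemma group_degree_sum_single:
  "group_degree g (\<Sum>j\<in>J. Poly_Mapping.single (y j) 1) = (\<Sum>j\<in>J. if fst (y j) = g then 1 else 0)"
proof (induction J rule: infinite_finite_induct)
  case (insert j J)
  have "{x. x = y j \<and> fst x = g} = (if fst (y j) = g then {y j} else {})" by auto
  then have "group_degree g (Poly_Mapping.single (y j) 1) = (if fst (y j) = g then 1 else 0)"
    by (simp add: group_degree_def)
  then show ?case using insert by (simp add: group_degree_add)
qed (simp_all add: group_degree_def)

lemma keys_sum_subset: "Poly_Mapping.keys (\<Sum>i\<in>S. f i) \<subseteq> (\<Union>i\<in>S. Poly_Mapping.keys (f i))"
proof (induction S rule: infinite_finite_induct)
  case (insert i S)
  then show ?case using keys_add[of "f i" "\<Sum>i\<in>S. f i"] by auto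
qed auto

text \<open>Each monomial has one factor of group \<open>h j\<close> for every \<open>j\<close>, so
  its group degrees do not depend on \<open>i\<close>. This is the shape of a Leibniz expansion with
  permutations \<open>S\<close> and rows \<open>J\<close>.\<close>

lemma multihomogeneous_sum_single:
  assumes "\<And>i j. \<lbrakk>i \<in> S; j \<in> J\<rbrakk> \<Longrightarrow> fst (y i j) = h j"
  shows "multihomogeneous (\<Sum>i\<in>S. Poly_Mapping.single (\<Sum>j\<in>J. Poly_Mapping.single (y i j) (1::nat)) (a i))"
  unfolding multihomogeneous_def group_degree_def[symmetric]
proof (intro allI exI ballI)
  fix g m
  assume "m \<in> Poly_Mapping.keys (\<Sum>i\<in>S. Poly_Mapping.single (\<Sum>j\<in>J. Poly_Mapping.single (y i j) (1::nat)) (a i))"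
  then obtain i where "i \<in> S" and m: "m = (\<Sum>j\<in>J. Poly_Mapping.single (y i j) (1::nat))"
    using keys_sum_subset by (fastforce split: if_splits)
  show "group_degree g m = (\<Sum>j\<in>J. if h j = g then 1 else 0)"
    unfolding m group_degree_sum_single using assms[OF \<open>i \<in> S\<close>] by (intro sum.cong) auto
qed

lemma mpoly_vars_sum_single:
  assumes "\<And>i j. \<lbrakk>i \<in> S; j \<in> J\<rbrakk> \<Longrightarrow> y i j \<in> V"
  shows "mpoly_vars (\<Sum>i\<in>S. Poly_Mapping.single (\<Sum>j\<in>J. Poly_Mapping.single (y i j) (1::nat)) (a i)) \<subseteq> V"
proof
  fix x
  assume "x \<in> mpoly_vars (\<Sum>i\<in>S. Poly_Mapping.single (\<Sum>j\<in>J. Poly_Mapping.single (y i j) (1::nat)) (a i))"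
  then obtain m where m: "m \<in> Poly_Mapping.keys (\<Sum>i\<in>S. Poly_Mapping.single (\<Sum>j\<in>J. Poly_Mapping.single (y i j) (1::nat)) (a i))"
    and x: "x \<in> Poly_Mapping.keys m" unfolding mpoly_vars_def by blast
  from m obtain i where "i \<in> S" and m: "m = (\<Sum>j\<in>J. Poly_Mapping.single (y i j) (1::nat))"
    using keys_sum_subset by (fastforce split: if_splits)
  have "x \<in> (\<Union>j\<in>J. Poly_Mapping.keys (Poly_Mapping.single (y i j) (1::nat)))"
    using x keys_sum_subset[of "\<lambda>j. Poly_Mapping.single (y i j) (1::nat)" J] unfolding m by blast
  then show "x \<in> V" using assms[OF \<open>i \<in> S\<close>] by auto
qed

section \<open>Minors as multihomogeneous polynomials\<close>

context flag_space
begin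

lemma flag_dim:
  assumes "B \<in> flags b" "i \<le> length b"
  shows "dim (B ! i) = sum_list (take i b)"
  using assms(2)
proof (induction i)
  case 0
  have "B ! 0 = {0}" using assms(1) unfolding flags_def by blast
  then show ?case by simp
next
  case (Suc i)
  have "\<forall>i\<in>{1..length b}. dim (B ! i) = dim (B ! (i - 1)) + b ! (i - 1)"
    using assms(1) unfolding flags_def by blast
  then have "dim (B ! Suc i) = dim (B ! i) + b ! i" using Suc.prems by force
  then show ?case using Suc by (simp add: take_Suc_conv_app_nth)
qed

lemma component_subspace_dim:
  assumes "T \<in> triple_flags b c" "x \<in> components b c"
  shows "subspace (component_space T x) \<and> dim (component_space T x) = component_dim b c x"
proof -
  obtain A B C where T: "T = (A, B, C)" by (cases T)
  have f: "A \<in> lines" "B \<in> flags b" "C \<in> flags c" using assms(1) unfolding T triple_flags_def by auto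
  have "subspace (B ! i)" if "i \<le> length b" for i using f(2) that unfolding flags_def by simp
  moreover have "subspace (C ! i)" if "i \<le> length c" for i using f(3) that unfolding flags_def by simp
  ultimately show ?thesis using assms(2) f flag_dim[OF f(2)] flag_dim[OF f(3)]
    unfolding T components_def lines_def by auto
qed

lemma rep_contraction:
  assumes "e \<in> Basis"
  shows "representation Basis (contraction us w k) e = det (frame_mat us (w[k := e]))"
proof -
  have "representation Basis (contraction us w k) e =
      (\<Sum>e'\<in>Basis. det (frame_mat us (w[k := e'])) * representation Basis e' e)"
    unfolding contraction_def by (simp add: rep_sum rep_scale)
  also have "\<dots> = (\<Sum>e'\<in>Basis. if e' = e then det (frame_mat us (w[k := e'])) else 0)"
    using representation_basis[OF independent_Basis] by (intro sum.cong) auto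
  also have "\<dots> = det (frame_mat us (w[k := e]))" using assms finite_Basis by simp
  finally show ?thesis .
qed

text \<open>
  The contractions of the Pluecker vector of a subspace span that subspace and depend linearly
  on the Pluecker coordinates, so a minor formed from such vectors is a multihomogeneous polynomial.
\<close>

lemma minor_polynomial:
  fixes X :: "nat \<Rightarrow> component" and w :: "component \<Rightarrow> 'b list" and kk :: "nat \<Rightarrow> nat" and z :: "nat \<Rightarrow> 'b"
  assumes es: "set es = Basis" "length es = n" and "k \<le> n"
    and X: "\<And>j. j < k \<Longrightarrow> X j \<in> components b c \<and> length (w (X j)) = component_dim b c (X j) \<and> set (w (X j)) \<subseteq> Basis"
  obtains P where "P \<in> multihomogeneous_polys b c"
    "\<And>u. mpoly_eval (pluecker u) P = det (mat n n (\<lambda>(j, i). representation Basis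
       (if j < k then contraction (u (X j)) (w (X j)) (kk j) else z j) (es ! i)))"
proof -
  \<comment> \<open>\<open>P\<close> below is the Leibniz expansion of the determinant. The first
    \<open>k\<close> rows contribute Pluecker variables, since coordinates of contractions are
    Pluecker coordinates; the other rows contribute constants.\<close>
  define y where "y p j = (X j, (w (X j))[kk j := es ! p j])" for p j
  define S where "S = {p. p permutes {0..<n}}"
  define P where "P = (\<Sum>p\<in>S. Poly_Mapping.single (\<Sum>j\<in>{0..<k}. Poly_Mapping.single (y p j) (1::nat))
    (signof p * (\<Prod>j\<in>{k..<n}. representation Basis (z j) (es ! p j))))"
  have esB: "es ! p j \<in> Basis" if "p \<in> S" "j < n" for p j
    using that es permutes_in_image[of p "{0..<n}" j] nth_mem[of "p j" es] unfolding S_def by auto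
  have "multihomogeneous P"
    unfolding P_def by (rule multihomogeneous_sum_single[where h = X]) (simp add: y_def)
  moreover have "mpoly_vars P \<subseteq> pluecker_vars b c" unfolding P_def
  proof (rule mpoly_vars_sum_single)
    fix p j assume pj: "p \<in> S" "j \<in> {0..<k}"
    have "set ((w (X j))[kk j := es ! p j]) \<subseteq> Basis"
      using X[of j] esB[of p j] pj assms(3) set_update_subset_insert[of "w (X j)" "kk j" "es ! p j"] by auto
    then show "y p j \<in> pluecker_vars b c"
      using X[of j] pj unfolding y_def pluecker_vars_def by auto
  qed
  ultimately have "P \<in> multihomogeneous_polys b c" unfolding multihomogeneous_polys_def by simp
  moreover have "mpoly_eval (pluecker u) P = det (mat n n (\<lambda>(j, i). representation Basis
       (if j < k then contraction (u (X j)) (w (X j)) (kk j) else z j) (es ! i)))" for u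
  proof -
    let ?r = "\<lambda>j e. representation Basis (if j < k then contraction (u (X j)) (w (X j)) (kk j) else z j) e"
    have "mpoly_eval (pluecker u) P = (\<Sum>p\<in>S. signof p * (\<Prod>j\<in>{k..<n}. representation Basis (z j) (es ! p j))
        * (\<Prod>j\<in>{0..<k}. pluecker u (y p j)))"
      unfolding P_def mpoly_eval_sum mpoly_eval_single mono_eval_sum_single ..
    also have "\<dots> = (\<Sum>p\<in>S. signof p * (\<Prod>j\<in>{0..<n}. ?r j (es ! p j)))"
    proof (rule sum.cong[OF refl])
      fix p assume p: "p \<in> S"
      have "(\<Prod>j\<in>{0..<n}. ?r j (es ! p j)) = (\<Prod>j\<in>{0..<k}. ?r j (es ! p j)) * (\<Prod>j\<in>{k..<n}. ?r j (es ! p j))"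
        using assms(3) by (intro prod.atLeastLessThan_concat[symmetric]) auto
      moreover have "(\<Prod>j\<in>{0..<k}. ?r j (es ! p j)) = (\<Prod>j\<in>{0..<k}. pluecker u (y p j))"
        using esB[OF p] assms(3)
        by (intro prod.cong) (auto simp: y_def pluecker_frame_mat rep_contraction)
      moreover have "(\<Prod>j\<in>{k..<n}. ?r j (es ! p j)) = (\<Prod>j\<in>{k..<n}. representation Basis (z j) (es ! p j))"
        by (intro prod.cong) auto
      ultimately show "signof p * (\<Prod>j\<in>{k..<n}. representation Basis (z j) (es ! p j))
        * (\<Prod>j\<in>{0..<k}. pluecker u (y p j)) = signof p * (\<Prod>j\<in>{0..<n}. ?r j (es ! p j))"
        by (simp add: mult.assoc mult.commute)
    qed
    also have "\<dots> = (\<Sum>p\<in>S. signof p * (\<Prod>j = 0..<n. mat n n (\<lambda>(j, i). ?r j (es ! i)) $$ (j, p j)))"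
    proof (intro sum.cong prod.cong refl arg_cong2[of _ _ _ _ "(*)"])
      fix p j assume "p \<in> S" "j \<in> {0..<n}"
      then show "?r j (es ! p j) = mat n n (\<lambda>(j, i). ?r j (es ! i)) $$ (j, p j)"
        using permutes_in_image[of p "{0..<n}" j] unfolding S_def by auto
    qed
    also have "\<dots> = det (mat n n (\<lambda>(j, i). ?r j (es ! i)))"
      unfolding S_def by (rule det_def'[symmetric]) simp
    finally show ?thesis .
  qed
  ultimately show ?thesis using that by blast
qed

text \<open>If the dimension at \<open>T\<close> exceeds \<open>s\<close>, some \<open>Suc s\<close>
  contractions are independent at \<open>T\<close>. Completed by constant vectors they give a minor
  that is nonzero at \<open>T\<close>, hence at some \<open>T'\<close> in \<open>W\<close>. But at
  \<open>T'\<close> the same contractions lie in a sum of dimension at most \<open>s\<close>, so the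
  minor vanishes. Note that \<open>dim\<close> of a union is the dimension of the sum.\<close>

lemma dim_sum_semicontinuous:
  assumes xs: "xs \<subseteq> components b c" and T: "T \<in> zariski_topology b c closure_of W"
    and W: "\<And>T'. T' \<in> W \<Longrightarrow> dim (\<Union>x\<in>xs. component_space T' x) \<le> s"
  shows "dim (\<Union>x\<in>xs. component_space T x) \<le> s"
proof (rule ccontr)
  assume "\<not> ?thesis"
  then have big: "s < dim (\<Union>x\<in>xs. component_space T x)" by simp
  have TT: "T \<in> triple_flags b c" using T unfolding in_closure_of topspace_zariski_topology by blast
  have frame_len: "length (u x) = component_dim b c x"
    if "frame b c T' u" "T' \<in> triple_flags b c" "x \<in> components b c" for T' u x
  proof -
    have "distinct (u x)" "independent (set (u x))" "span (set (u x)) = component_space T' x"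
      using that unfolding frame_def by auto
    then show ?thesis
      using component_subspace_dim[OF that(2,3)] dim_span_eq_card_independent distinct_card by metis
  qed
  obtain u where u: "frame b c T u" using ex_frame[OF TT] by blast
  have "\<forall>x\<in>components b c. \<exists>w. length w = length (u x) \<and> set w \<subseteq> Basis \<and> det (frame_mat (u x) w) \<noteq> 0"
    using u exists_nonzero_minor unfolding frame_def by blast
  then obtain w where w: "\<And>x. x \<in> components b c \<Longrightarrow>
      length (w x) = length (u x) \<and> set (w x) \<subseteq> Basis \<and> det (frame_mat (u x) (w x)) \<noteq> 0"
    by metis
  \<comment> \<open>At \<open>T\<close> the contractions along the chosen nonzero minors
    \<open>w\<close> span every component. At other points, where these minors may vanish, they are
    only known to lie in it.\<close>
  define K where "K = (\<Union>x\<in>xs. contraction (u x) (w x) ` {..<length (u x)})"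
  have "component_space T x \<subseteq> span K" if x: "x \<in> xs" for x
  proof -
    have xc: "x \<in> components b c" using x xs by blast
    have "set (u x) \<subseteq> span K"
    proof
      fix v assume "v \<in> set (u x)"
      then obtain l where l: "l < length (u x)" "v = u x ! l" by (auto simp: in_set_conv_nth)
      have "v \<in> span (contraction (u x) (w x) ` {..<length (u x)})"
        unfolding l(2) using contraction_spans w[OF xc] l(1) by blast
      then show "v \<in> span K" using x span_mono[of _ K] unfolding K_def by blast
    qed
    then have "span (set (u x)) \<subseteq> span K" by (rule span_minimal) simp
    then show ?thesis using u xc unfolding frame_def by simp
  qed
  then have "dim (\<Union>x\<in>xs. component_space T x) \<le> dim (span K)" by (intro dim_subset) blast
  then have "s < dim K" using big by simp
  obtain I where I: "I \<subseteq> K" "independent I" "K \<subseteq> span I" "card I = dim K" by (rule basis_exists)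
  obtain J where J: "J \<subseteq> I" "card J = Suc s" "finite J"
    using obtain_subset_with_card_n[of "Suc s" I] \<open>s < dim K\<close> I(4) by auto
  have indJ: "independent J" using independent_mono[OF I(2) J(1)] .
  obtain B where B: "J \<subseteq> B" "independent B" "UNIV \<subseteq> span B"
    by (rule maximal_independent_subset_extend[OF subset_UNIV indJ])
  define n where "n = card Basis"
  have fB: "finite B" using finiteI_independent[OF B(2)] .
  have cB: "card B = n"
    using basis_card_eq_dim[of B UNIV] B dim_UNIV unfolding n_def dimension_def by simp
  \<comment> \<open>Listing \<open>J\<close> first makes rows \<open>0\<close> to \<open>s\<close>
    the ones that vary with the flag.\<close>
  obtain zl1 where zl1: "set zl1 = J" "distinct zl1"
    using finite_distinct_list[OF J(3)] by blast
  obtain zl2 where zl2: "set zl2 = B - J" "distinct zl2"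
    using finite_distinct_list[of "B - J"] fB by blast
  note zl = zl1 zl2
  define z where "z j = (zl1 @ zl2) ! j" for j
  have dzl: "distinct (zl1 @ zl2)" "set (zl1 @ zl2) = B" using zl B(1) by auto
  have lzl: "length (zl1 @ zl2) = n" "length zl1 = Suc s"
    using dzl cB distinct_card[of "zl1 @ zl2"] zl J distinct_card[of zl1] by auto
  have injz: "inj_on z {..<n}" unfolding z_def using dzl lzl by (intro inj_on_nth) auto
  have imz: "z ` {..<n} = B" unfolding z_def using dzl lzl by (auto simp: set_conv_nth)
  have sn: "Suc s \<le> n" using lzl by simp
  have "\<forall>j<Suc s. \<exists>x k. x \<in> xs \<and> k < length (u x) \<and> z j = contraction (u x) (w x) k"
  proof (intro allI impI)
    fix j assume "j < Suc s"
    then have "z j \<in> J" using zl(1) lzl(2) unfolding z_def by (metis nth_append nth_mem)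
    then show "\<exists>x k. x \<in> xs \<and> k < length (u x) \<and> z j = contraction (u x) (w x) k"
      using J(1) I(1) unfolding K_def by blast
  qed
  then obtain X kk where X: "\<And>j. j < Suc s \<Longrightarrow>
      X j \<in> xs \<and> kk j < length (u (X j)) \<and> z j = contraction (u (X j)) (w (X j)) (kk j)"
    by metis
  obtain es where es: "set es = Basis" "length es = n"
    using finite_distinct_list[OF finite_Basis] distinct_card unfolding n_def by metis
  obtain P where P: "P \<in> multihomogeneous_polys b c"
    "\<And>u. mpoly_eval (pluecker u) P = det (mat n n (\<lambda>(j, i). representation Basis
       (if j < Suc s then contraction (u (X j)) (w (X j)) (kk j) else z j) (es ! i)))"
  proof (rule minor_polynomial[OF es sn, of X b c w kk z])
    fix j assume "j < Suc s"
    then have "X j \<in> components b c" using X xs by blast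
    then show "X j \<in> components b c \<and> length (w (X j)) = component_dim b c (X j) \<and> set (w (X j)) \<subseteq> Basis"
      using w[of "X j"] frame_len[OF u TT] by simp
  qed blast
  have "mpoly_eval (pluecker u) P \<noteq> 0"
  proof
    assume "mpoly_eval (pluecker u) P = 0"
    then obtain a j where a: "j < n" "a j \<noteq> 0" "(\<Sum>j<n. scale (a j)
        (if j < Suc s then contraction (u (X j)) (w (X j)) (kk j) else z j)) = 0"
      unfolding P(2) det_rows_iff[OF es] by blast
    have "(\<Sum>j<n. scale (a j) (z j)) = (\<Sum>j<n. scale (a j)
        (if j < Suc s then contraction (u (X j)) (w (X j)) (kk j) else z j))"
      using X by (intro sum.cong) auto
    then have "a j = 0" using family_independent[OF injz] a B(2) unfolding imz by auto
    then show False using a by simp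
  qed
  then have "T \<in> triple_flags b c - zero_locus b c P" using TT u unfolding zero_locus_def by blast
  moreover have "openin (zariski_topology b c) (triple_flags b c - zero_locus b c P)"
    unfolding zariski_topology_def openin_topology_generated_by_iff
    by (rule generate_topology_on.Basis) (use P(1) in blast)
  ultimately obtain T' where T': "T' \<in> W" "T' \<in> triple_flags b c" "T' \<notin> zero_locus b c P"
    using T unfolding in_closure_of by blast
  then obtain u' where u': "frame b c T' u'" "mpoly_eval (pluecker u') P \<noteq> 0"
    unfolding zero_locus_def by blast
  have "mpoly_eval (pluecker u') P = 0"
    unfolding P(2) det_rows_iff[OF es]
  proof (rule family_dependent)
    fix j assume j: "j < Suc s"
    have x: "X j \<in> xs" "X j \<in> components b c" using X[OF j] xs by auto
    have len: "length (w (X j)) = length (u' (X j))" "kk j < length (u' (X j))"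
      using w[OF x(2)] frame_len[OF u TT x(2)] frame_len[OF u'(1) T'(2) x(2)] X[OF j] by auto
    have "contraction (u' (X j)) (w (X j)) (kk j) \<in> component_space T' (X j)"
      using contraction_in_span[OF len] u'(1) x(2) unfolding frame_def by auto
    then show "(if j < Suc s then contraction (u' (X j)) (w (X j)) (kk j) else z j)
        \<in> (\<Union>x\<in>xs. component_space T' x)" using j x by auto
  next
    show "dim (\<Union>x\<in>xs. component_space T' x) < Suc s" using W[OF T'(1)] by simp
  qed (rule sn)
  then show False using u' by simp
qed

end

section \<open>Adapted bases\<close>

lemma finite_basis_index: "finite (basis_index q r M)"
proof -
  have "basis_index q r M = (SIGMA i:{1..q}. SIGMA j:{1..r}. {1..M i j})"
    unfolding basis_index_def by auto
  then show ?thesis by simp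
qed

lemma card_basis_index_rank:
  assumes "i \<le> q" "j \<le> r"
  shows "card {\<iota> \<in> basis_index q r M. fst \<iota> \<le> i \<and> fst (snd \<iota>) \<le> j} = rank_num M i j"
proof -
  have "{\<iota> \<in> basis_index q r M. fst \<iota> \<le> i \<and> fst (snd \<iota>) \<le> j} = (SIGMA k:{1..i}. SIGMA l:{1..j}. {1..M k l})"
    unfolding basis_index_def using assms by auto
  then show ?thesis unfolding rank_num_def by simp
qed

lemma sum_list_take_eq: "i \<le> length b \<Longrightarrow> sum_list (take i b) = (\<Sum>k\<in>{1..i}. b ! (k - 1))"
  by (induction i) (auto simp: take_Suc_conv_app_nth)

lemma rank_num_full_row:
  assumes "transport_matrix b c M" "i \<le> length b"
  shows "rank_num M i (length c) = sum_list (take i b)"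
  unfolding rank_num_def sum_list_take_eq[OF assms(2)]
  using assms unfolding transport_matrix_def by (intro sum.cong) auto

lemma rank_num_full_col:
  assumes "transport_matrix b c M" "j \<le> length c"
  shows "rank_num M (length b) j = sum_list (take j c)"
  unfolding rank_num_def sum_list_take_eq[OF assms(2)]
  by (subst sum.swap) (use assms in \<open>auto simp: transport_matrix_def intro!: sum.cong\<close>)

text \<open>Sorted by row, an antichain for \<open>pos_le\<close> has decreasing columns; this form
  of the condition on \<open>\<Delta>\<close> avoids the sorted list.\<close>

definition antichain_decoration :: "nat \<Rightarrow> nat \<Rightarrow> (nat \<Rightarrow> nat \<Rightarrow> nat) \<Rightarrow> (nat \<times> nat) set \<Rightarrow> bool" where
  "antichain_decoration q r M \<Delta> \<longleftrightarrow> \<Delta> \<noteq> {} \<and> \<Delta> \<subseteq> {1..q} \<times> {1..r} \<and>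
     (\<forall>p\<in>\<Delta>. \<forall>p'\<in>\<Delta>. pos_le p p' \<longrightarrow> p = p') \<and> (\<forall>(i, j)\<in>\<Delta>. 0 < M i j)"

lemma decorated_matrix_antichain:
  assumes "decorated_matrix b c M \<Delta>"
  shows "transport_matrix b c M" "antichain_decoration (length b) (length c) M \<Delta>"
proof -
  show "transport_matrix b c M" using assms unfolding decorated_matrix_def by blast
  obtain ps where ps: "set ps = \<Delta>" "sorted_wrt (\<lambda>(i, j) (i', j'). i < i' \<and> j > j') ps"
    using assms unfolding decorated_matrix_def by blast
  have "p = p'" if pp: "p \<in> \<Delta>" "p' \<in> \<Delta>" and le: "pos_le p p'" for p p'
  proof -
    obtain k l where kl: "k < length ps" "l < length ps" "p = ps ! k" "p' = ps ! l"
      using pp unfolding ps(1)[symmetric] in_set_conv_nth by blast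
    have lt: "fst (ps ! k) < fst (ps ! l) \<and> snd (ps ! l) < snd (ps ! k)" if "k < l" "l < length ps" for k l
      using sorted_wrt_nth_less[OF ps(2) that] by (simp add: case_prod_unfold)
    show ?thesis
      using lt[of k l] lt[of l k] kl le unfolding pos_le_def
      by (cases k l rule: linorder_cases) simp_all
  qed
  then show "antichain_decoration (length b) (length c) M \<Delta>"
    using assms unfolding decorated_matrix_def antichain_decoration_def by blast
qed

context flag_space
begin

section \<open>Linear algebra with indexed bases\<close>

lemma indexed_sum_zero:
  assumes "indexed_basis I v" "finite I" "(\<Sum>\<iota>\<in>I. scale (g \<iota>) (v \<iota>)) = 0" "\<iota> \<in> I"
  shows "g \<iota> = 0"
proof -
  have inj: "inj_on v I" and ind: "independent (v ` I)" using assms(1) unfolding indexed_basis_def by auto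
  have eq: "(\<Sum>x\<in>v ` I. scale (g (inv_into I v x)) x) = 0"
    using assms(3) inj by (simp add: sum.reindex[OF inj])
  have "g (inv_into I v (v \<iota>)) = 0"
    using independentD[of "v ` I" "v ` I" "\<lambda>x. g (inv_into I v x)" "v \<iota>", OF ind _ subset_refl eq] assms(2,4)
    by blast
  then show ?thesis using inj assms(4) by simp
qed

lemma in_indexed_span:
  assumes "finite J" "inj_on v J" "a \<in> span (v ` J)"
  obtains y where "a = (\<Sum>\<iota>\<in>J. scale (y \<iota>) (v \<iota>))"
proof -
  obtain y where "a = (\<Sum>x\<in>v ` J. scale (y x) x)"
    using assms span_finite[of "v ` J"] by auto
  then show ?thesis using that[of "\<lambda>\<iota>. y (v \<iota>)"] assms(2) by (simp add: sum.reindex)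
qed

lemma indexed_expansion:
  assumes "indexed_basis I v" "finite I"
  obtains y where "a = (\<Sum>\<iota>\<in>I. scale (y \<iota>) (v \<iota>))"
  using in_indexed_span[of I v a] assms unfolding indexed_basis_def by auto

lemma sum_in_indexed_span_iff:
  assumes I: "indexed_basis I v" "finite I" and J: "J \<subseteq> I"
  shows "(\<Sum>\<iota>\<in>I. scale (x \<iota>) (v \<iota>)) \<in> span (v ` J) \<longleftrightarrow> (\<forall>\<iota>\<in>I - J. x \<iota> = 0)"
proof
  assume "(\<Sum>\<iota>\<in>I. scale (x \<iota>) (v \<iota>)) \<in> span (v ` J)"
  moreover have "finite J" "inj_on v J"
    using J I finite_subset inj_on_subset unfolding indexed_basis_def by blast+
  ultimately obtain y where y: "(\<Sum>\<iota>\<in>I. scale (x \<iota>) (v \<iota>)) = (\<Sum>\<iota>\<in>J. scale (y \<iota>) (v \<iota>))"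
    by (metis in_indexed_span)
  have "(\<Sum>\<iota>\<in>J. scale (y \<iota>) (v \<iota>)) = (\<Sum>\<iota>\<in>I. scale (if \<iota> \<in> J then y \<iota> else 0) (v \<iota>))"
    using J I(2) by (intro sum.mono_neutral_cong_left) auto
  then have "(\<Sum>\<iota>\<in>I. scale (x \<iota> - (if \<iota> \<in> J then y \<iota> else 0)) (v \<iota>)) = 0"
    using y by (simp add: scale_left_diff_distrib sum_subtractf)
  then have "x \<iota> - (if \<iota> \<in> J then y \<iota> else 0) = 0" if "\<iota> \<in> I" for \<iota>
    using indexed_sum_zero[OF I _ that, of "\<lambda>\<iota>. x \<iota> - (if \<iota> \<in> J then y \<iota> else 0)"] by simp
  then show "\<forall>\<iota>\<in>I - J. x \<iota> = 0" by fastforce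
next
  assume *: "\<forall>\<iota>\<in>I - J. x \<iota> = 0"
  have "(\<Sum>\<iota>\<in>I. scale (x \<iota>) (v \<iota>)) = (\<Sum>\<iota>\<in>J. scale (x \<iota>) (v \<iota>))"
    using * J I(2) by (intro sum.mono_neutral_right) auto
  also have "\<dots> \<in> span (v ` J)" by (intro span_sum span_scale span_base) auto
  finally show "(\<Sum>\<iota>\<in>I. scale (x \<iota>) (v \<iota>)) \<in> span (v ` J)" .
qed

lemma basis_vec_in_span_iff:
  assumes I: "indexed_basis I v" and J: "J \<subseteq> I" and "\<iota> \<in> I"
  shows "v \<iota> \<in> span (v ` J) \<longleftrightarrow> \<iota> \<in> J"
proof
  assume *: "v \<iota> \<in> span (v ` J)"
  show "\<iota> \<in> J"
  proof (rule ccontr)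
    assume "\<iota> \<notin> J"
    then have "v ` J \<subseteq> v ` I - {v \<iota>}" using I J \<open>\<iota> \<in> I\<close> unfolding indexed_basis_def inj_on_def by blast
    then have "v \<iota> \<in> span (v ` I - {v \<iota>})" using * span_mono by blast
    then show False using I \<open>\<iota> \<in> I\<close> unfolding indexed_basis_def dependent_def by blast
  qed
qed (auto intro: span_base)

lemma dim_indexed_span:
  assumes "indexed_basis I v" "J \<subseteq> I"
  shows "dim (span (v ` J)) = card J"
proof -
  have "independent (v ` J)" "inj_on v J"
    using assms independent_mono[of "v ` I" "v ` J"] inj_on_subset[of v I J]
    unfolding indexed_basis_def by auto
  then show ?thesis by (metis dim_span_eq_card_independent card_image)
qed

lemma indexed_basis_if_spanning:
  assumes "finite I" "card I = dim UNIV" "span (v ` I) = UNIV"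
  shows "indexed_basis I v"
proof -
  have "dim (UNIV :: 'b set) \<le> card (v ` I)" using dim_le_card[of UNIV "v ` I"] assms by simp
  then have c: "card (v ` I) = card I" using card_image_le[OF assms(1), of v] assms(2) by simp
  then have "inj_on v I" using eq_card_imp_inj_on[OF assms(1)] by simp
  moreover have "independent (v ` I)"
    using card_eq_dim[of "v ` I" UNIV] c assms by simp
  ultimately show ?thesis using assms unfolding indexed_basis_def by simp
qed

lemma card_indexed_basis: "indexed_basis I v \<Longrightarrow> card I = dim UNIV"
  using dim_indexed_span[of I v I] unfolding indexed_basis_def by simp

lemma indexed_linear_extend:
  assumes "indexed_basis I v"
  obtains f where "lin f" "\<And>\<iota>. \<iota> \<in> I \<Longrightarrow> f (v \<iota>) = g \<iota>"
proof -
  interpret vector_space_pair scale scale ..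
  obtain f where "lin f" "\<forall>x\<in>v ` I. f x = g (inv_into I v x)"
    using linear_independent_extend[of "v ` I" "\<lambda>x. g (inv_into I v x)"] assms
    unfolding indexed_basis_def by blast
  then show ?thesis using that[of f] assms unfolding indexed_basis_def by simp
qed

text \<open>The part of the description of an orbit that concerns only \<open>B\<close> and
  \<open>C\<close>, so that the line and its decoration can vary for fixed flags.\<close>

definition adapted ::
    "nat list \<Rightarrow> nat list \<Rightarrow> (nat \<Rightarrow> nat \<Rightarrow> nat) \<Rightarrow> (nat \<times> nat \<times> nat \<Rightarrow> 'b) \<Rightarrow> 'b set list \<Rightarrow> 'b set list \<Rightarrow> bool" where
  "adapted b c M v B C \<longleftrightarrow> indexed_basis (basis_index (length b) (length c) M) v \<and>
     length B = length b + 1 \<and> length C = length c + 1 \<and>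
     (\<forall>i\<le>length b. B ! i = span (v ` {\<iota> \<in> basis_index (length b) (length c) M. fst \<iota> \<le> i})) \<and>
     (\<forall>j\<le>length c. C ! j = span (v ` {\<iota> \<in> basis_index (length b) (length c) M. fst (snd \<iota>) \<le> j}))"

lemma triple_orbit_iff:
  "(A, B, C) \<in> triple_orbit b c M \<Delta> \<longleftrightarrow>
    (\<exists>v. adapted b c M v B C \<and> A = span {\<Sum>(i, j)\<in>\<Delta>. v (i, j, 1)})"
proof -
  have 1: "{v (i', j, k) | i' j k. (i', j, k) \<in> I \<and> i' \<le> i} = v ` {\<iota> \<in> I. fst \<iota> \<le> i}"
    for v :: "nat \<times> nat \<times> nat \<Rightarrow> 'b" and I i by force
  have 2: "{v (i, j', k) | i j' k. (i, j', k) \<in> I \<and> j' \<le> j} = v ` {\<iota> \<in> I. fst (snd \<iota>) \<le> j}"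
    for v :: "nat \<times> nat \<times> nat \<Rightarrow> 'b" and I j by force
  show ?thesis
    unfolding triple_orbit_def adapted_def mem_Collect_eq prod.case 1 2 atLeast0AtMost
    by (auto simp: Ball_def)
qed

lemma span_Un_subspaces: "\<lbrakk>subspace S; subspace T\<rbrakk> \<Longrightarrow> span (S \<union> T) = {x + y | x y. x \<in> S \<and> y \<in> T}"
  by (simp add: span_Un span_eq_iff[THEN iffD2])

lemma adapted_subspaces:
  assumes "adapted b c M v B C"
  shows "i \<le> length b \<Longrightarrow> subspace (B ! i)" "j \<le> length c \<Longrightarrow> subspace (C ! j)"
  using assms unfolding adapted_def by auto

lemma adapted_sum:
  assumes "adapted b c M v B C" "i \<le> length b" "j \<le> length c"
  shows "span (B ! i \<union> C ! j) = span (v ` {\<iota> \<in> basis_index (length b) (length c) M. fst \<iota> \<le> i \<or> fst (snd \<iota>) \<le> j})"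
proof -
  let ?I = "basis_index (length b) (length c) M"
  have "{\<iota> \<in> ?I. fst \<iota> \<le> i \<or> fst (snd \<iota>) \<le> j} = {\<iota> \<in> ?I. fst \<iota> \<le> i} \<union> {\<iota> \<in> ?I. fst (snd \<iota>) \<le> j}" by auto
  then have "span (v ` {\<iota> \<in> ?I. fst \<iota> \<le> i \<or> fst (snd \<iota>) \<le> j}) = {x + y | x y. x \<in> B ! i \<and> y \<in> C ! j}"
    using assms unfolding adapted_def by (simp add: image_Un span_Un)
  then show ?thesis using span_Un_subspaces[OF adapted_subspaces[OF assms(1)]] assms by simp
qed

text \<open>\<open>rank_num M i j\<close> counts the basis vectors common to both index sets, so
  inclusion-exclusion turns rank numbers into dimensions of sums.\<close>

lemma adapted_dims:
  assumes a: "adapted b c M v B C" and t: "transport_matrix b c M" and i: "i \<le> length b" and j: "j \<le> length c"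
  shows "dim (B ! i) = sum_list (take i b)" "dim (C ! j) = sum_list (take j c)"
    "dim (B ! i \<union> C ! j) + rank_num M i j = sum_list (take i b) + sum_list (take j c)"
proof -
  let ?I = "basis_index (length b) (length c) M"
  let ?R = "{\<iota> \<in> ?I. fst \<iota> \<le> i}" and ?L = "{\<iota> \<in> ?I. fst (snd \<iota>) \<le> j}"
  have I: "indexed_basis ?I v" using a unfolding adapted_def by blast
  have R: "card ?R = sum_list (take i b)"
  proof -
    have "?R = {\<iota> \<in> ?I. fst \<iota> \<le> i \<and> fst (snd \<iota>) \<le> length c}" unfolding basis_index_def by auto
    then show ?thesis using card_basis_index_rank[OF i order_refl] rank_num_full_row[OF t i] by simp
  qed
  have L: "card ?L = sum_list (take j c)"
  proof -
    have "?L = {\<iota> \<in> ?I. fst \<iota> \<le> length b \<and> fst (snd \<iota>) \<le> j}" unfolding basis_index_def by auto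
    then show ?thesis using card_basis_index_rank[OF order_refl j] rank_num_full_col[OF t j] by simp
  qed
  show "dim (B ! i) = sum_list (take i b)"
    using dim_indexed_span[OF I, of ?R] R a i unfolding adapted_def by auto
  show "dim (C ! j) = sum_list (take j c)"
    using dim_indexed_span[OF I, of ?L] L a j unfolding adapted_def by auto
  have fin: "finite ?R" "finite ?L" using finite_basis_index by auto
  have "{\<iota> \<in> ?I. fst \<iota> \<le> i \<or> fst (snd \<iota>) \<le> j} = ?R \<union> ?L" by auto
  then have "dim (B ! i \<union> C ! j) = card (?R \<union> ?L)"
    using dim_indexed_span[OF I, of "?R \<union> ?L"] adapted_sum[OF a i j] dim_span[of "B ! i \<union> C ! j"] by auto
  moreover have "?R \<inter> ?L = {\<iota> \<in> ?I. fst \<iota> \<le> i \<and> fst (snd \<iota>) \<le> j}" by auto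
  ultimately show "dim (B ! i \<union> C ! j) + rank_num M i j = sum_list (take i b) + sum_list (take j c)"
    using card_Un_Int[OF fin] card_basis_index_rank[OF i j] R L by simp
qed

lemma decoration_index:
  assumes "antichain_decoration q r M \<Delta>" "p \<in> \<Delta>"
  shows "(fst p, snd p, 1) \<in> basis_index q r M"
  using assms unfolding antichain_decoration_def basis_index_def by (cases p) fastforce

lemma decoration_sum:
  assumes "antichain_decoration q r M \<Delta>"
  shows "(\<Sum>(i, j)\<in>\<Delta>. v (i, j, 1)) =
    (\<Sum>\<iota>\<in>basis_index q r M. scale (if \<iota> \<in> (\<lambda>p. (fst p, snd p, 1)) ` \<Delta> then 1 else 0) (v \<iota>))"
proof -
  let ?e = "\<lambda>p. (fst p, snd p, 1::nat)"
  have "(\<Sum>(i, j)\<in>\<Delta>. v (i, j, 1)) = (\<Sum>\<iota>\<in>?e ` \<Delta>. v \<iota>)"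
    by (subst sum.reindex) (auto simp: inj_on_def case_prod_unfold)
  also have "\<dots> = (\<Sum>\<iota>\<in>basis_index q r M. scale (if \<iota> \<in> ?e ` \<Delta> then 1 else 0) (v \<iota>))"
    using decoration_index[OF assms] finite_basis_index by (intro sum.mono_neutral_cong_left) auto
  finally show ?thesis .
qed

text \<open>Distinct basis vectors cannot cancel, so the sum lies in \<open>B_i + C_j\<close> only
  if every summand does.\<close>

lemma decoration_sum_in_sum_iff:
  assumes a: "adapted b c M v B C" and d: "antichain_decoration (length b) (length c) M \<Delta>"
    and i: "i \<le> length b" and j: "j \<le> length c"
  shows "(\<Sum>(i, j)\<in>\<Delta>. v (i, j, 1)) \<in> span (B ! i \<union> C ! j) \<longleftrightarrow> \<not> pos_le_set (i + 1, j + 1) \<Delta>"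
proof -
  let ?I = "basis_index (length b) (length c) M"
  have I: "indexed_basis ?I v" using a unfolding adapted_def by blast
  have "(\<Sum>(i, j)\<in>\<Delta>. v (i, j, 1)) \<in> span (B ! i \<union> C ! j) \<longleftrightarrow>
    (\<forall>\<iota>\<in>?I - {\<iota> \<in> ?I. fst \<iota> \<le> i \<or> fst (snd \<iota>) \<le> j}. (if \<iota> \<in> (\<lambda>p. (fst p, snd p, 1)) ` \<Delta> then 1 else 0 :: 'a) = 0)"
    unfolding adapted_sum[OF a i j] decoration_sum[OF d]
    by (rule sum_in_indexed_span_iff[OF I finite_basis_index]) auto
  also have "\<dots> \<longleftrightarrow> (\<forall>p\<in>\<Delta>. fst p \<le> i \<or> snd p \<le> j)"
  proof
    assume *: "\<forall>\<iota>\<in>?I - {\<iota> \<in> ?I. fst \<iota> \<le> i \<or> fst (snd \<iota>) \<le> j}.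
      (if \<iota> \<in> (\<lambda>p. (fst p, snd p, 1)) ` \<Delta> then 1 else 0 :: 'a) = 0"
    show "\<forall>p\<in>\<Delta>. fst p \<le> i \<or> snd p \<le> j"
    proof
      fix p assume p: "p \<in> \<Delta>"
      have "(fst p, snd p, 1) \<in> (\<lambda>p. (fst p, snd p, 1::nat)) ` \<Delta>" using p by blast
      then have "(fst p, snd p, 1) \<notin> ?I - {\<iota> \<in> ?I. fst \<iota> \<le> i \<or> fst (snd \<iota>) \<le> j}"
        using bspec[OF *, of "(fst p, snd p, 1)"] by (metis one_neq_zero)
      then show "fst p \<le> i \<or> snd p \<le> j" using decoration_index[OF d p] by simp
    qed
  next
    assume "\<forall>p\<in>\<Delta>. fst p \<le> i \<or> snd p \<le> j"
    then show "\<forall>\<iota>\<in>?I - {\<iota> \<in> ?I. fst \<iota> \<le> i \<or> fst (snd \<iota>) \<le> j}.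
      (if \<iota> \<in> (\<lambda>p. (fst p, snd p, 1)) ` \<Delta> then 1 else 0 :: 'a) = 0" by auto
  qed
  also have "\<dots> \<longleftrightarrow> \<not> pos_le_set (i + 1, j + 1) \<Delta>"
    unfolding pos_le_set_def pos_le_def by (auto simp: not_le Suc_le_eq)
  finally show ?thesis .
qed

lemma decoration_sum_nonzero:
  assumes "adapted b c M v B C" "antichain_decoration (length b) (length c) M \<Delta>"
  shows "(\<Sum>(i, j)\<in>\<Delta>. v (i, j, 1)) \<noteq> 0"
proof
  assume z: "(\<Sum>(i, j)\<in>\<Delta>. v (i, j, 1)) = 0"
  obtain p where p: "p \<in> \<Delta>" using assms(2) unfolding antichain_decoration_def by blast
  have "(if (fst p, snd p, 1) \<in> (\<lambda>p. (fst p, snd p, 1::nat)) ` \<Delta> then 1 else 0 :: 'a) = 0"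
    by (rule indexed_sum_zero[of "basis_index (length b) (length c) M" v
        "\<lambda>\<iota>. if \<iota> \<in> (\<lambda>p. (fst p, snd p, 1)) ` \<Delta> then 1 else 0"])
      (use assms z decoration_sum[OF assms(2)] decoration_index[OF assms(2) p] finite_basis_index
        in \<open>auto simp: adapted_def\<close>)
  then show False using p by auto
qed

lemma dim_insert_span: "dim (span {a} \<union> S) = (if a \<in> span S then dim S else dim S + 1)"
proof -
  have "span (span {a} \<union> S) = span (insert a S)"
  proof -
    have "span (span {a} \<union> S) = span ({a} \<union> S)" unfolding span_Un span_span ..
    then show ?thesis by simp
  qed
  then have "dim (span {a} \<union> S) = dim (insert a S)" using dim_span[of "span {a} \<union> S"] dim_span[of "insert a S"] by simp
  then show ?thesis unfolding dim_insert .
qed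

lemma decoration_dim:
  assumes "adapted b c M v B C" "antichain_decoration (length b) (length c) M \<Delta>"
    and "transport_matrix b c M" "i \<le> length b" "j \<le> length c"
    and A: "A = span {\<Sum>(i, j)\<in>\<Delta>. v (i, j, 1)}"
  shows "dim (A \<union> (B ! i \<union> C ! j)) + rank_num_dec M \<Delta> i j = sum_list (take i b) + sum_list (take j c) + 1"
  unfolding A dim_insert_span rank_num_dec_def delta_num_def
  using decoration_sum_in_sum_iff[OF assms(1,2,4,5)] adapted_dims(3)[OF assms(1,3,4,5)] by auto

lemma line_of_nonzero: "a \<noteq> 0 \<Longrightarrow> span {a} \<in> lines"
  unfolding lines_def by (simp add: dim_span_eq_card_independent dependent_single)

lemma adapted_flags:
  assumes a: "adapted b c M v B C" and t: "transport_matrix b c M"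
  shows "B \<in> flags b" "C \<in> flags c"
proof -
  let ?I = "basis_index (length b) (length c) M"
  have B: "\<And>i. i \<le> length b \<Longrightarrow> B ! i = span (v ` {\<iota> \<in> ?I. fst \<iota> \<le> i})"
    and C: "\<And>j. j \<le> length c \<Longrightarrow> C ! j = span (v ` {\<iota> \<in> ?I. fst (snd \<iota>) \<le> j})"
    and len: "length B = length b + 1" "length C = length c + 1"
    and I: "span (v ` ?I) = UNIV"
    using a unfolding adapted_def indexed_basis_def by auto
  have e: "{\<iota> \<in> ?I. fst \<iota> \<le> 0} = {}" "{\<iota> \<in> ?I. fst (snd \<iota>) \<le> 0} = {}"
    "{\<iota> \<in> ?I. fst \<iota> \<le> length b} = ?I" "{\<iota> \<in> ?I. fst (snd \<iota>) \<le> length c} = ?I"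
    unfolding basis_index_def by auto
  have "dim (B ! i) = dim (B ! (i - 1)) + b ! (i - 1)" if "i \<in> {1..length b}" for i
  proof -
    have "i - 1 < length b" "Suc (i - 1) = i" using that by auto
    then show ?thesis
      using adapted_dims(1)[OF a t, of i 0] adapted_dims(1)[OF a t, of "i - 1" 0] that
        take_Suc_conv_app_nth[of "i - 1" b] by simp
  qed
  moreover have "B ! (i - 1) \<subseteq> B ! i" if "i \<in> {1..length b}" for i
  proof -
    have "v ` {\<iota> \<in> ?I. fst \<iota> \<le> i - 1} \<subseteq> v ` {\<iota> \<in> ?I. fst \<iota> \<le> i}" by auto
    moreover have le: "i - 1 \<le> length b" "i \<le> length b" using that by auto
    ultimately show ?thesis unfolding B[OF le(1)] B[OF le(2)] by (intro span_mono)
  qed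
  moreover have "B ! 0 = {0}" "B ! length b = UNIV"
    using B[OF le0] B[OF order_refl] unfolding e I by simp_all
  ultimately show "B \<in> flags b" using len adapted_subspaces(1)[OF a]
    unfolding flags_def by auto
  have "dim (C ! i) = dim (C ! (i - 1)) + c ! (i - 1)" if "i \<in> {1..length c}" for i
  proof -
    have "i - 1 < length c" "Suc (i - 1) = i" using that by auto
    then show ?thesis
      using adapted_dims(2)[OF a t, of 0 i] adapted_dims(2)[OF a t, of 0 "i - 1"] that
        take_Suc_conv_app_nth[of "i - 1" c] by simp
  qed
  moreover have "C ! (i - 1) \<subseteq> C ! i" if "i \<in> {1..length c}" for i
  proof -
    have "v ` {\<iota> \<in> ?I. fst (snd \<iota>) \<le> i - 1} \<subseteq> v ` {\<iota> \<in> ?I. fst (snd \<iota>) \<le> i}" by auto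
    moreover have le: "i - 1 \<le> length c" "i \<le> length c" using that by auto
    ultimately show ?thesis unfolding C[OF le(1)] C[OF le(2)] by (intro span_mono)
  qed
  moreover have "C ! 0 = {0}" "C ! length c = UNIV"
    using C[OF le0] C[OF order_refl] unfolding e I by simp_all
  ultimately show "C \<in> flags c" using len adapted_subspaces(2)[OF a]
    unfolding flags_def by auto
qed

lemma adapted_triple_flags:
  assumes "adapted b c M v B C" "transport_matrix b c M" "antichain_decoration (length b) (length c) M \<Delta>"
    "A = span {\<Sum>(i, j)\<in>\<Delta>. v (i, j, 1)}"
  shows "(A, B, C) \<in> triple_flags b c"
  using adapted_flags[OF assms(1,2)] line_of_nonzero[OF decoration_sum_nonzero[OF assms(1,3)]] assms(4)
  unfolding triple_flags_def by simp


text \<open>Assign each term of \<open>a\<close> to a position of \<open>\<Delta>\<close> above it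
  and let the sum of the terms assigned to \<open>p\<close> be the new basis vector at
  \<open>p\<close>. Terms at smaller positions lie in every \<open>B_i\<close> and
  \<open>C_j\<close> that contains the vectors at \<open>p\<close>, so both flags are kept.\<close>

lemma normalise_decoration:
  assumes a: "adapted b c M v B C" and d: "antichain_decoration (length b) (length c) M \<Delta>"
    and x: "a = (\<Sum>\<iota>\<in>basis_index (length b) (length c) M. scale (x \<iota>) (v \<iota>))"
    and low: "\<And>\<iota>. \<lbrakk>\<iota> \<in> basis_index (length b) (length c) M; x \<iota> \<noteq> 0\<rbrakk> \<Longrightarrow> pos_le_set (fst \<iota>, fst (snd \<iota>)) \<Delta>"
    and top: "\<And>i j. (i, j) \<in> \<Delta> \<Longrightarrow> \<exists>k. (i, j, k) \<in> basis_index (length b) (length c) M \<and> x (i, j, k) \<noteq> 0"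
  obtains v' where "adapted b c M v' B C" "a = (\<Sum>(i, j)\<in>\<Delta>. v' (i, j, 1))"
proof -
  let ?I = "basis_index (length b) (length c) M"
  define pos where "pos = (\<lambda>\<iota> :: nat \<times> nat \<times> nat. (fst \<iota>, fst (snd \<iota>)))"
  have I: "indexed_basis ?I v" using a unfolding adapted_def by blast
  have anti: "p = p'" if "p \<in> \<Delta>" "p' \<in> \<Delta>" "pos_le p p'" for p p'
    using d that unfolding antichain_decoration_def by blast
  have fin\<Delta>: "finite \<Delta>" using d unfolding antichain_decoration_def by (meson finite_SigmaI finite_atLeastAtMost finite_subset)
  have "\<forall>p\<in>\<Delta>. \<exists>k. (fst p, snd p, k) \<in> ?I \<and> x (fst p, snd p, k) \<noteq> 0" using top by simp
  then obtain kk where kk: "\<And>p. p \<in> \<Delta> \<Longrightarrow> (fst p, snd p, kk p) \<in> ?I \<and> x (fst p, snd p, kk p) \<noteq> 0" by metis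
  define S where "S = {\<iota> \<in> ?I. x \<iota> \<noteq> 0}"
  have finS: "finite S" unfolding S_def using finite_basis_index by simp
  \<comment> \<open>The choice of \<open>\<pi>\<close> is arbitrary except at the pivots
    \<open>h p\<close>, where the antichain property forces \<open>\<pi> (h p) = p\<close>.\<close>
  have "\<forall>\<iota>\<in>S. \<exists>p. p \<in> \<Delta> \<and> pos_le (pos \<iota>) p" using low unfolding S_def pos_le_set_def pos_def by blast
  then obtain \<pi> where \<pi>: "\<And>\<iota>. \<iota> \<in> S \<Longrightarrow> \<pi> \<iota> \<in> \<Delta> \<and> pos_le (pos \<iota>) (\<pi> \<iota>)" by metis
  define e where "e = (\<lambda>p :: nat \<times> nat. (fst p, snd p, 1 :: nat))"
  define h where "h = (\<lambda>p :: nat \<times> nat. (fst p, snd p, kk p))"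
  define z where "z p = (\<Sum>\<iota>\<in>{\<iota> \<in> S. \<pi> \<iota> = p}. scale (x \<iota>) (v \<iota>))" for p
  \<comment> \<open>\<open>z p\<close> takes the index with \<open>k = 1\<close>; the vector
    displaced from there moves to the index of the pivot. If pivot and first index coincide, only
    the first branch applies.\<close>
  define v' where "v' \<iota> = (if \<iota> \<in> e ` \<Delta> then z (pos \<iota>) else if \<iota> \<in> h ` \<Delta> then v (e (pos \<iota>)) else v \<iota>)" for \<iota>
  have pos_eh: "pos (e p) = p" "pos (h p) = p" for p unfolding pos_def e_def h_def by auto
  have eI: "e p \<in> ?I" if "p \<in> \<Delta>" for p using decoration_index[OF d that] unfolding e_def .
  have hS: "h p \<in> S" if "p \<in> \<Delta>" for p using kk[OF that] unfolding h_def S_def by simp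
  have \<pi>h: "\<pi> (h p) = p" if "p \<in> \<Delta>" for p using \<pi>[OF hS[OF that]] anti[OF that] pos_eh by metis
  have v'e: "v' (e p) = z p" if "p \<in> \<Delta>" for p using that unfolding v'_def pos_eh by simp
  have sum: "a = (\<Sum>(i, j)\<in>\<Delta>. v' (i, j, 1))"
  proof -
    have "a = (\<Sum>\<iota>\<in>S. scale (x \<iota>) (v \<iota>))"
      unfolding x S_def using finite_basis_index by (intro sum.mono_neutral_right) auto
    also have "\<dots> = (\<Sum>p\<in>\<Delta>. z p)"
      unfolding z_def using \<pi> by (intro sum.group[symmetric] finS fin\<Delta>) auto
    also have "\<dots> = (\<Sum>p\<in>\<Delta>. v' (e p))" using v'e by simp
    finally show ?thesis unfolding e_def case_prod_unfold .
  qed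
  define G where "G = span (v' ` ?I)"
  have G1: "v \<iota> \<in> G" if "\<iota> \<in> ?I" "\<iota> \<notin> h ` \<Delta>" for \<iota>
  proof (cases "\<iota> \<in> e ` \<Delta>")
    case False
    then have "v' \<iota> = v \<iota>" using that unfolding v'_def by simp
    then show ?thesis unfolding G_def using that(1) by (metis span_base imageI)
  next
    case True
    then obtain p where p: "p \<in> \<Delta>" "\<iota> = e p" by blast
    have "h p \<notin> e ` \<Delta>"
    proof
      assume "h p \<in> e ` \<Delta>"
      then obtain p' where "h p = e p'" by blast
      then have "h p = e p" unfolding h_def e_def by auto
      then have "\<iota> \<in> h ` \<Delta>" using p by (metis imageI)
      then show False using that(2) by blast
    qed
    then have "v' (h p) = v \<iota>" using p unfolding v'_def pos_eh by simp
    moreover have "h p \<in> ?I" using hS[OF p(1)] unfolding S_def by simp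
    ultimately show ?thesis unfolding G_def by (metis span_base imageI)
  qed
  have G2: "v (h p) \<in> G" if p: "p \<in> \<Delta>" for p
  proof -
    let ?F = "{\<iota> \<in> S. \<pi> \<iota> = p}"
    have "z p \<in> G" unfolding G_def v'e[OF p, symmetric] using eI[OF p] by (intro span_base) simp
    moreover have "(\<Sum>\<iota>\<in>?F - {h p}. scale (x \<iota>) (v \<iota>)) \<in> G"
      unfolding G_def
    proof (intro span_sum span_scale)
      fix \<iota> assume \<iota>: "\<iota> \<in> ?F - {h p}"
      then have "\<iota> \<notin> h ` \<Delta>" using \<pi>h by auto
      then show "v \<iota> \<in> span (v' ` ?I)" using G1[of \<iota>] \<iota> unfolding G_def S_def by blast
    qed
    moreover have "z p = scale (x (h p)) (v (h p)) + (\<Sum>\<iota>\<in>?F - {h p}. scale (x \<iota>) (v \<iota>))"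
      unfolding z_def using hS[OF p] \<pi>h[OF p] finS by (intro sum.remove) auto
    ultimately have "scale (x (h p)) (v (h p)) \<in> G"
      unfolding G_def using span_diff[of "z p" "v' ` ?I" "\<Sum>\<iota>\<in>?F - {h p}. scale (x \<iota>) (v \<iota>)"]
      by simp
    then have "scale (inverse (x (h p))) (scale (x (h p)) (v (h p))) \<in> G" unfolding G_def by (rule span_scale)
    moreover have "x (h p) \<noteq> 0" using hS[OF p] unfolding S_def by simp
    ultimately show ?thesis by simp
  qed
  have "v ` ?I \<subseteq> G" using G1 G2 by blast
  then have "span (v ` ?I) \<subseteq> G" unfolding G_def by (rule span_minimal) simp
  then have "span (v' ` ?I) = UNIV" using I unfolding G_def indexed_basis_def by auto
  then have I': "indexed_basis ?I v'"
    by (intro indexed_basis_if_spanning finite_basis_index card_indexed_basis[OF I])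
  \<comment> \<open>One inclusion holds for every downward closed set of indices, and equality
    follows by comparing dimensions.\<close>
  have J: "span (v' ` J) = span (v ` J)"
    if J: "J \<subseteq> ?I" and dn: "\<And>\<iota> \<iota>'. \<lbrakk>\<iota> \<in> J; \<iota>' \<in> ?I; pos_le (pos \<iota>') (pos \<iota>)\<rbrakk> \<Longrightarrow> \<iota>' \<in> J" for J
  proof (rule subspace_dim_equal)
    have "v' \<iota> \<in> span (v ` J)" if \<iota>: "\<iota> \<in> J" for \<iota>
    proof -
      consider p where "p \<in> \<Delta>" "\<iota> = e p" | p where "p \<in> \<Delta>" "\<iota> = h p" "\<iota> \<notin> e ` \<Delta>" | "\<iota> \<notin> e ` \<Delta>" "\<iota> \<notin> h ` \<Delta>" by blast
      then show ?thesis
      proof cases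
        case 1
        have "z p \<in> span (v ` J)" unfolding z_def
        proof (intro span_sum span_scale span_base imageI)
          fix \<iota>' assume "\<iota>' \<in> {\<iota> \<in> S. \<pi> \<iota> = p}"
          then show "\<iota>' \<in> J" using \<pi>[of \<iota>'] dn[OF \<iota>, of \<iota>'] unfolding 1 pos_eh S_def by auto
        qed
        then show ?thesis using v'e 1 by simp
      next
        case 2
        then have "v' \<iota> = v (e p)" unfolding v'_def pos_eh 2 by (simp add: pos_eh)
        moreover have "e p \<in> J" using dn[OF \<iota> eI[OF 2(1)]] unfolding 2 pos_eh pos_le_def by simp
        ultimately show ?thesis by (simp add: span_base)
      next
        case 3
        then have "v' \<iota> = v \<iota>" unfolding v'_def by simp
        then show ?thesis using \<iota> by (simp add: span_base)
      qed
    qed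
    then show "span (v' ` J) \<subseteq> span (v ` J)" by (intro span_minimal) auto
    show "dim (span (v ` J)) \<le> dim (span (v' ` J))"
      using dim_indexed_span[OF I J] dim_indexed_span[OF I' J] by simp
  qed auto
  have "span (v' ` {\<iota> \<in> ?I. fst \<iota> \<le> i}) = span (v ` {\<iota> \<in> ?I. fst \<iota> \<le> i})" for i
    by (rule J) (auto simp: pos_le_def pos_def)
  moreover have "span (v' ` {\<iota> \<in> ?I. fst (snd \<iota>) \<le> i}) = span (v ` {\<iota> \<in> ?I. fst (snd \<iota>) \<le> i})" for i
    by (rule J) (auto simp: pos_le_def pos_def)
  ultimately have "adapted b c M v' B C" using a I' unfolding adapted_def by simp
  then show ?thesis using that sum by blast
qed

section \<open>Existence of adapted bases and decorations\<close>

lemma relative_basis: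
  assumes "subspace U" "subspace W" "U \<subseteq> W"
  shows "\<exists>K. K \<subseteq> W \<and> finite K \<and> card K + dim U = dim W \<and> W \<subseteq> span (U \<union> K)"
proof -
  obtain BU where BU: "BU \<subseteq> U" "independent BU" "U \<subseteq> span BU" "card BU = dim U" by (rule basis_exists)
  have "BU \<subseteq> W" using BU assms by blast
  obtain BW where BW: "BU \<subseteq> BW" "BW \<subseteq> W" "independent BW" "W \<subseteq> span BW"
    by (rule maximal_independent_subset_extend[OF \<open>BU \<subseteq> W\<close> BU(2)])
  have fin: "finite BW" using finiteI_independent[OF BW(3)] .
  have "card (BW - BU) + dim U = dim W"
    using card_Diff_subset[OF finite_subset[OF BW(1) fin] BW(1)] card_mono[OF fin BW(1)]
      basis_card_eq_dim[OF BW(2,4,3)] BU(4) by simp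
  moreover have "BW \<subseteq> U \<union> (BW - BU)" using BU by blast
  then have "W \<subseteq> span (U \<union> (BW - BU))" using BW(4) span_mono by blast
  ultimately show ?thesis using BW fin by (intro exI[of _ "BW - BU"]) auto
qed

lemma flags_mono:
  assumes "B \<in> flags b" "i' \<le> i" "i \<le> length b"
  shows "B ! i' \<subseteq> B ! i"
  using assms(2,3)
proof (induction rule: dec_induct)
  case base
  then show ?case by simp
next
  case (step i)
  have "\<forall>i\<in>{1..length b}. B ! (i - 1) \<subseteq> B ! i" using assms(1) unfolding flags_def by blast
  then have "B ! i \<subseteq> B ! Suc i" using step.prems by force
  then show ?case using step by auto
qed

lemma flags_basic:
  assumes "B \<in> flags b"
  shows "length B = length b + 1" "B ! 0 = {0}" "B ! length b = UNIV" "i \<le> length b \<Longrightarrow> subspace (B ! i)"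
    "\<lbrakk>0 < i; i \<le> length b\<rbrakk> \<Longrightarrow> dim (B ! i) = dim (B ! (i - 1)) + b ! (i - 1)"
  using assms unfolding flags_def by auto

text \<open>Relative position of two flags: choose in each intersection of \<open>B_i\<close> and
  \<open>C_j\<close> vectors \<open>K i j\<close> that span it together with the two smaller
  intersections, as few as possible. All these vectors span the space, and their number is its
  dimension, so they form a basis.\<close>

theorem exists_adapted:
  assumes B: "B \<in> flags b" and C: "C \<in> flags c"
  obtains M v where "transport_matrix b c M" "adapted b c M v B C"
proof -
  define q r where "q = length b" and "r = length c"
  define W where "W i j = B ! i \<inter> C ! j" for i j
  define \<rho> where "\<rho> i j = int (dim (W i j))" for i j
  define U where "U i j = {x + y | x y. x \<in> W (i - 1) j \<and> y \<in> W i (j - 1)}" for i j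
  have subW: "subspace (W i j)" if "i \<le> q" "j \<le> r" for i j
    using that flags_basic(4)[OF B] flags_basic(4)[OF C] subspace_inter unfolding W_def q_def r_def by blast
  have W0: "W 0 j = {0}" if "j \<le> r" for j
    using flags_basic(2)[OF B] subspace_0[OF flags_basic(4)[OF C]] that unfolding W_def r_def by auto
  have W0': "W i 0 = {0}" if "i \<le> q" for i
    using flags_basic(2)[OF C] subspace_0[OF flags_basic(4)[OF B]] that unfolding W_def q_def by auto
  have Wr: "W i r = B ! i" for i using flags_basic(3)[OF C] unfolding W_def r_def by simp
  have Wq: "W q j = C ! j" for j using flags_basic(3)[OF B] unfolding W_def q_def by simp
  have monoW: "W i' j' \<subseteq> W i j" if "i' \<le> i" "j' \<le> j" "i \<le> q" "j \<le> r" for i j i' j'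
    using flags_mono[OF B that(1)] flags_mono[OF C that(2)] that unfolding W_def q_def r_def by blast
  have U: "U i j = span (W (i - 1) j \<union> W i (j - 1))" if "i \<le> q" "j \<le> r" for i j
    unfolding U_def using that by (intro span_Un_subspaces[symmetric] subW) auto
  have "\<forall>p :: nat \<times> nat. \<exists>K. fst p \<in> {1..q} \<longrightarrow> snd p \<in> {1..r} \<longrightarrow> K \<subseteq> W (fst p) (snd p) \<and> finite K \<and>
      card K + dim (U (fst p) (snd p)) = dim (W (fst p) (snd p)) \<and> W (fst p) (snd p) \<subseteq> span (U (fst p) (snd p) \<union> K)"
  proof
    fix p :: "nat \<times> nat"
    obtain i j where p: "p = (i, j)" by (cases p)
    show "\<exists>K. fst p \<in> {1..q} \<longrightarrow> snd p \<in> {1..r} \<longrightarrow> K \<subseteq> W (fst p) (snd p) \<and> finite K \<and>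
      card K + dim (U (fst p) (snd p)) = dim (W (fst p) (snd p)) \<and> W (fst p) (snd p) \<subseteq> span (U (fst p) (snd p) \<union> K)"
    proof (cases "i \<in> {1..q} \<and> j \<in> {1..r}")
      case True
      have "U i j \<subseteq> W i j" unfolding U[OF True[THEN conjunct1, simplified, THEN conjunct2] True[THEN conjunct2, simplified, THEN conjunct2]]
        by (intro span_minimal subW Un_least monoW) (use True in auto)
      then obtain K where "K \<subseteq> W i j" "finite K" "card K + dim (U i j) = dim (W i j)" "W i j \<subseteq> span (U i j \<union> K)"
        using relative_basis[of "U i j" "W i j"] subW[of i j] U[of i j] True by auto
      then show ?thesis unfolding p by auto
    next
      case False
      then show ?thesis unfolding p by auto
    qed
  qed
  then obtain K0 where K0: "\<And>p. \<lbrakk>fst p \<in> {1..q}; snd p \<in> {1..r}\<rbrakk> \<Longrightarrow> K0 p \<subseteq> W (fst p) (snd p) \<and> finite (K0 p) \<and>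
      card (K0 p) + dim (U (fst p) (snd p)) = dim (W (fst p) (snd p)) \<and>
      W (fst p) (snd p) \<subseteq> span (U (fst p) (snd p) \<union> K0 p)" by metis
  define K where "K i j = K0 (i, j)" for i j
  have K: "K i j \<subseteq> W i j" "finite (K i j)" "card (K i j) + dim (U i j) = dim (W i j)"
    "W i j \<subseteq> span (U i j \<union> K i j)" if "i \<in> {1..q}" "j \<in> {1..r}" for i j
    using K0[of "(i, j)"] that unfolding K_def by auto
  define M where "M i j = card (K i j)" for i j
  \<comment> \<open>The two smaller intersections meet in the one at \<open>(i - 1, j - 1)\<close>,
    so the dimension formula makes \<open>M\<close> the mixed difference of the dimensions. Row and
    column sums then telescope.\<close>
  have cardK: "int (M i j) = \<rho> i j - \<rho> (i - 1) j - \<rho> i (j - 1) + \<rho> (i - 1) (j - 1)"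
    if "i \<in> {1..q}" "j \<in> {1..r}" for i j
  proof -
    have "W (i - 1) j \<inter> W i (j - 1) = W (i - 1) (j - 1)"
      using flags_mono[OF B, of "i - 1" i] flags_mono[OF C, of "j - 1" j] that unfolding W_def q_def r_def by auto
    moreover have "i - 1 \<le> q" "i \<le> q" "j - 1 \<le> r" "j \<le> r" using that by auto
    ultimately have "dim (U i j) + dim (W (i - 1) (j - 1)) = dim (W (i - 1) j) + dim (W i (j - 1))"
      using dim_sums_Int[OF subW[of "i - 1" j] subW[of i "j - 1"]] unfolding U_def by simp
    then show ?thesis using K(3)[OF that] unfolding M_def \<rho>_def by linarith
  qed
  have rowsum: "(\<Sum>l\<in>{1..j}. int (M i l)) = \<rho> i j - \<rho> (i - 1) j" if "i \<in> {1..q}" "j \<le> r" for i j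
    using that(2)
  proof (induction j)
    case 0
    have "i \<le> q" "i - 1 \<le> q" using that by auto
    then show ?case using W0'[of i] W0'[of "i - 1"] unfolding \<rho>_def by simp
  next
    case (Suc j)
    then show ?case using cardK[OF that(1), of "Suc j"] by simp
  qed
  have colsum: "(\<Sum>k\<in>{1..i}. int (M k j)) = \<rho> i j - \<rho> i (j - 1)" if "j \<in> {1..r}" "i \<le> q" for i j
    using that(2)
  proof (induction i)
    case 0
    have "j \<le> r" "j - 1 \<le> r" using that by auto
    then show ?case using W0[of j] W0[of "j - 1"] unfolding \<rho>_def by simp
  next
    case (Suc i)
    then show ?case using cardK[OF _ that(1), of "Suc i"] by simp
  qed
  have total: "(\<Sum>k\<in>{1..i}. \<Sum>l\<in>{1..r}. int (M k l)) = \<rho> i r" if "i \<le> q" for i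
    using that
  proof (induction i)
    case 0
    then show ?case using W0[of r] unfolding \<rho>_def by simp
  next
    case (Suc i)
    then show ?case using rowsum[of "Suc i" r] by simp
  qed
  have transport: "transport_matrix b c M"
  proof -
    have "b ! (i - 1) = (\<Sum>j\<in>{1..r}. M i j)" if "i \<in> {1..q}" for i
    proof -
      have "int (\<Sum>j\<in>{1..r}. M i j) = int (b ! (i - 1))"
        using rowsum[OF that order_refl] flags_basic(5)[OF B, of i] that unfolding \<rho>_def Wr q_def by simp
      then show ?thesis by linarith
    qed
    moreover have "c ! (j - 1) = (\<Sum>i\<in>{1..q}. M i j)" if "j \<in> {1..r}" for j
    proof -
      have "int (\<Sum>i\<in>{1..q}. M i j) = int (c ! (j - 1))"
        using colsum[OF that order_refl] flags_basic(5)[OF C, of j] that unfolding \<rho>_def Wq r_def by simp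
      then show ?thesis by linarith
    qed
    ultimately show ?thesis unfolding transport_matrix_def q_def r_def by simp
  qed
  define L where "L i j = (\<Union>k\<in>{1..i}. \<Union>l\<in>{1..j}. K k l)" for i j
  \<comment> \<open>Induction on \<open>i + j\<close>: the part \<open>U i j\<close> is covered by
    the two smaller intersections.\<close>
  have spanL: "W i j \<subseteq> span (L i j)" if "i \<le> q" "j \<le> r" for i j
    using that
  proof (induction "i + j" arbitrary: i j rule: less_induct)
    case less
    show ?case
    proof (cases "i = 0 \<or> j = 0")
      case True
      then show ?thesis using W0 W0' less.prems span_zero by auto
    next
      case False
      have m: "span (L (i - 1) j) \<subseteq> span (L i j)" "span (L i (j - 1)) \<subseteq> span (L i j)"
        by (rule span_mono, force simp: L_def)+
      have "W (i - 1) j \<subseteq> span (L i j)" "W i (j - 1) \<subseteq> span (L i j)"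
        using less.hyps[of "i - 1" j] less.hyps[of i "j - 1"] less.prems False m by auto
      then have "U i j \<subseteq> span (L i j)" unfolding U[OF less.prems] by (intro span_minimal) auto
      moreover have "K i j \<subseteq> span (L i j)"
        using False unfolding L_def by (intro subset_trans[OF _ span_superset]) force
      ultimately have "span (U i j \<union> K i j) \<subseteq> span (L i j)" by (intro span_minimal) auto
      then show ?thesis using K(4)[of i j] less.prems False by auto
    qed
  qed
  have "\<forall>p :: nat \<times> nat. \<exists>h. fst p \<in> {1..q} \<longrightarrow> snd p \<in> {1..r} \<longrightarrow> bij_betw h {1..M (fst p) (snd p)} (K (fst p) (snd p))"
    using ex_bij_betw_nat_finite_1 K(2) unfolding M_def by metis
  then obtain h where h: "\<And>i j. \<lbrakk>i \<in> {1..q}; j \<in> {1..r}\<rbrakk> \<Longrightarrow> bij_betw (h (i, j)) {1..M i j} (K i j)"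
    by (metis fst_conv snd_conv)
  define v where "v = (\<lambda>(i, j, k). h (i, j) k)"
  define I where "I = basis_index q r M"
  have im: "v ` {\<iota> \<in> I. fst \<iota> \<le> i \<and> fst (snd \<iota>) \<le> j} = L i j" if "i \<le> q" "j \<le> r" for i j
  proof -
    have "{\<iota> \<in> I. fst \<iota> \<le> i \<and> fst (snd \<iota>) \<le> j} = (SIGMA k:{1..i}. SIGMA l:{1..j}. {1..M k l})"
      unfolding I_def basis_index_def using that by auto
    moreover have "v ` (SIGMA k:K. SIGMA l:L. N k l) = (\<Union>k\<in>K. \<Union>l\<in>L. h (k, l) ` N k l)" for K L N
    proof (rule Set.set_eqI)
      fix y
      show "y \<in> v ` (SIGMA k:K. SIGMA l:L. N k l) \<longleftrightarrow> y \<in> (\<Union>k\<in>K. \<Union>l\<in>L. h (k, l) ` N k l)"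
        unfolding image_iff UN_iff Bex_def by (auto simp: v_def)
    qed
    ultimately have "v ` {\<iota> \<in> I. fst \<iota> \<le> i \<and> fst (snd \<iota>) \<le> j} = (\<Union>k\<in>{1..i}. \<Union>l\<in>{1..j}. h (k, l) ` {1..M k l})"
      by simp
    also have "\<dots> = L i j"
      unfolding L_def using h that by (intro SUP_cong refl) (auto simp: bij_betw_def)
    finally show ?thesis .
  qed
  have Ir: "{\<iota> \<in> I. fst \<iota> \<le> i} = {\<iota> \<in> I. fst \<iota> \<le> i \<and> fst (snd \<iota>) \<le> r}" for i
    unfolding I_def basis_index_def by auto
  have Iq: "{\<iota> \<in> I. fst (snd \<iota>) \<le> j} = {\<iota> \<in> I. fst \<iota> \<le> q \<and> fst (snd \<iota>) \<le> j}" for j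
    unfolding I_def basis_index_def by auto
  have LW: "span (L i j) = W i j" if "i \<le> q" "j \<le> r" for i j
  proof
    have "L i j \<subseteq> W i j" unfolding L_def
    proof (intro UN_least)
      fix k l assume "k \<in> {1..i}" "l \<in> {1..j}"
      then show "K k l \<subseteq> W i j" using K(1)[of k l] monoW[of k i l j] that by auto
    qed
    then show "span (L i j) \<subseteq> W i j" using span_minimal subW[OF that] by blast
  qed (rule spanL[OF that])
  have Bi: "B ! i = span (v ` {\<iota> \<in> I. fst \<iota> \<le> i})" if "i \<le> q" for i
    unfolding Ir im[OF that order_refl] LW[OF that order_refl] Wr ..
  have Cj: "C ! j = span (v ` {\<iota> \<in> I. fst (snd \<iota>) \<le> j})" if "j \<le> r" for j
    unfolding Iq im[OF order_refl that] LW[OF order_refl that] Wq ..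
  have II: "{\<iota> \<in> I. fst \<iota> \<le> q \<and> fst (snd \<iota>) \<le> r} = I" unfolding I_def basis_index_def by auto
  have Wqr: "W q r = UNIV" using Wr[of q] flags_basic(3)[OF B] unfolding q_def by simp
  have "indexed_basis I v"
  proof (rule indexed_basis_if_spanning)
    show "finite I" unfolding I_def by (rule finite_basis_index)
    have "card I = rank_num M q r" using card_basis_index_rank[of q q r r M] II unfolding I_def by simp
    also have "\<dots> = dim (W q r)" using total[of q] unfolding rank_num_def \<rho>_def
      by (simp flip: of_nat_sum)
    finally show "card I = dim UNIV" unfolding Wqr .
    show "span (v ` I) = UNIV" using im[of q r] LW[of q r] unfolding II Wqr by simp
  qed
  then have "adapted b c M v B C"
    unfolding adapted_def q_def[symmetric] r_def[symmetric] I_def[symmetric]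
    using Bi Cj flags_basic(1)[OF B] flags_basic(1)[OF C] unfolding q_def r_def by simp
  then show ?thesis using that transport by blast
qed

lemma exists_above_maximal:
  fixes S :: "(nat \<times> nat) set"
  assumes "finite S" "p \<in> S"
  obtains p' where "p' \<in> S" "pos_le p p'" "\<And>p''. \<lbrakk>p'' \<in> S; pos_le p' p''\<rbrakk> \<Longrightarrow> p'' = p'"
proof -
  let ?S = "{p' \<in> S. pos_le p p'}"
  have "p \<in> ?S" using assms unfolding pos_le_def by simp
  moreover have "finite ?S" using assms(1) by simp
  ultimately have "Max ((\<lambda>p. fst p + snd p) ` ?S) \<in> (\<lambda>p. fst p + snd p) ` ?S"
    by (intro Max_in) blast+
  then obtain p' where p': "p' \<in> ?S" "Max ((\<lambda>p. fst p + snd p) ` ?S) = fst p' + snd p'" by blast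
  have max: "fst p'' + snd p'' \<le> fst p' + snd p'" if "p'' \<in> ?S" for p''
    unfolding p'(2)[symmetric] using that \<open>finite ?S\<close> by (intro Max_ge) auto
  show ?thesis
  proof (rule that[of p'])
    show "p' \<in> S" "pos_le p p'" using p'(1) by auto
    fix p'' assume *: "p'' \<in> S" "pos_le p' p''"
    then have "pos_le p p''" using \<open>pos_le p p'\<close> unfolding pos_le_def by auto
    then have "\<not> fst p' + snd p' < fst p'' + snd p''" using max[of p''] * by simp
    then show "p'' = p'" using *(2) unfolding pos_le_def by (simp add: prod_eq_iff)
  qed
qed

text \<open>\<open>\<Delta>\<close> consists of the maximal positions at which a generator of
  \<open>A\<close> has a nonzero coefficient; \<open>normalise_decoration\<close> then makes all its
  coefficients standard.\<close>

theorem exists_decoration: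
  assumes "(A, B, C) \<in> triple_flags b c"
  obtains M v \<Delta> where "transport_matrix b c M" "adapted b c M v B C"
    "antichain_decoration (length b) (length c) M \<Delta>" "A = span {\<Sum>(i, j)\<in>\<Delta>. v (i, j, 1)}"
proof -
  have f: "A \<in> lines" "B \<in> flags b" "C \<in> flags c" using assms unfolding triple_flags_def by auto
  obtain M v where M: "transport_matrix b c M" and a: "adapted b c M v B C"
    by (rule exists_adapted[OF f(2,3)])
  let ?I = "basis_index (length b) (length c) M"
  have I: "indexed_basis ?I v" using a unfolding adapted_def by blast
  have "\<exists>a. a \<noteq> 0 \<and> A = span {a}"
  proof -
    have A: "subspace A" "dim A = 1" using f(1) unfolding lines_def by auto
    obtain X where X: "X \<subseteq> A" "independent X" "A \<subseteq> span X" "card X = dim A" by (rule basis_exists)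
    then obtain a where "X = {a}" using A(2) by (metis card_1_singletonE)
    then have "a \<noteq> 0" "A = span {a}" using X span_minimal[OF X(1) A(1)] by (auto simp: dependent_single)
    then show ?thesis by blast
  qed
  then obtain a0 where a0: "a0 \<noteq> 0" "A = span {a0}" by blast
  obtain x where x: "a0 = (\<Sum>\<iota>\<in>?I. scale (x \<iota>) (v \<iota>))" by (rule indexed_expansion[OF I finite_basis_index])
  define S where "S = (\<lambda>\<iota>. (fst \<iota>, fst (snd \<iota>))) ` {\<iota> \<in> ?I. x \<iota> \<noteq> 0}"
  have finS: "finite S" unfolding S_def using finite_basis_index by auto
  define \<Delta> where "\<Delta> = {p \<in> S. \<forall>p'\<in>S. pos_le p p' \<longrightarrow> p' = p}"
  have above: "\<exists>p'\<in>\<Delta>. pos_le p p'" if p: "p \<in> S" for p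
  proof -
    obtain p' where "p' \<in> S" "pos_le p p'" "\<And>p''. \<lbrakk>p'' \<in> S; pos_le p' p''\<rbrakk> \<Longrightarrow> p'' = p'"
      by (rule exists_above_maximal[OF finS p]) (rule that)
    then show ?thesis unfolding \<Delta>_def by blast
  qed
  have "\<exists>\<iota>\<in>?I. x \<iota> \<noteq> 0"
  proof (rule ccontr)
    assume "\<not> ?thesis"
    then have "a0 = 0" unfolding x by (intro sum.neutral) auto
    then show False using a0 by simp
  qed
  then have "S \<noteq> {}" unfolding S_def by blast
  then have "\<Delta> \<noteq> {}" using above by blast
  moreover have "0 < M (fst p) (snd p) \<and> p \<in> {1..length b} \<times> {1..length c}" if "p \<in> S" for p
    using that unfolding S_def basis_index_def by auto
  then have "\<Delta> \<subseteq> {1..length b} \<times> {1..length c}" "\<forall>(i, j)\<in>\<Delta>. 0 < M i j" unfolding \<Delta>_def by fastforce+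
  ultimately have d: "antichain_decoration (length b) (length c) M \<Delta>"
    unfolding antichain_decoration_def by (auto simp: \<Delta>_def)
  obtain v' where "adapted b c M v' B C" "a0 = (\<Sum>(i, j)\<in>\<Delta>. v' (i, j, 1))"
  proof (rule normalise_decoration[OF a d x])
    fix \<iota> assume "\<iota> \<in> ?I" "x \<iota> \<noteq> 0"
    then show "pos_le_set (fst \<iota>, fst (snd \<iota>)) \<Delta>" using above unfolding pos_le_set_def S_def by blast
  next
    fix i j assume "(i, j) \<in> \<Delta>"
    then show "\<exists>k. (i, j, k) \<in> ?I \<and> x (i, j, k) \<noteq> 0" unfolding \<Delta>_def S_def by auto
  qed (rule that)
  then show ?thesis using that M d a0 by blast
qed


section \<open>Elementary degenerations\<close>

lemma range_in_span:
  assumes "lin f" "indexed_basis I v" "\<And>\<iota>. \<iota> \<in> I \<Longrightarrow> f (v \<iota>) \<in> span {a}"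
  shows "f x \<in> span {a}"
proof -
  interpret f: Vector_Spaces.linear scale scale f by fact
  have "range f = span (f ` (v ` I))" using assms(2) f.span_image unfolding indexed_basis_def by metis
  also have "\<dots> \<subseteq> span {a}" using assms(3) by (intro span_minimal) auto
  finally show ?thesis by blast
qed

lemma vanishes_on_span:
  assumes "lin f" "\<And>\<iota>. \<iota> \<in> J \<Longrightarrow> f (v \<iota>) = 0" "x \<in> span (v ` J)"
  shows "f x = 0"
proof -
  interpret f: Vector_Spaces.linear scale scale f by fact
  show ?thesis using f.eq_0_on_span[of "v ` J" x] assms(2,3) by blast
qed

lemma agree_on_span:
  assumes "lin f" "lin g" "\<And>\<iota>. \<iota> \<in> J \<Longrightarrow> f (v \<iota>) = g (v \<iota>)" "x \<in> span (v ` J)"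
  shows "f x = g x"
proof -
  interpret vector_space_pair scale scale ..
  show ?thesis using linear_eq_on_span[OF assms(1,2), of "v ` J" x] assms(3,4) by blast
qed

lemma square_zero:
  assumes "lin f" "\<And>x. f x \<in> span {a}" "f a = 0"
  shows "f (f x) = 0"
  using vanishes_on_span[of f "{a}" "\<lambda>x. x" "f x"] assms by simp

lemma dim_eq_spanI: "span S = span T \<Longrightarrow> dim S = dim T"
  using dim_span by metis

lemma dim_perturb_image:
  assumes "lin f" "\<And>x. f (f x) = 0"
  shows "dim ((\<lambda>v. v + scale t (f v)) ` S) = dim S"
proof -
  interpret finite_dimensional_vector_space_pair_1 scale Basis scale ..
  show ?thesis
    by (rule dim_image_eq[OF lin_perturb[OF assms(1)]])
      (use inj_perturb[OF assms] inj_on_subset in blast)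
qed

text \<open>All displacements are multiples of \<open>a\<close>. Once the moved sum contains
  \<open>a\<close>, moved and original vectors differ by elements of it.\<close>

lemma span_perturb:
  assumes f: "\<And>x. f x \<in> span {a}" and B: "a \<in> span (P \<union> (\<lambda>v. v + scale t (f v)) ` S)"
  shows "span (P \<union> (\<lambda>v. v + scale t (f v)) ` S) = span (insert a (P \<union> S))"
proof
  let ?g = "\<lambda>v. v + scale t (f v)"
  have fs: "f x \<in> span W" if "a \<in> span W" for x W
    using f[of x] span_minimal[of "{a}" "span W"] that by auto
  have "?g x \<in> span (insert a (P \<union> S))" if "x \<in> S" for x
    using that fs[of "insert a (P \<union> S)" x] by (intro span_add span_scale) (auto intro: span_base)
  then show "span (P \<union> ?g ` S) \<subseteq> span (insert a (P \<union> S))"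
    by (intro span_minimal) (auto intro: span_base)
  have "x \<in> span (P \<union> ?g ` S)" if "x \<in> S" for x
  proof -
    have "?g x - scale t (f x) \<in> span (P \<union> ?g ` S)"
      using that fs[OF B, of x] by (intro span_diff span_scale) (auto intro: span_base)
    then show ?thesis by simp
  qed
  then show "span (insert a (P \<union> S)) \<subseteq> span (P \<union> ?g ` S)"
    using B by (intro span_minimal) (auto intro: span_base)
qed

section \<open>Moves of triple flags\<close>

text \<open>Three separate maps are essential: a common invertible map would keep the triple in its
  orbit.\<close>

definition move :: "('b \<Rightarrow> 'b) \<Rightarrow> ('b \<Rightarrow> 'b) \<Rightarrow> ('b \<Rightarrow> 'b) \<Rightarrow> 'b triple \<Rightarrow> 'a \<Rightarrow> 'b triple" where
  "move fA fB fC T t = (case T of (A, B, C) \<Rightarrow> ((\<lambda>v. v + scale t (fA v)) ` A,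
     map ((`) (\<lambda>v. v + scale t (fB v))) B, map ((`) (\<lambda>v. v + scale t (fC v))) C))"

abbreviation move_B :: "('b \<Rightarrow> 'b) \<Rightarrow> 'b triple \<Rightarrow> 'a \<Rightarrow> 'b triple" where
  "move_B f \<equiv> move (\<lambda>x. 0) f (\<lambda>x. 0)"

abbreviation move_AC :: "('b \<Rightarrow> 'b) \<Rightarrow> ('b \<Rightarrow> 'b) \<Rightarrow> 'b triple \<Rightarrow> 'a \<Rightarrow> 'b triple" where
  "move_AC fA fC \<equiv> move fA (\<lambda>x. 0) fC"

definition square_zero_map :: "('b \<Rightarrow> 'b) \<Rightarrow> bool" where
  "square_zero_map f \<longleftrightarrow> lin f \<and> (\<forall>x. f (f x) = 0)"

lemma square_zero_map_zero: "square_zero_map (\<lambda>x. 0)"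
proof -
  have "lin (\<lambda>x. 0)" by unfold_locales simp_all
  then show ?thesis unfolding square_zero_map_def by simp
qed

lemma square_zero_mapD:
  assumes "square_zero_map f"
  shows "lin f" "f (f x) = 0"
  using assms unfolding square_zero_map_def by auto

lemma subspace_perturb_image:
  assumes "square_zero_map f" "subspace S"
  shows "subspace ((\<lambda>v. v + scale t (f v)) ` S)"
proof -
  interpret g: Vector_Spaces.linear scale scale "\<lambda>v. v + scale t (f v)"
    by (rule lin_perturb[OF square_zero_mapD(1)[OF assms(1)]])
  show ?thesis by (rule g.subspace_image[OF assms(2)])
qed

lemma move_flags:
  assumes f: "square_zero_map f" and B: "B \<in> flags b"
  shows "map ((`) (\<lambda>v. v + scale t (f v))) B \<in> flags b"
proof -
  let ?g = "\<lambda>v. v + scale t (f v)"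
  interpret f: Vector_Spaces.linear scale scale f using square_zero_mapD[OF f] by blast
  have nth: "map ((`) ?g) B ! i = ?g ` (B ! i)" if "i \<le> length b" for i
    using that flags_basic(1)[OF B] by simp
  have surj: "?g ` UNIV = UNIV"
  proof -
    have "?g (w - scale t (f w)) = w" for w
      using square_zero_mapD(2)[OF f] by (simp add: f.diff f.scale)
    then show ?thesis by (rule surjI)
  qed
  have dim: "dim (?g ` S) = dim S" for S
    using dim_perturb_image square_zero_mapD[OF f] by blast
  have mono: "B ! (i - 1) \<subseteq> B ! i" if "i \<in> {1..length b}" for i
    using flags_mono[OF B, of "i - 1" i] that by auto
  show ?thesis unfolding flags_def mem_Collect_eq
  proof (intro conjI ballI)
    show "length (map ((`) ?g) B) = length b + 1" using flags_basic(1)[OF B] by simp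
    show "map ((`) ?g) B ! 0 = {0}" unfolding nth[OF le0] flags_basic(2)[OF B] by simp
    show "map ((`) ?g) B ! length b = UNIV" unfolding nth[OF order_refl] flags_basic(3)[OF B] by (rule surj)
    fix i assume "i \<in> {0..length b}"
    then show "subspace (map ((`) ?g) B ! i)"
      using nth[of i] subspace_perturb_image[OF f flags_basic(4)[OF B]] by simp
  next
    fix i assume i: "i \<in> {1..length b}"
    then have n: "map ((`) ?g) B ! i = ?g ` (B ! i)" "map ((`) ?g) B ! (i - 1) = ?g ` (B ! (i - 1))"
      using nth[of i] nth[of "i - 1"] by auto
    show "map ((`) ?g) B ! (i - 1) \<subseteq> map ((`) ?g) B ! i" unfolding n using mono[OF i] by blast
    show "dim (map ((`) ?g) B ! i) = dim (map ((`) ?g) B ! (i - 1)) + b ! (i - 1)"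
      unfolding n dim using flags_basic(5)[OF B, of i] i by simp
  qed
qed

lemma move_triple_flags:
  assumes "square_zero_map fA" "square_zero_map fB" "square_zero_map fC" "T \<in> triple_flags b c"
  shows "move fA fB fC T t \<in> triple_flags b c"
proof -
  obtain A B C where T: "T = (A, B, C)" by (cases T)
  have "A \<in> lines" "B \<in> flags b" "C \<in> flags c" using assms(4) unfolding T triple_flags_def by auto
  moreover from this have "(\<lambda>v. v + scale t (fA v)) ` A \<in> lines"
    using subspace_perturb_image[OF assms(1)] dim_perturb_image square_zero_mapD[OF assms(1)]
    unfolding lines_def by simp
  ultimately show ?thesis using move_flags assms unfolding T move_def triple_flags_def by simp
qed

lemma in_closure_if_moves:
  assumes inf: "infinite (UNIV :: 'a set)" and T: "T \<in> triple_flags b c"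
    and f: "square_zero_map fA" "square_zero_map fB" "square_zero_map fC"
    and cl: "\<And>t. t \<noteq> 0 \<Longrightarrow> move fA fB fC T t \<in> zariski_topology b c closure_of W"
  shows "T \<in> zariski_topology b c closure_of W"
proof -
  define F where "F x = (case x of Line \<Rightarrow> fA | FlagB i \<Rightarrow> fB | FlagC j \<Rightarrow> fC)" for x
  have F: "square_zero_map (F x)" for x unfolding F_def using f by (cases x) auto
  obtain A B C where TABC: "T = (A, B, C)" by (cases T)
  have len: "length B = length b + 1" "length C = length c + 1"
    using T flags_basic(1) unfolding TABC triple_flags_def by auto
  show ?thesis
  proof (rule in_closure_if_curve[OF inf T, of F "move fA fB fC T"])
    fix t x assume x: "x \<in> components b c"
    show "component_space (move fA fB fC T t) x = (\<lambda>v. v + scale t (F x v)) ` component_space T x"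
      using x len unfolding TABC move_def components_def F_def by auto
  qed (use square_zero_mapD[OF F] move_triple_flags[OF f T] cl in auto)
qed

text \<open>\<open>dim\<close> of a set is that of its span, so unions stand for sums of
  subspaces.\<close>

fun sum_dim :: "'b triple \<Rightarrow> nat \<Rightarrow> nat \<Rightarrow> nat" where
  "sum_dim (A, B, C) i j = dim (B ! i \<union> C ! j)"

fun total_dim :: "'b triple \<Rightarrow> nat \<Rightarrow> nat \<Rightarrow> nat" where
  "total_dim (A, B, C) i j = dim (A \<union> (B ! i \<union> C ! j))"

abbreviation same_dims :: "'b triple \<Rightarrow> 'b triple \<Rightarrow> nat \<Rightarrow> nat \<Rightarrow> bool" where
  "same_dims T T' i j \<equiv> sum_dim T' i j = sum_dim T i j \<and> total_dim T' i j = total_dim T i j"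

abbreviation dims_le_Suc :: "'b triple \<Rightarrow> 'b triple \<Rightarrow> nat \<Rightarrow> nat \<Rightarrow> bool" where
  "dims_le_Suc T T' i j \<equiv> sum_dim T' i j \<le> sum_dim T i j + 1 \<and> total_dim T' i j \<le> total_dim T i j + 1"

text \<open>\<open>f\<close> sends the basis vector at \<open>(i0, j0, k0)\<close> to the sum
  \<open>y\<close> over \<open>Y\<close> and kills the others. If \<open>(i0, j0)\<close> is below
  \<open>(i, j)\<close>, that vector lies in both \<open>B_i\<close> and \<open>C_j\<close>, so
  after moving \<open>B\<close> alone the sum gains \<open>y\<close>. Otherwise \<open>f\<close>
  kills \<open>B_i\<close> or \<open>C_j\<close> and nothing changes. If \<open>Y\<close> contains
  all summands of the generator of \<open>A\<close> outside \<open>B_i + C_j\<close>, then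
  \<open>y\<close> already lies in \<open>A + B_i + C_j\<close>.\<close>

lemma move_B_step:
  assumes a: "adapted b c M v B C" and d: "antichain_decoration (length b) (length c) M \<Delta>"
    and A: "A = span {\<Sum>(i, j)\<in>\<Delta>. v (i, j, 1)}"
    and \<iota>0: "(i0, j0, k0) \<in> basis_index (length b) (length c) M" "(i0, j0) \<in> \<Delta> \<Longrightarrow> k0 \<noteq> 1"
    and Y: "Y \<noteq> {}" "\<And>k l. (k, l) \<in> Y \<Longrightarrow> i0 < k \<and> k \<le> length b \<and> j0 < l \<and> l \<le> length c \<and> 0 < M k l"
  obtains f where "square_zero_map f"
    "\<And>t i j. \<lbrakk>t \<noteq> 0; i \<le> length b; j \<le> length c\<rbrakk> \<Longrightarrow>
       sum_dim (A, B, C) i j \<le> sum_dim (move_B f (A, B, C) t) i j"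
    "\<And>t. t \<noteq> 0 \<Longrightarrow> sum_dim (A, B, C) i0 j0 < sum_dim (move_B f (A, B, C) t) i0 j0"
    "\<And>t i j. \<lbrakk>t \<noteq> 0; i \<le> length b; j \<le> length c; i0 \<le> i; j0 \<le> j; \<exists>(k, l)\<in>Y. i < k \<and> j < l\<rbrakk> \<Longrightarrow>
       dims_le_Suc (A, B, C) (move_B f (A, B, C) t) i j"
    "\<And>t i j. \<lbrakk>t \<noteq> 0; i \<le> length b; j \<le> length c; i0 \<le> i; j0 \<le> j; Y \<subseteq> \<Delta>; \<not> pos_le_set (i + 1, j + 1) (\<Delta> - Y)\<rbrakk> \<Longrightarrow>
       total_dim (move_B f (A, B, C) t) i j \<le> total_dim (A, B, C) i j"
    "\<And>t i j. \<lbrakk>t \<noteq> 0; i \<le> length b; j \<le> length c; \<not> (i0 \<le> i \<and> j0 \<le> j \<and> (\<exists>(k, l)\<in>Y. i < k \<and> j < l))\<rbrakk> \<Longrightarrow>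
       same_dims (A, B, C) (move_B f (A, B, C) t) i j"
proof -
  let ?I = "basis_index (length b) (length c) M"
  define \<iota>0 where "\<iota>0 = (i0, j0, k0)"
  define a0 where "a0 = (\<Sum>(i, j)\<in>\<Delta>. v (i, j, 1))"
  define y where "y = (\<Sum>(i, j)\<in>Y. v (i, j, 1))"
  have I: "indexed_basis ?I v" using a unfolding adapted_def by blast
  have Bi: "B ! i = span (v ` {\<iota> \<in> ?I. fst \<iota> \<le> i})" if "i \<le> length b" for i using a that unfolding adapted_def by blast
  have Cj: "C ! j = span (v ` {\<iota> \<in> ?I. fst (snd \<iota>) \<le> j})" if "j \<le> length c" for j using a that unfolding adapted_def by blast
  have lenB: "length B = length b + 1" using a unfolding adapted_def by blast
  have YI: "(k, l, 1) \<in> ?I" "(k, l, 1) \<noteq> \<iota>0" if "(k, l) \<in> Y" for k l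
    using Y(2)[OF that] unfolding basis_index_def \<iota>0_def by auto
  have finY: "finite Y" by (rule finite_subset[of _ "{..length b} \<times> {..length c}"]) (use Y in auto)
  have Ydec: "antichain_decoration (length b) (length c) M \<Delta>" by (rule d)
  obtain f where f: "lin f" "\<And>\<iota>. \<iota> \<in> ?I \<Longrightarrow> f (v \<iota>) = (if \<iota> = \<iota>0 then y else 0)"
    by (rule indexed_linear_extend[OF I, of "\<lambda>\<iota>. if \<iota> = \<iota>0 then y else 0"]) (rule that)
  interpret f: Vector_Spaces.linear scale scale f by fact
  have fspan: "f x \<in> span {y}" for x
    by (rule range_in_span[OF f(1) I]) (auto simp: f(2) span_base span_zero)
  have fy: "f y = 0" unfolding y_def f.sum case_prod_unfold
    by (intro sum.neutral) (use f(2) YI in auto)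
  have ff: "f (f x) = 0" for x by (rule square_zero[OF f(1) fspan fy])
  have sq: "square_zero_map f" unfolding square_zero_map_def using f(1) ff by blast
  \<comment> \<open>The moved vector is not a summand of \<open>a0\<close>; this is where
    \<open>k0 \<noteq> 1\<close> on \<open>\<Delta>\<close> enters.\<close>
  have fa: "f a0 = 0" unfolding a0_def f.sum case_prod_unfold
  proof (intro sum.neutral ballI)
    fix p assume p: "p \<in> \<Delta>"
    have "(fst p, snd p, 1) \<noteq> \<iota>0" using \<iota>0(2) p unfolding \<iota>0_def by (cases p) auto
    then show "f (v (fst p, snd p, 1)) = 0" using f(2)[OF decoration_index[OF d p]] by simp
  qed
  have fA: "f x = 0" if "x \<in> A" for x
    using vanishes_on_span[OF f(1), of "{a0}" "\<lambda>x. x" x] fa that unfolding A a0_def by simp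
  have y_in: "y \<in> span (B ! i \<union> C ! j) \<longleftrightarrow> (\<forall>(k, l)\<in>Y. k \<le> i \<or> l \<le> j)" if ij: "i \<le> length b" "j \<le> length c" for i j
  proof -
    let ?e = "\<lambda>p. (fst p, snd p, 1::nat)"
    have "y = (\<Sum>\<iota>\<in>?e ` Y. v \<iota>)"
      unfolding y_def by (subst sum.reindex) (auto simp: inj_on_def case_prod_unfold)
    also have "\<dots> = (\<Sum>\<iota>\<in>?I. scale (if \<iota> \<in> ?e ` Y then 1 else 0) (v \<iota>))"
      using YI finite_basis_index by (intro sum.mono_neutral_cong_left) auto
    finally have ye: "y = (\<Sum>\<iota>\<in>?I. scale (if \<iota> \<in> ?e ` Y then 1 else 0) (v \<iota>))" .
    have "y \<in> span (B ! i \<union> C ! j) \<longleftrightarrow>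
      (\<forall>\<iota>\<in>?I - {\<iota> \<in> ?I. fst \<iota> \<le> i \<or> fst (snd \<iota>) \<le> j}. (if \<iota> \<in> ?e ` Y then 1 else 0 :: 'a) = 0)"
      unfolding adapted_sum[OF a ij] ye
      by (rule sum_in_indexed_span_iff[OF I finite_basis_index]) auto
    also have "\<dots> \<longleftrightarrow> (\<forall>\<iota>\<in>?I. \<iota> \<in> ?e ` Y \<longrightarrow> fst \<iota> \<le> i \<or> fst (snd \<iota>) \<le> j)" by auto
    also have "\<dots> \<longleftrightarrow> (\<forall>(k, l)\<in>Y. k \<le> i \<or> l \<le> j)" using YI by fastforce
    finally show ?thesis .
  qed
  let ?g = "\<lambda>t v. v + scale t (f v)"
  have mv: "sum_dim (move_B f (A, B, C) t) i j = dim (?g t ` (B ! i) \<union> C ! j)"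
    "total_dim (move_B f (A, B, C) t) i j = dim (A \<union> (?g t ` (B ! i) \<union> C ! j))"
    if "i \<le> length b" "j \<le> length c" for t i j
    using that lenB a unfolding move_def adapted_def by auto
  have inside: "dim (?g t ` (B ! i) \<union> C ! j) = dim (insert y (B ! i \<union> C ! j)) \<and>
      dim (A \<union> (?g t ` (B ! i) \<union> C ! j)) = dim (insert y (A \<union> (B ! i \<union> C ! j)))"
    if "t \<noteq> 0" "i \<le> length b" "j \<le> length c" "i0 \<le> i" "j0 \<le> j" for t i j
  proof -
    have xB: "v \<iota>0 \<in> B ! i" unfolding Bi[OF that(2)] using \<iota>0(1) that by (intro span_base imageI) (auto simp: \<iota>0_def)
    have xC: "v \<iota>0 \<in> C ! j" unfolding Cj[OF that(3)] using \<iota>0(1) that by (intro span_base imageI) (auto simp: \<iota>0_def)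
    have yin: "y \<in> span (P \<union> ?g t ` (B ! i))" if "C ! j \<subseteq> P" for P
    proof -
      have "?g t (v \<iota>0) - v \<iota>0 \<in> span (P \<union> ?g t ` (B ! i))"
        using xB xC that by (intro span_diff span_base) auto
      then have "scale t y \<in> span (P \<union> ?g t ` (B ! i))" using f(2) \<iota>0(1) unfolding \<iota>0_def by simp
      then have "scale (inverse t) (scale t y) \<in> span (P \<union> ?g t ` (B ! i))" by (rule span_scale)
      then show ?thesis using \<open>t \<noteq> 0\<close> by simp
    qed
    have "span (C ! j \<union> ?g t ` (B ! i)) = span (insert y (C ! j \<union> B ! i))"
      by (rule span_perturb[OF fspan yin]) simp
    moreover have "span ((A \<union> C ! j) \<union> ?g t ` (B ! i)) = span (insert y ((A \<union> C ! j) \<union> B ! i))"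
      by (rule span_perturb[OF fspan yin]) simp
    ultimately show ?thesis by (auto intro!: dim_eq_spanI simp: Un_ac)
  qed
  \<comment> \<open>If \<open>C_j\<close> is killed, \<open>1 + t f\<close> fixes both
    \<open>C_j\<close> and \<open>A\<close>, so the moved sum is the image of the whole old sum. If
    \<open>B_i\<close> is killed, it does not move.\<close>
  have outside: "dim (?g t ` (B ! i) \<union> C ! j) = dim (B ! i \<union> C ! j) \<and>
      dim (A \<union> (?g t ` (B ! i) \<union> C ! j)) = dim (A \<union> (B ! i \<union> C ! j))"
    if "i \<le> length b" "j \<le> length c" "\<not> (i0 \<le> i \<and> j0 \<le> j)" for t i j
  proof (cases "i0 \<le> i")
    case True
    have "f x = 0" if "x \<in> C ! j" for x
      by (rule vanishes_on_span[OF f(1), of "{\<iota> \<in> ?I. fst (snd \<iota>) \<le> j}" v])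
        (use that Cj[OF \<open>j \<le> length c\<close>] f(2) True \<open>\<not> (i0 \<le> i \<and> j0 \<le> j)\<close> in \<open>auto simp: \<iota>0_def\<close>)
    then have gC: "?g t ` (C ! j) = C ! j" by force
    have gA: "?g t ` A = A" using fA by force
    have "?g t ` (B ! i) \<union> C ! j = ?g t ` (B ! i \<union> C ! j)"
      "A \<union> (?g t ` (B ! i) \<union> C ! j) = ?g t ` (A \<union> (B ! i \<union> C ! j))"
      unfolding image_Un gC gA by (rule refl)+
    then show ?thesis using dim_perturb_image[OF f(1) ff] by simp
  next
    case False
    have "f x = 0" if "x \<in> B ! i" for x
      by (rule vanishes_on_span[OF f(1), of "{\<iota> \<in> ?I. fst \<iota> \<le> i}" v])
        (use that Bi[OF \<open>i \<le> length b\<close>] f(2) False in \<open>auto simp: \<iota>0_def\<close>)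
    then have "?g t ` (B ! i) = B ! i" by force
    then show ?thesis by simp
  qed
  show ?thesis
  proof (rule that[OF sq])
    fix t :: 'a and i j assume t: "t \<noteq> 0" and ij: "i \<le> length b" "j \<le> length c"
    show "sum_dim (A, B, C) i j \<le> sum_dim (move_B f (A, B, C) t) i j"
      unfolding mv[OF ij] using inside[OF t ij] outside[OF ij, of t] by (cases "i0 \<le> i \<and> j0 \<le> j") (auto simp: dim_insert)
  next
    fix t :: 'a assume t: "t \<noteq> 0"
    have ij: "i0 \<le> length b" "j0 \<le> length c" using \<iota>0(1) unfolding basis_index_def by auto
    have "y \<notin> span (B ! i0 \<union> C ! j0)" unfolding y_in[OF ij] using Y by fastforce
    then show "sum_dim (A, B, C) i0 j0 < sum_dim (move_B f (A, B, C) t) i0 j0"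
      unfolding mv[OF ij] using inside[OF t ij] by (simp add: dim_insert)
  next
    fix t :: 'a and i j assume t: "t \<noteq> 0" and ij: "i \<le> length b" "j \<le> length c" and le: "i0 \<le> i" "j0 \<le> j"
    show "dims_le_Suc (A, B, C) (move_B f (A, B, C) t) i j"
      unfolding mv[OF ij] using inside[OF t ij le] by (simp add: dim_insert)
  next
    fix t :: 'a and i j assume t: "t \<noteq> 0" and ij: "i \<le> length b" "j \<le> length c" and le: "i0 \<le> i" "j0 \<le> j"
      and sub: "Y \<subseteq> \<Delta>" and no: "\<not> pos_le_set (i + 1, j + 1) (\<Delta> - Y)"
    have fin: "finite \<Delta>" using d unfolding antichain_decoration_def
      by (meson finite_SigmaI finite_atLeastAtMost finite_subset)
    \<comment> \<open>\<open>y\<close> is the generator of \<open>A\<close> minus summands that lie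
      in \<open>B_i\<close> or \<open>C_j\<close>.\<close>
    have "a0 = (\<Sum>(i, j)\<in>\<Delta> - Y. v (i, j, 1)) + y"
      unfolding a0_def y_def by (rule sum.subset_diff[OF sub fin])
    moreover have "(\<Sum>(k, l)\<in>\<Delta> - Y. v (k, l, 1)) \<in> span (A \<union> (B ! i \<union> C ! j))"
    proof (intro span_sum, clarify)
      fix k l assume kl: "(k, l) \<in> \<Delta>" "(k, l) \<notin> Y"
      have I1: "(k, l, 1) \<in> ?I" using decoration_index[OF d kl(1)] by simp
      have "k \<le> i \<or> l \<le> j"
        using no kl unfolding pos_le_set_def pos_le_def by (force simp: not_le Suc_le_eq)
      then have "v (k, l, 1) \<in> B ! i \<union> C ! j"
        unfolding Bi[OF ij(1)] Cj[OF ij(2)] using I1 by (auto intro!: span_base)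
      then show "v (k, l, 1) \<in> span (A \<union> (B ! i \<union> C ! j))" by (intro span_base) auto
    qed
    moreover have "a0 \<in> span (A \<union> (B ! i \<union> C ! j))"
    proof -
      have "a0 \<in> A" unfolding A a0_def by (simp add: span_base)
      then show ?thesis by (intro span_base) simp
    qed
    ultimately have "y \<in> span (A \<union> (B ! i \<union> C ! j))" by (metis add_diff_cancel_left' span_diff)
    then show "total_dim (move_B f (A, B, C) t) i j \<le> total_dim (A, B, C) i j"
      unfolding mv[OF ij] using inside[OF t ij le] by (simp add: dim_insert)
  next
    fix t :: 'a and i j assume t: "t \<noteq> 0" and ij: "i \<le> length b" "j \<le> length c"
      and no: "\<not> (i0 \<le> i \<and> j0 \<le> j \<and> (\<exists>(k, l)\<in>Y. i < k \<and> j < l))"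
    show "same_dims (A, B, C) (move_B f (A, B, C) t) i j"
    proof (cases "i0 \<le> i \<and> j0 \<le> j")
      case True
      then have "\<forall>(k, l)\<in>Y. k \<le> i \<or> l \<le> j" using no by (auto simp: not_less)
      then have y: "y \<in> span (B ! i \<union> C ! j)" using y_in[OF ij] by blast
      moreover have "span (B ! i \<union> C ! j) \<subseteq> span (A \<union> (B ! i \<union> C ! j))" by (intro span_mono) auto
      ultimately show ?thesis unfolding mv[OF ij] using inside[OF t ij] True by (auto simp: dim_insert)
    next
      case False
      then show ?thesis unfolding mv[OF ij] using outside[OF ij] by simp
    qed
  qed
qed

text \<open>Outside the cells strictly below \<open>y\<close> in both coordinates, \<open>y\<close>
  is already in \<open>B_i + C_j\<close>. Below \<open>y\<close> and above some \<open>x\<close> in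
  \<open>X\<close>, the vector at \<open>x\<close> lies in \<open>B_i\<close> and in
  \<open>C_j\<close>, so the sum gains \<open>y\<close>. At the other cells the move of
  \<open>C_j\<close> extends to a map fixing \<open>B_i\<close>, which shifts the generator of
  \<open>A\<close> by \<open>y\<close> times the partial sum of \<open>\<beta>\<close>; if that is
  \<open>\<gamma>\<close>, the whole triple is moved by one invertible map.\<close>

lemma move_C_step:
  fixes \<beta> :: "nat \<times> nat \<Rightarrow> 'a"
  assumes a: "adapted b c M v B C" and d: "antichain_decoration (length b) (length c) M \<Delta>"
    and A: "A = span {\<Sum>(i, j)\<in>\<Delta>. v (i, j, 1)}"
    and y1: "i1 \<le> length b" "j1 \<le> length c" "0 < M i1 j1"
    and X: "X \<noteq> {}" "X \<subseteq> \<Delta>" "\<And>x. x \<in> X \<Longrightarrow> fst x < i1 \<and> snd x < j1" and \<beta>: "\<And>x. x \<in> X \<Longrightarrow> \<beta> x \<noteq> 0"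
  obtains fA f where "square_zero_map fA" "square_zero_map f"
    "\<And>t i j. \<lbrakk>t \<noteq> 0; i \<le> length b; j \<le> length c\<rbrakk> \<Longrightarrow>
       sum_dim (A, B, C) i j \<le> sum_dim (move_AC fA f (A, B, C) t) i j"
    "\<And>t x. \<lbrakk>t \<noteq> 0; x \<in> X\<rbrakk> \<Longrightarrow>
       sum_dim (A, B, C) (fst x) (snd x) < sum_dim (move_AC fA f (A, B, C) t) (fst x) (snd x)"
    "\<And>t i j x. \<lbrakk>t \<noteq> 0; i < i1; j < j1; x \<in> X; fst x \<le> i; snd x \<le> j\<rbrakk> \<Longrightarrow>
       dims_le_Suc (A, B, C) (move_AC fA f (A, B, C) t) i j"
    "\<And>t i j. \<lbrakk>t \<noteq> 0; i < i1; j < j1; \<not> (\<exists>x\<in>X. fst x \<le> i \<and> snd x \<le> j)\<rbrakk> \<Longrightarrow>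
       sum_dim (move_AC fA f (A, B, C) t) i j = sum_dim (A, B, C) i j \<and>
       total_dim (move_AC fA f (A, B, C) t) i j \<le> sum_dim (A, B, C) i j + 1 \<and>
       ((\<Sum>x\<in>{x \<in> X. snd x \<le> j}. \<beta> x) = \<gamma> \<longrightarrow>
         total_dim (move_AC fA f (A, B, C) t) i j = total_dim (A, B, C) i j)"
    "\<And>t i j. \<lbrakk>t \<noteq> 0; i \<le> length b; j \<le> length c; \<not> (i < i1 \<and> j < j1)\<rbrakk> \<Longrightarrow>
       same_dims (A, B, C) (move_AC fA f (A, B, C) t) i j"
proof -
  let ?I = "basis_index (length b) (length c) M"
  let ?e = "\<lambda>p. (fst p, snd p, 1::nat)"
  let ?p = "\<lambda>\<iota> :: nat \<times> nat \<times> nat. (fst \<iota>, fst (snd \<iota>))"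
  define a0 where "a0 = (\<Sum>(i, j)\<in>\<Delta>. v (i, j, 1))"
  define y where "y = v (i1, j1, 1)"
  have I: "indexed_basis ?I v" using a unfolding adapted_def by blast
  have Bi: "B ! i = span (v ` {\<iota> \<in> ?I. fst \<iota> \<le> i})" if "i \<le> length b" for i using a that unfolding adapted_def by blast
  have Cj: "C ! j = span (v ` {\<iota> \<in> ?I. fst (snd \<iota>) \<le> j})" if "j \<le> length c" for j using a that unfolding adapted_def by blast
  have lens: "length B = length b + 1" "length C = length c + 1" using a unfolding adapted_def by auto
  have fin: "finite \<Delta>" using d unfolding antichain_decoration_def
    by (meson finite_SigmaI finite_atLeastAtMost finite_subset)
  have finX: "finite X" using X(2) fin finite_subset by blast
  have eI: "?e p \<in> ?I" if "p \<in> \<Delta>" for p using decoration_index[OF d that] .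
  obtain x0 where x0: "x0 \<in> X" using X(1) by blast
  have yI: "(i1, j1, 1) \<in> ?I" using y1 X(3)[OF x0] unfolding basis_index_def by auto
  have ynot: "(i1, j1) \<notin> X" using X(3) by fastforce
  \<comment> \<open>Common construction of three maps: \<open>f\<close> with \<open>Z = X\<close>,
    \<open>fA\<close> with a single vector, and \<open>h\<close> below with the columns up to
    \<open>j\<close>.\<close>
  have map_of: "\<exists>f. lin f \<and> (\<forall>x. f x \<in> span {y}) \<and> (\<forall>x. f (f x) = 0) \<and> f y = 0 \<and>
      (\<forall>\<iota>\<in>?I. f (v \<iota>) = (if \<iota> \<in> ?e ` Z then scale (w (?p \<iota>)) y else 0)) \<and>
      f a0 = scale (\<Sum>x\<in>Z. w x) y" if Z: "Z \<subseteq> X" for Z and w :: "nat \<times> nat \<Rightarrow> 'a"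
  proof -
    obtain f where f: "lin f" "\<And>\<iota>. \<iota> \<in> ?I \<Longrightarrow> f (v \<iota>) = (if \<iota> \<in> ?e ` Z then scale (w (?p \<iota>)) y else 0)"
      by (rule indexed_linear_extend[OF I, of "\<lambda>\<iota>. if \<iota> \<in> ?e ` Z then scale (w (?p \<iota>)) y else 0"]) (rule that)
    interpret f: Vector_Spaces.linear scale scale f by fact
    have r: "f x \<in> span {y}" for x
      by (rule range_in_span[OF f(1) I]) (auto simp: f(2) span_base span_zero intro!: span_scale)
    have fy: "f y = 0" using f(2)[OF yI] ynot Z unfolding y_def by auto
    have "inj ?e" by (auto intro!: injI simp: prod_eq_iff)
    then have mem: "?e p \<in> ?e ` Z \<longleftrightarrow> p \<in> Z" for p by (rule inj_image_mem_iff)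
    have fe: "f (v (?e p)) = (if p \<in> Z then scale (w p) y else 0)" if "p \<in> \<Delta>" for p
      using f(2)[OF eI[OF that]] unfolding mem by simp
    have "f a0 = (\<Sum>p\<in>\<Delta>. f (v (?e p)))" unfolding a0_def f.sum case_prod_unfold ..
    also have "\<dots> = (\<Sum>p\<in>\<Delta>. if p \<in> Z then scale (w p) y else 0)" using fe by (intro sum.cong) auto
    also have "\<dots> = (\<Sum>p\<in>Z. scale (w p) y)"
      using Z X(2) fin by (intro sum.mono_neutral_cong_right) auto
    finally have fa0: "f a0 = scale (\<Sum>x\<in>Z. w x) y" by (simp add: scale_sum_left)
    show ?thesis
      by (rule exI[of _ f]) (use f r fy square_zero[OF f(1) r fy] fa0 in blast)
  qed
  obtain f where f: "lin f" "\<And>x. f x \<in> span {y}" "\<And>x. f (f x) = 0" "f y = 0"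
    "\<And>\<iota>. \<iota> \<in> ?I \<Longrightarrow> f (v \<iota>) = (if \<iota> \<in> ?e ` X then scale (\<beta> (?p \<iota>)) y else 0)"
    using map_of[OF subset_refl, of \<beta>] by auto
  \<comment> \<open>Only the value at the generator of \<open>A\<close> matters, so it is enough to
    move one summand.\<close>
  obtain fA where fA: "lin fA" "\<And>x. fA x \<in> span {y}" "\<And>x. fA (fA x) = 0" "fA a0 = scale \<gamma> y"
    using map_of[of "{x0}" "\<lambda>_. \<gamma>"] x0 by auto
  let ?g = "\<lambda>t v. v + scale t (f v)" and ?gA = "\<lambda>t v. v + scale t (fA v)"
  have gA: "?gA t ` A = span {a0 + scale (t * \<gamma>) y}" for t
  proof -
    interpret g: Vector_Spaces.linear scale scale "?gA t" by (rule lin_perturb[OF fA(1)])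
    show ?thesis unfolding A a0_def[symmetric] using g.span_image[of "{a0}"] fA(4) by simp
  qed
  have mv: "sum_dim (move_AC fA f (A, B, C) t) i j = dim (B ! i \<union> ?g t ` (C ! j))"
    "total_dim (move_AC fA f (A, B, C) t) i j = dim (span {a0 + scale (t * \<gamma>) y} \<union> (B ! i \<union> ?g t ` (C ! j)))"
    if "i \<le> length b" "j \<le> length c" for t i j
    using that lens unfolding move_def gA[symmetric] by auto
  have y_in: "y \<in> span (B ! i \<union> C ! j) \<longleftrightarrow> i1 \<le> i \<or> j1 \<le> j" if ij: "i \<le> length b" "j \<le> length c" for i j
    unfolding adapted_sum[OF a ij] y_def using basis_vec_in_span_iff[OF I _ yI] yI by auto
  have C_part: "span (B ! i \<union> ?g t ` (C ! j)) = span (insert y (B ! i \<union> C ! j))"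
    if "y \<in> span (B ! i \<union> ?g t ` (C ! j))" for t i j
    by (rule span_perturb[OF f(2) that])
  \<comment> \<open>Modulo \<open>y\<close> the old and new generators of \<open>A\<close>
    agree.\<close>
  have A_part: "span (span {a0 + scale (t * \<gamma>) y} \<union> (B ! i \<union> ?g t ` (C ! j))) = span (insert y (A \<union> (B ! i \<union> C ! j)))"
    if y: "y \<in> span (B ! i \<union> ?g t ` (C ! j))" for t i j
  proof -
    have 1: "span (span {w} \<union> S) = span (insert w S)" for w S
    proof -
      have "span (span {w} \<union> S) = span ({w} \<union> S)" unfolding span_Un span_span ..
      then show ?thesis by simp
    qed
    have 2: "span (insert w S) = span (insert w S')" if "span S = span S'" for w S S'
    proof -
      have "span ({w} \<union> S) = span ({w} \<union> S')" unfolding span_Un that ..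
      then show ?thesis by simp
    qed
    have 3: "span (insert (a0 + scale (t * \<gamma>) y) (insert y S)) = span (insert a0 (insert y S))" for S
    proof
      have "a0 + scale (t * \<gamma>) y \<in> span (insert a0 (insert y S))"
        by (intro span_add span_scale) (auto intro: span_base)
      then show "span (insert (a0 + scale (t * \<gamma>) y) (insert y S)) \<subseteq> span (insert a0 (insert y S))"
        by (intro span_minimal) (auto intro: span_base)
      have "(a0 + scale (t * \<gamma>) y) - scale (t * \<gamma>) y \<in> span (insert (a0 + scale (t * \<gamma>) y) (insert y S))"
        by (intro span_diff span_scale) (auto intro: span_base)
      then show "span (insert a0 (insert y S)) \<subseteq> span (insert (a0 + scale (t * \<gamma>) y) (insert y S))"
        by (intro span_minimal) (auto intro: span_base)
    qed
    show ?thesis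
      unfolding A a0_def[symmetric] 1 2[OF C_part[OF y]] 3
      using 1[of a0 "insert y (B ! i \<union> C ! j)"] by (simp add: insert_commute)
  qed
  have equal: "same_dims (A, B, C) (move_AC fA f (A, B, C) t) i j"
    if ij: "i \<le> length b" "j \<le> length c" and no: "\<not> (i < i1 \<and> j < j1)" for t i j
  proof -
    have y: "y \<in> span (B ! i \<union> C ! j)" using y_in[OF ij] no by auto
    have y': "y \<in> span (B ! i \<union> ?g t ` (C ! j))"
    proof (cases "i1 \<le> i")
      case True
      then have "y \<in> B ! i" unfolding Bi[OF ij(1)] y_def using yI by (intro span_base) auto
      then show ?thesis by (intro span_base) simp
    next
      case False
      then have "y \<in> C ! j" unfolding Cj[OF ij(2)] y_def using yI no by (intro span_base) auto
      then have "?g t y \<in> ?g t ` (C ! j)" by blast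
      then show ?thesis using f(4) by (intro span_base) simp
    qed
    have "dim (B ! i \<union> ?g t ` (C ! j)) = dim (insert y (B ! i \<union> C ! j))"
      "dim (span {a0 + scale (t * \<gamma>) y} \<union> (B ! i \<union> ?g t ` (C ! j))) = dim (insert y (A \<union> (B ! i \<union> C ! j)))"
      by (rule dim_eq_spanI[OF C_part[OF y']], rule dim_eq_spanI[OF A_part[OF y']])
    moreover have "y \<in> span (A \<union> (B ! i \<union> C ! j))" using y span_mono[of "B ! i \<union> C ! j" "A \<union> (B ! i \<union> C ! j)"] by blast
    ultimately show ?thesis unfolding mv[OF ij] using y by (simp add: dim_insert)
  qed
  have hit: "dim (B ! i \<union> ?g t ` (C ! j)) = dim (B ! i \<union> C ! j) + 1 \<and>
      dim (span {a0 + scale (t * \<gamma>) y} \<union> (B ! i \<union> ?g t ` (C ! j))) \<le> dim (A \<union> (B ! i \<union> C ! j)) + 1"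
    if t: "t \<noteq> 0" and ij: "i < i1" "j < j1" and x: "x \<in> X" "fst x \<le> i" "snd x \<le> j" for t i j x
  proof -
    have le: "i \<le> length b" "j \<le> length c" using ij y1 by auto
    have xI: "?e x \<in> ?I" using eI X(2) x(1) by blast
    have xB: "v (?e x) \<in> B ! i" unfolding Bi[OF le(1)] using xI x by (intro span_base imageI) simp
    have xC: "v (?e x) \<in> C ! j" unfolding Cj[OF le(2)] using xI x by (intro span_base imageI) simp
    have "?g t (v (?e x)) - v (?e x) \<in> span (B ! i \<union> ?g t ` (C ! j))"
      using xB xC by (intro span_diff span_base) auto
    moreover have "f (v (?e x)) = scale (\<beta> x) y" using f(5)[OF xI] x(1) by auto
    ultimately have "scale (t * \<beta> x) y \<in> span (B ! i \<union> ?g t ` (C ! j))" by simp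
    then have "scale (inverse (t * \<beta> x)) (scale (t * \<beta> x) y) \<in> span (B ! i \<union> ?g t ` (C ! j))" by (rule span_scale)
    moreover have "t * \<beta> x \<noteq> 0" using t \<beta>[OF x(1)] by simp
    ultimately have y: "y \<in> span (B ! i \<union> ?g t ` (C ! j))" by (simp del: mult_eq_0_iff inverse_mult_distrib)
    have "dim (B ! i \<union> ?g t ` (C ! j)) = dim (insert y (B ! i \<union> C ! j))"
      "dim (span {a0 + scale (t * \<gamma>) y} \<union> (B ! i \<union> ?g t ` (C ! j))) = dim (insert y (A \<union> (B ! i \<union> C ! j)))"
      by (rule dim_eq_spanI[OF C_part[OF y]], rule dim_eq_spanI[OF A_part[OF y]])
    then show ?thesis using y_in[OF le] ij by (simp add: dim_insert)
  qed
  have miss: "dim (B ! i \<union> ?g t ` (C ! j)) = dim (B ! i \<union> C ! j) \<and>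
      dim (span {a0 + scale (t * \<gamma>) y} \<union> (B ! i \<union> ?g t ` (C ! j))) \<le> dim (B ! i \<union> C ! j) + 1 \<and>
      ((\<Sum>x\<in>{x \<in> X. snd x \<le> j}. \<beta> x) = \<gamma> \<longrightarrow>
        dim (span {a0 + scale (t * \<gamma>) y} \<union> (B ! i \<union> ?g t ` (C ! j))) = dim (A \<union> (B ! i \<union> C ! j)))"
    if ij: "i < i1" "j < j1" and none: "\<And>x. \<lbrakk>x \<in> X; fst x \<le> i; snd x \<le> j\<rbrakk> \<Longrightarrow> False" for t i j
  proof -
    have le: "i \<le> length b" "j \<le> length c" using ij y1 by auto
    let ?Z = "{x \<in> X. snd x \<le> j}"
    \<comment> \<open>\<open>1 + t h\<close> fixes \<open>B\<^sub>i\<close> and acts on \<open>C\<^sub>j\<close> as \<open>1 + t f\<close> does\<close>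
    obtain h where h: "lin h" "\<And>x. h (h x) = 0"
      "\<And>\<iota>. \<iota> \<in> ?I \<Longrightarrow> h (v \<iota>) = (if \<iota> \<in> ?e ` ?Z then scale (\<beta> (?p \<iota>)) y else 0)"
      "h a0 = scale (\<Sum>x\<in>?Z. \<beta> x) y"
      using map_of[of ?Z \<beta>] by auto
    let ?h = "\<lambda>v. v + scale t (h v)"
    have h0: "h (v \<iota>) = 0" if "\<iota> \<in> {\<iota> \<in> ?I. fst \<iota> \<le> i}" for \<iota>
    proof -
      have "\<iota> \<notin> ?e ` ?Z" using none that by force
      then show ?thesis using h(3)[of \<iota>] that by simp
    qed
    have "h x = 0" if "x \<in> B ! i" for x
      using vanishes_on_span[OF h(1), of "{\<iota> \<in> ?I. fst \<iota> \<le> i}" v x] h0 that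
      unfolding Bi[OF le(1)] by blast
    then have hB: "?h ` (B ! i) = B ! i" by force
    have hf: "h (v \<iota>) = f (v \<iota>)" if "\<iota> \<in> {\<iota> \<in> ?I. fst (snd \<iota>) \<le> j}" for \<iota>
    proof -
      have "\<iota> \<in> ?e ` ?Z \<longleftrightarrow> \<iota> \<in> ?e ` X" using that by force
      then show ?thesis using h(3)[of \<iota>] f(5)[of \<iota>] that by simp
    qed
    have "h x = f x" if "x \<in> C ! j" for x
      using agree_on_span[OF h(1) f(1), of "{\<iota> \<in> ?I. fst (snd \<iota>) \<le> j}" v x] hf that
      unfolding Cj[OF le(2)] by blast
    then have hC: "?h ` (C ! j) = ?g t ` (C ! j)" by (intro image_cong) auto
    have un: "B ! i \<union> ?g t ` (C ! j) = ?h ` (B ! i \<union> C ! j)" unfolding image_Un hB hC ..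
    have 1: "dim (B ! i \<union> ?g t ` (C ! j)) = dim (B ! i \<union> C ! j)"
      unfolding un by (rule dim_perturb_image[OF h(1,2)])
    moreover have "dim (span {a0 + scale (t * \<gamma>) y} \<union> (B ! i \<union> ?g t ` (C ! j))) = dim (A \<union> (B ! i \<union> C ! j))"
      if eq: "(\<Sum>x\<in>?Z. \<beta> x) = \<gamma>"
    proof -
      interpret g: Vector_Spaces.linear scale scale ?h by (rule lin_perturb[OF h(1)])
      have "?h ` A = span {a0 + scale (t * \<gamma>) y}"
        unfolding A a0_def[symmetric] using g.span_image[of "{a0}"] h(4) eq by simp
      then have "span {a0 + scale (t * \<gamma>) y} \<union> (B ! i \<union> ?g t ` (C ! j)) = ?h ` (A \<union> (B ! i \<union> C ! j))"
        unfolding un image_Un by simp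
      then show ?thesis using dim_perturb_image[OF h(1,2)] by simp
    qed
    ultimately show ?thesis using dim_insert_span[of "a0 + scale (t * \<gamma>) y" "B ! i \<union> ?g t ` (C ! j)"] by auto
  qed
  show ?thesis
  proof (rule that[of fA f])
    show "square_zero_map fA" "square_zero_map f" unfolding square_zero_map_def using f(1,3) fA(1,3) by auto
  next
    fix t :: 'a and i j assume t: "t \<noteq> 0" and ij: "i \<le> length b" "j \<le> length c"
    show "sum_dim (A, B, C) i j \<le> sum_dim (move_AC fA f (A, B, C) t) i j"
    proof (cases "i < i1 \<and> j < j1")
      case True
      then have lt: "i < i1" "j < j1" by auto
      show ?thesis
      proof (cases "\<exists>x\<in>X. fst x \<le> i \<and> snd x \<le> j")
        case True
        then obtain x where "x \<in> X" "fst x \<le> i" "snd x \<le> j" by blast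
        from hit[OF t lt this] show ?thesis unfolding mv[OF ij] by simp
      next
        case False
        then have "\<And>x. \<lbrakk>x \<in> X; fst x \<le> i; snd x \<le> j\<rbrakk> \<Longrightarrow> False" by blast
        from miss[of i j t, OF lt this] show ?thesis unfolding mv[OF ij] by simp
      qed
    next
      case False
      then show ?thesis using equal[OF ij] by simp
    qed
  next
    fix t :: 'a and x assume t: "t \<noteq> 0" and x: "x \<in> X"
    have lt: "fst x < i1" "snd x < j1" using X(3)[OF x] by auto
    then have le: "fst x \<le> length b" "snd x \<le> length c" using y1 by auto
    show "sum_dim (A, B, C) (fst x) (snd x) < sum_dim (move_AC fA f (A, B, C) t) (fst x) (snd x)"
      unfolding mv[OF le] using hit[OF t lt x order_refl order_refl] by simp
  next
    fix t :: 'a and i j x assume *: "t \<noteq> 0" "i < i1" "j < j1" "x \<in> X" "fst x \<le> i" "snd x \<le> j"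
    then have le: "i \<le> length b" "j \<le> length c" using y1 by auto
    show "dims_le_Suc (A, B, C) (move_AC fA f (A, B, C) t) i j"
      unfolding mv[OF le] using hit[OF *] by simp
  next
    fix t :: 'a and i j
    assume *: "i < i1" "j < j1" and none': "\<not> (\<exists>x\<in>X. fst x \<le> i \<and> snd x \<le> j)"
    from none' have none: "\<And>x. \<lbrakk>x \<in> X; fst x \<le> i; snd x \<le> j\<rbrakk> \<Longrightarrow> False" by blast
    have le: "i \<le> length b" "j \<le> length c" using y1 * by auto
    show "sum_dim (move_AC fA f (A, B, C) t) i j = sum_dim (A, B, C) i j \<and>
       total_dim (move_AC fA f (A, B, C) t) i j \<le> sum_dim (A, B, C) i j + 1 \<and>
       ((\<Sum>x\<in>{x \<in> X. snd x \<le> j}. \<beta> x) = \<gamma> \<longrightarrow>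
         total_dim (move_AC fA f (A, B, C) t) i j = total_dim (A, B, C) i j)"
      unfolding mv[OF le] using miss[of i j t, OF * none] by simp
  next
    fix t :: 'a and i j assume "i \<le> length b" "j \<le> length c" "\<not> (i < i1 \<and> j < j1)"
    then show "same_dims (A, B, C) (move_AC fA f (A, B, C) t) i j" by (rule equal)
  qed
qed

end

section \<open>Rank conditions imply degeneration\<close>

lemma rank_num_Suc: "rank_num M (Suc i) j = rank_num M i j + (\<Sum>l\<in>{1..j}. M (Suc i) l)"
  unfolding rank_num_def by simp

lemma mixed_diff_rank_num:
  assumes "0 < k" "0 < l"
  shows "mixed_diff (\<lambda>i j. int (rank_num M i j) - int (rank_num M' i j)) k l = int (M k l) - int (M' k l)"
proof -
  obtain k' l' where "k = Suc k'" "l = Suc l'" using assms gr0_implies_Suc by blast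
  then show ?thesis unfolding mixed_diff_def by (simp add: rank_num_Suc)
qed

lemma pos_le_set_down: "\<lbrakk>pos_le_set (Suc i, Suc j) \<Delta>; i' \<le> i; j' \<le> j\<rbrakk> \<Longrightarrow> pos_le_set (Suc i', Suc j') \<Delta>"
  unfolding pos_le_set_def pos_le_def fst_conv snd_conv by (meson Suc_le_mono le_trans)

lemma pos_on_mono: "\<lbrakk>pos_on R i0 j0 c d; c' \<le> c; d' \<le> d\<rbrakk> \<Longrightarrow> pos_on R i0 j0 c' d'"
  unfolding pos_on_def by (meson le_trans)

context flag_space
begin

definition deficit :: "nat list \<Rightarrow> nat list \<Rightarrow> 'b triple \<Rightarrow> nat" where
  "deficit b c T = (\<Sum>p\<in>{..length b} \<times> {..length c}. dim UNIV - sum_dim T (fst p) (snd p))"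

lemma deficit_less:
  assumes le: "\<And>i j. \<lbrakk>i \<le> length b; j \<le> length c\<rbrakk> \<Longrightarrow> sum_dim T i j \<le> sum_dim T' i j"
    and lt: "i0 \<le> length b" "j0 \<le> length c" "sum_dim T i0 j0 < sum_dim T' i0 j0"
  shows "deficit b c T' < deficit b c T"
  unfolding deficit_def
proof (rule sum_strict_mono_ex1)
  show "\<forall>p\<in>{..length b} \<times> {..length c}. dim UNIV - sum_dim T' (fst p) (snd p) \<le> dim UNIV - sum_dim T (fst p) (snd p)"
    using le by (auto intro: diff_le_mono2)
  have "sum_dim T' i0 j0 \<le> dim UNIV"
  proof -
    obtain A B C where "T' = (A, B, C)" by (cases T')
    then show ?thesis using dim_subset[OF subset_UNIV] by (simp only: sum_dim.simps)
  qed
  then have "dim UNIV - sum_dim T' i0 j0 < dim UNIV - sum_dim T i0 j0" using lt(3) by linarith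
  then show "\<exists>p\<in>{..length b} \<times> {..length c}. dim UNIV - sum_dim T' (fst p) (snd p) < dim UNIV - sum_dim T (fst p) (snd p)"
    using lt(1,2) by (intro bexI[of _ "(i0, j0)"]) auto
qed simp

text \<open>Add \<open>t\<close> times the vectors at \<open>\<Delta>' - \<Delta>\<close> to the
  generator of \<open>A\<close>. All its terms now lie below \<open>\<Delta>'\<close> and every
  position of \<open>\<Delta>'\<close> occurs, so \<open>normalise_decoration\<close> applies with
  \<open>\<Delta>'\<close>. The displacement is attached to one summand \<open>p0\<close> of the
  generator.\<close>

lemma same_matrix_degeneration:
  assumes a: "adapted b c M v B C" and d: "antichain_decoration (length b) (length c) M \<Delta>"
    and d': "antichain_decoration (length b) (length c) M \<Delta>'"
    and A: "A = span {\<Sum>(i, j)\<in>\<Delta>. v (i, j, 1)}"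
    and sub: "\<And>p. p \<in> \<Delta> \<Longrightarrow> pos_le_set p \<Delta>'"
  obtains f where "square_zero_map f" "\<And>t. t \<noteq> 0 \<Longrightarrow> move f (\<lambda>x. 0) (\<lambda>x. 0) (A, B, C) t \<in> triple_orbit b c M \<Delta>'"
proof -
  let ?I = "basis_index (length b) (length c) M"
  let ?e = "\<lambda>p. (fst p, snd p, 1::nat)"
  have I: "indexed_basis ?I v" using a unfolding adapted_def by blast
  have inj: "inj ?e" by (auto intro!: injI simp: prod_eq_iff)
  have mem: "?e p \<in> ?e ` Z \<longleftrightarrow> p \<in> Z" for p Z by (rule inj_image_mem_iff[OF inj])
  have fin: "finite \<Delta>" "finite \<Delta>'" using d d' unfolding antichain_decoration_def
    by (meson finite_SigmaI finite_atLeastAtMost finite_subset)+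
  obtain p0 where p0: "p0 \<in> \<Delta>" using d unfolding antichain_decoration_def by blast
  define a0 where "a0 = (\<Sum>(i, j)\<in>\<Delta>. v (i, j, 1))"
  define w where "w = (\<Sum>p\<in>\<Delta>' - \<Delta>. v (?e p))"
  obtain f where f: "lin f" "\<And>\<iota>. \<iota> \<in> ?I \<Longrightarrow> f (v \<iota>) = (if \<iota> = ?e p0 then w else 0)"
    by (rule indexed_linear_extend[OF I, of "\<lambda>\<iota>. if \<iota> = ?e p0 then w else 0"]) (rule that)
  interpret f: Vector_Spaces.linear scale scale f by fact
  have ev: "f (v (?e p)) = (if p = p0 then w else 0)" if "?e p \<in> ?I" for p
    using f(2)[OF that] by (auto simp: prod_eq_iff)
  have fw: "f w = 0" unfolding w_def f.sum
    using ev decoration_index[OF d'] p0 by (intro sum.neutral) auto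
  have fspan: "f x \<in> span {w}" for x
    by (rule range_in_span[OF f(1) I]) (auto simp: f(2) span_base span_zero)
  have sq: "square_zero_map f" unfolding square_zero_map_def
    using f(1) square_zero[OF f(1) fspan fw] by blast
  have "f a0 = (\<Sum>p\<in>\<Delta>. if p = p0 then w else 0)"
    unfolding a0_def f.sum case_prod_unfold using ev decoration_index[OF d] by (intro sum.cong) auto
  then have fa: "f a0 = w" using fin p0 by simp
  have "move f (\<lambda>x. 0) (\<lambda>x. 0) (A, B, C) t \<in> triple_orbit b c M \<Delta>'" if t: "t \<noteq> 0" for t
  proof -
    interpret g: Vector_Spaces.linear scale scale "\<lambda>v. v + scale t (f v)" by (rule lin_perturb[OF f(1)])
    have mv: "move f (\<lambda>x. 0) (\<lambda>x. 0) (A, B, C) t = (span {a0 + scale t w}, B, C)"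
      unfolding move_def A a0_def[symmetric] using g.span_image[of "{a0}"] fa
      by (simp add: map_idI)
    define x where "x \<iota> = (if \<iota> \<in> ?e ` \<Delta> then 1 else 0) + (if \<iota> \<in> ?e ` (\<Delta>' - \<Delta>) then t else 0)" for \<iota>
    have "w = (\<Sum>\<iota>\<in>?e ` (\<Delta>' - \<Delta>). v \<iota>)"
      unfolding w_def by (subst sum.reindex) (use inj inj_on_subset in auto)
    also have "\<dots> = (\<Sum>\<iota>\<in>?I. scale (if \<iota> \<in> ?e ` (\<Delta>' - \<Delta>) then 1 else 0) (v \<iota>))"
      using decoration_index[OF d'] finite_basis_index by (intro sum.mono_neutral_cong_left) auto
    finally have w: "w = (\<Sum>\<iota>\<in>?I. scale (if \<iota> \<in> ?e ` (\<Delta>' - \<Delta>) then 1 else 0) (v \<iota>))" .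
    have "scale t w = (\<Sum>\<iota>\<in>?I. scale t (scale (if \<iota> \<in> ?e ` (\<Delta>' - \<Delta>) then 1 else 0) (v \<iota>)))"
      by (subst w) (rule scale_sum_right)
    also have "\<dots> = (\<Sum>\<iota>\<in>?I. scale (if \<iota> \<in> ?e ` (\<Delta>' - \<Delta>) then t else 0) (v \<iota>))"
      by (intro sum.cong) auto
    finally have tw: "scale t w = (\<Sum>\<iota>\<in>?I. scale (if \<iota> \<in> ?e ` (\<Delta>' - \<Delta>) then t else 0) (v \<iota>))" .
    have xsum: "a0 + scale t w = (\<Sum>\<iota>\<in>?I. scale (x \<iota>) (v \<iota>))"
      unfolding tw a0_def decoration_sum[OF d] x_def by (simp only: scale_left_distrib sum.distrib)
    obtain v' where v': "adapted b c M v' B C" "a0 + scale t w = (\<Sum>(i, j)\<in>\<Delta>'. v' (i, j, 1))"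
    proof (rule normalise_decoration[OF a d' xsum])
      fix \<iota> assume "\<iota> \<in> ?I" "x \<iota> \<noteq> 0"
      then have "\<iota> \<in> ?e ` \<Delta> \<or> \<iota> \<in> ?e ` \<Delta>'" unfolding x_def by (auto split: if_splits)
      then obtain p where "p \<in> \<Delta> \<or> p \<in> \<Delta>'" "\<iota> = ?e p" by blast
      then show "pos_le_set (fst \<iota>, fst (snd \<iota>)) \<Delta>'"
        using sub[of p] unfolding pos_le_set_def pos_le_def by auto
    next
      fix i j assume ij: "(i, j) \<in> \<Delta>'"
      have "x (?e (i, j)) \<noteq> 0" unfolding x_def mem using t ij by auto
      then have "x (i, j, 1) \<noteq> 0" by simp
      moreover have "(i, j, 1) \<in> ?I" using decoration_index[OF d' ij] by simp
      ultimately show "\<exists>k. (i, j, k) \<in> ?I \<and> x (i, j, k) \<noteq> 0" by blast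
    qed (rule that)
    show ?thesis unfolding mv triple_orbit_iff v'(2) by (intro exI[of _ v'] conjI v'(1) refl)
  qed
  then show ?thesis using that sq by blast
qed

lemma adapted_cong:
  assumes "\<And>i j. \<lbrakk>i \<in> {1..length b}; j \<in> {1..length c}\<rbrakk> \<Longrightarrow> M i j = M' i j"
  shows "adapted b c M v B C \<longleftrightarrow> adapted b c M' v B C"
proof -
  have "basis_index (length b) (length c) M = basis_index (length b) (length c) M'"
    unfolding basis_index_def using assms by auto
  then show ?thesis unfolding adapted_def by simp
qed

lemma in_closure_of_member: "\<lbrakk>T \<in> W; T \<in> triple_flags b c\<rbrakk> \<Longrightarrow> T \<in> zariski_topology b c closure_of W"
  unfolding in_closure_of topspace_zariski_topology by blast

text \<open>The rank conditions rewritten with sums of subspaces, so that they make sense for a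
  triple flag whose orbit is not known.\<close>

definition rank_bounded ::
    "nat list \<Rightarrow> nat list \<Rightarrow> (nat \<Rightarrow> nat \<Rightarrow> nat) \<Rightarrow> (nat \<times> nat) set \<Rightarrow> 'b triple \<Rightarrow> bool" where
  "rank_bounded b c M \<Delta> T \<longleftrightarrow> (\<forall>i\<le>length b. \<forall>j\<le>length c.
     sum_dim T i j + rank_num M i j \<le> sum_list (take i b) + sum_list (take j c) \<and>
     total_dim T i j + rank_num_dec M \<Delta> i j \<le> sum_list (take i b) + sum_list (take j c) + 1)"

theorem rank_bounded_in_closure:
  assumes inf: "infinite (UNIV :: 'a set)" and tr': "transport_matrix b c M'"
    and d': "antichain_decoration (length b) (length c) M' \<Delta>'"
  shows "\<lbrakk>T \<in> triple_flags b c; rank_bounded b c M' \<Delta>' T\<rbrakk>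
    \<Longrightarrow> T \<in> zariski_topology b c closure_of triple_orbit b c M' \<Delta>'"
proof (induction "deficit b c T" arbitrary: T rule: less_induct)
  case less
  define q r where "q = length b" and "r = length c"
  let ?F = "triple_orbit b c M' \<Delta>'"
  obtain A B C where T: "T = (A, B, C)" by (cases T)
  obtain M v \<Delta> where tr: "transport_matrix b c M" and a: "adapted b c M v B C"
    and d: "antichain_decoration q r M \<Delta>" and A: "A = span {\<Sum>(i, j)\<in>\<Delta>. v (i, j, 1)}"
    using exists_decoration less.prems(1) unfolding T q_def r_def by metis
  note d' = d'[folded q_def r_def]
  define R where "R i j = int (rank_num M i j) - int (rank_num M' i j)" for i j
  define D where "D i j \<longleftrightarrow> pos_le_set (Suc i, Suc j) \<Delta>" for i j
  define D' where "D' i j \<longleftrightarrow> pos_le_set (Suc i, Suc j) \<Delta>'" for i j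
  have sumT: "sum_dim T i j + rank_num M i j = sum_list (take i b) + sum_list (take j c)" if "i \<le> q" "j \<le> r" for i j
    using adapted_dims(3)[OF a tr, of i j] that unfolding T q_def r_def by simp
  have totT: "total_dim T i j + rank_num M i j = sum_list (take i b) + sum_list (take j c) + (if D i j then 1 else 0)"
    if "i \<le> q" "j \<le> r" for i j
    using decoration_dim[OF a d[unfolded q_def r_def] tr _ _ A, of i j] that
    unfolding T q_def r_def rank_num_dec_def delta_num_def D_def by (simp split: if_splits)
  \<comment> \<open>The slack of a move: the sum may grow by \<open>R\<close>, the sum with
    \<open>A\<close> by \<open>R\<close> corrected by the two indicators.\<close>
  have bounded_iff: "sum_dim T' i j + rank_num M' i j \<le> sum_list (take i b) + sum_list (take j c) \<and>
     total_dim T' i j + rank_num_dec M' \<Delta>' i j \<le> sum_list (take i b) + sum_list (take j c) + 1 \<longleftrightarrow>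
     int (sum_dim T' i j) \<le> int (sum_dim T i j) + R i j \<and>
     int (total_dim T' i j) \<le> int (total_dim T i j) + R i j + (if D' i j then 1 else 0) - (if D i j then 1 else 0)"
    if "i \<le> q" "j \<le> r" for T' i j
    using sumT[OF that] totT[OF that] unfolding R_def rank_num_dec_def delta_num_def D'_def
    by (auto split: if_splits)
  have nn: "0 \<le> R i j \<and> 0 \<le> R i j + (if D' i j then 1 else 0) - (if D i j then 1 else 0)"
    if "i \<le> q" "j \<le> r" for i j
  proof -
    have "sum_dim T i j + rank_num M' i j \<le> sum_list (take i b) + sum_list (take j c) \<and>
     total_dim T i j + rank_num_dec M' \<Delta>' i j \<le> sum_list (take i b) + sum_list (take j c) + 1"
      using less.prems(2) that unfolding rank_bounded_def q_def r_def by blast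
    then show ?thesis unfolding bounded_iff[OF that] by linarith
  qed
  then have nonneg: "0 \<le> R i j" if "i \<le> q" "j \<le> r" for i j using that by blast
  have R_edge: "R q j = 0" "R 0 j = 0" if "j \<le> r" for j
    using that rank_num_full_col[OF tr] rank_num_full_col[OF tr'] unfolding R_def q_def r_def
    by (auto simp: rank_num_def)
  have R_edge': "R i r = 0" "R i 0 = 0" if "i \<le> q" for i
    using that rank_num_full_row[OF tr] rank_num_full_row[OF tr'] unfolding R_def q_def r_def
    by (auto simp: rank_num_def)
  have md: "mixed_diff R k l = int (M k l) - int (M' k l)" if "0 < k" "0 < l" for k l
    using mixed_diff_rank_num[OF that] unfolding R_def .
  have Dbd: "i < q \<and> j < r" if "D i j" for i j
    using that d unfolding D_def antichain_decoration_def pos_le_set_def pos_le_def by fastforce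
  have posD: "0 < R i j" if "D i j" "\<not> D' i j" for i j
    using nn[of i j] Dbd[OF that(1)] that by (simp split: if_splits)
  have Ddown: "D i' j'" if "D i j" "i' \<le> i" "j' \<le> j" for i j i' j'
    using that pos_le_set_down unfolding D_def by blast
  have D'down: "D' i' j'" if "D' i j" "i' \<le> i" "j' \<le> j" for i j i' j'
    using that pos_le_set_down unfolding D'_def by blast
  \<comment> \<open>The induction hypothesis in the form used: a move within the slack that enlarges
    one sum and shrinks none.\<close>
  have step: "T \<in> zariski_topology b c closure_of ?F"
    if f: "square_zero_map fA" "square_zero_map fB" "square_zero_map fC"
      and mono: "\<And>t i j. \<lbrakk>t \<noteq> 0; i \<le> q; j \<le> r\<rbrakk> \<Longrightarrow> sum_dim T i j \<le> sum_dim (move fA fB fC T t) i j"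
      and strict: "i0 \<le> q" "j0 \<le> r" "\<And>t. t \<noteq> 0 \<Longrightarrow> sum_dim T i0 j0 < sum_dim (move fA fB fC T t) i0 j0"
      and bound: "\<And>t i j. \<lbrakk>t \<noteq> 0; i \<le> q; j \<le> r\<rbrakk> \<Longrightarrow>
        int (sum_dim (move fA fB fC T t) i j) \<le> int (sum_dim T i j) + R i j \<and>
        int (total_dim (move fA fB fC T t) i j) \<le> int (total_dim T i j) + R i j + (if D' i j then 1 else 0) - (if D i j then 1 else 0)"
    for fA fB fC i0 j0
  proof (rule in_closure_if_moves[OF inf less.prems(1) f])
    fix t :: 'a assume t: "t \<noteq> 0"
    show "move fA fB fC T t \<in> zariski_topology b c closure_of ?F"
    proof (rule less.hyps)
      show "deficit b c (move fA fB fC T t) < deficit b c T"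
        by (rule deficit_less[of b c T _ i0 j0]) (use mono[OF t] strict(1,2) strict(3)[OF t] in \<open>auto simp: q_def r_def\<close>)
      show "move fA fB fC T t \<in> triple_flags b c" by (rule move_triple_flags[OF f less.prems(1)])
      show "rank_bounded b c M' \<Delta>' (move fA fB fC T t)"
        unfolding rank_bounded_def q_def[symmetric] r_def[symmetric] using bounded_iff bound[OF t] by blast
    qed
  qed
  have \<Delta>bd: "0 < k \<and> k \<le> q \<and> 0 < l \<and> l \<le> r \<and> 0 < M k l" if "(k, l) \<in> \<Delta>" for k l
    using d that unfolding antichain_decoration_def by fastforce
  have \<Delta>'bd: "0 < k \<and> k \<le> q \<and> 0 < l \<and> l \<le> r \<and> 0 < M' k l" if "(k, l) \<in> \<Delta>'" for k l
    using d' that unfolding antichain_decoration_def by fastforce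
  have anti: "p = p'" if "p \<in> \<Delta>" "p' \<in> \<Delta>" "pos_le p p'" for p p'
    using d that unfolding antichain_decoration_def by blast
  have D\<Delta>: "D (k - 1) (l - 1)" if "(k, l) \<in> \<Delta>" for k l
    using that \<Delta>bd[OF that] unfolding D_def pos_le_set_def pos_le_def by (intro bexI[of _ "(k, l)"]) auto
  \<comment> \<open>Where \<open>B_i + C_j\<close> gains \<open>y\<close>, both dimensions grow by
    at most one and \<open>R\<close> is at least one. Slack is missing only at cells of
    \<open>D\<close> outside \<open>D'\<close> with \<open>R = 1\<close>, which \<open>tight\<close>
    handles.\<close>
  have B_case: "T \<in> zariski_topology b c closure_of ?F"
    if x: "i0 \<le> q" "j0 \<le> r" "(i0, j0, k0) \<in> basis_index (length b) (length c) M" "(i0, j0) \<in> \<Delta> \<Longrightarrow> k0 \<noteq> 1"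
      and Y: "Y \<noteq> {}" "\<And>k l. (k, l) \<in> Y \<Longrightarrow>
        i0 < k \<and> k \<le> q \<and> j0 < l \<and> l \<le> r \<and> 0 < M k l \<and> pos_on R i0 j0 (k - 1) (l - 1)"
      and tight: "\<And>i j. \<lbrakk>i0 \<le> i; j0 \<le> j; pos_on R i0 j0 i j; D i j; \<not> D' i j; R i j = 1\<rbrakk>
        \<Longrightarrow> Y \<subseteq> \<Delta> \<and> \<not> pos_le_set (i + 1, j + 1) (\<Delta> - Y)"
    for i0 j0 k0 Y
  proof -
    have Yb: "i0 < k \<and> k \<le> length b \<and> j0 < l \<and> l \<le> length c \<and> 0 < M k l" if "(k, l) \<in> Y" for k l
      using Y(2)[OF that] unfolding q_def r_def by blast
    obtain f where f: "square_zero_map f"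
      and m1: "\<And>t i j. \<lbrakk>t \<noteq> 0; i \<le> length b; j \<le> length c\<rbrakk> \<Longrightarrow>
         sum_dim (A, B, C) i j \<le> sum_dim (move_B f (A, B, C) t) i j"
      and m2: "\<And>t. t \<noteq> 0 \<Longrightarrow> sum_dim (A, B, C) i0 j0 < sum_dim (move_B f (A, B, C) t) i0 j0"
      and m3: "\<And>t i j. \<lbrakk>t \<noteq> 0; i \<le> length b; j \<le> length c; i0 \<le> i; j0 \<le> j; \<exists>(k, l)\<in>Y. i < k \<and> j < l\<rbrakk> \<Longrightarrow>
         dims_le_Suc (A, B, C) (move_B f (A, B, C) t) i j"
      and m4: "\<And>t i j. \<lbrakk>t \<noteq> 0; i \<le> length b; j \<le> length c; i0 \<le> i; j0 \<le> j; Y \<subseteq> \<Delta>; \<not> pos_le_set (i + 1, j + 1) (\<Delta> - Y)\<rbrakk> \<Longrightarrow>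
         total_dim (move_B f (A, B, C) t) i j \<le> total_dim (A, B, C) i j"
      and m5: "\<And>t i j. \<lbrakk>t \<noteq> 0; i \<le> length b; j \<le> length c; \<not> (i0 \<le> i \<and> j0 \<le> j \<and> (\<exists>(k, l)\<in>Y. i < k \<and> j < l))\<rbrakk> \<Longrightarrow>
         same_dims (A, B, C) (move_B f (A, B, C) t) i j"
      by (rule move_B_step[OF a d[unfolded q_def r_def] A x(3,4) Y(1) Yb]) (assumption | rule that)+
    show ?thesis
    proof (rule step[OF square_zero_map_zero f square_zero_map_zero _ x(1,2)])
      fix t :: 'a and i j assume t: "t \<noteq> 0" and ij: "i \<le> q" "j \<le> r"
      have ij': "i \<le> length b" "j \<le> length c" using ij unfolding q_def r_def .
      show "sum_dim T i j \<le> sum_dim (move_B f T t) i j" unfolding T by (rule m1[OF t ij'])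
      show "int (sum_dim (move_B f T t) i j) \<le> int (sum_dim T i j) + R i j \<and>
        int (total_dim (move_B f T t) i j) \<le> int (total_dim T i j) + R i j + (if D' i j then 1 else 0) - (if D i j then 1 else 0)"
      proof (cases "i0 \<le> i \<and> j0 \<le> j \<and> (\<exists>(k, l)\<in>Y. i < k \<and> j < l)")
        case False
        then show ?thesis using m5[OF t ij' False] nn[OF ij] unfolding T by linarith
      next
        case True
        then obtain k l where kl: "(k, l) \<in> Y" "i < k" "j < l" and le: "i0 \<le> i" "j0 \<le> j" by blast
        have "i \<le> k - 1" "j \<le> l - 1" using kl by auto
        then have pos: "pos_on R i0 j0 i j" using Y(2)[OF kl(1)] pos_on_mono by blast
        then have R1: "1 \<le> R i j" using le unfolding pos_on_def by force
        have up: "sum_dim (move_B f (A, B, C) t) i j \<le> sum_dim (A, B, C) i j + 1"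
          "total_dim (move_B f (A, B, C) t) i j \<le> total_dim (A, B, C) i j + 1"
          using m3[OF t ij' le] True by auto
        show ?thesis
        proof (cases "D i j \<and> \<not> D' i j \<and> R i j = 1")
          case True
          then have "total_dim (move_B f (A, B, C) t) i j \<le> total_dim (A, B, C) i j"
            using tight[OF le pos] m4[OF t ij' le] by blast
          then show ?thesis using up R1 nn[OF ij] unfolding T by linarith
        next
          case False
          then show ?thesis using up R1 unfolding T by auto
        qed
      qed
    next
      fix t :: 'a assume "t \<noteq> 0"
      then show "sum_dim T i0 j0 < sum_dim (move_B f T t) i0 j0" unfolding T by (rule m2)
    qed
  qed
  show ?case
  proof (cases "\<exists>c d. D c d \<and> \<not> D' c d")
    case True
    \<comment> \<open>Positions of \<open>M\<close> from which a cell of \<open>D\<close> outside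
      \<open>D'\<close> can be reached. The element \<open>x\<close> of \<open>Q\<close> with
      maximal coordinate sum has none of \<open>Q\<close> strictly beyond it in both coordinates, as
      \<open>reachable_above\<close> requires.\<close>
    define Q where "Q = {(k, l). 0 < k \<and> k \<le> q \<and> 0 < l \<and> l \<le> r \<and> 0 < M k l \<and>
      (\<exists>c d. D c d \<and> \<not> D' c d \<and> k \<le> c \<and> l \<le> d \<and> pos_on R k l c d)}"
    have "finite Q" by (rule finite_subset[of _ "{..q} \<times> {..r}"]) (auto simp: Q_def)
    have "Q \<noteq> {}"
    proof -
      obtain cc dd where cd: "D cc dd" "\<not> D' cc dd" using True by blast
      obtain k l where "0 < k" "k \<le> cc" "0 < l" "l \<le> dd" "pos_on R k l cc dd" "0 < mixed_diff R k l"
      proof (rule backward_exists[of cc dd R])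
        show "0 < R cc dd" by (rule posD[OF cd])
      qed (use nonneg Dbd[OF cd(1)] R_edge R_edge' in auto)
      then have "(k, l) \<in> Q" using md[of k l] cd Dbd[OF cd(1)] unfolding Q_def by auto
      then show ?thesis by blast
    qed
    then have "Max ((\<lambda>p. fst p + snd p) ` Q) \<in> (\<lambda>p. fst p + snd p) ` Q"
      using \<open>finite Q\<close> by (intro Max_in) auto
    then obtain x where x: "x \<in> Q" "Max ((\<lambda>p. fst p + snd p) ` Q) = fst x + snd x" by blast
    have xmax: "fst p + snd p \<le> fst x + snd x" if "p \<in> Q" for p
      unfolding x(2)[symmetric] using that \<open>finite Q\<close> by (intro Max_ge) auto
    obtain i0 j0 where xij: "x = (i0, j0)" by (cases x)
    obtain cc dd where i0: "0 < i0" "i0 \<le> q" "0 < j0" "j0 \<le> r" "0 < M i0 j0"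
      and cd: "D cc dd" "\<not> D' cc dd" "i0 \<le> cc" "j0 \<le> dd" "pos_on R i0 j0 cc dd"
      using x(1) unfolding xij Q_def by auto
    interpret staircase R q r "\<lambda>k l. 0 < M k l" D D'
    proof
      show "0 \<le> R i j" if "i \<le> q" "j \<le> r" for i j by (rule nonneg[OF that])
      show "0 < M k l" if "0 < k" "k \<le> q" "0 < l" "l \<le> r" "0 < mixed_diff R k l" for k l
        using md that by auto
      show "i < q \<and> j < r" if "D i j" for i j by (rule Dbd[OF that])
      show "D i' j'" if "D i j" "i' \<le> i" "j' \<le> j" for i j i' j' by (rule Ddown[OF that])
      show "D' i' j'" if "D' i j" "i' \<le> i" "j' \<le> j" for i j i' j' by (rule D'down[OF that])
      show "0 < R i j" if "D i j" "\<not> D' i j" for i j by (rule posD[OF that])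
    qed
    have reach: "pos_on R i0 j0 (u - 1) (w - 1)"
      if cell: "D i j" "\<not> D' i j" "i0 \<le> i" "j0 \<le> j" "pos_on R i0 j0 i j" "R i j = 1"
        and u: "(u, w) \<in> \<Delta>" "i < u" "j < w" for i j u w
    proof (rule reachable_above[OF cell(5,3,4,2,6)])
      show False if "i0 < k" "j0 < l" "0 < M k l" "D c' d'" "\<not> D' c' d'" "k \<le> c'" "l \<le> d'" "pos_on R k l c' d'"
        for k l c' d'
      proof -
        have "(k, l) \<in> Q" using that Dbd[OF that(4)] unfolding Q_def by auto
        from xmax[OF this] show False using that unfolding xij by simp
      qed
      show "D (u - 1) (w - 1)" by (rule D\<Delta>[OF u(1)])
      show "i \<le> u - 1" "j \<le> w - 1" using u by auto
    qed
    \<comment> \<open>\<open>x\<close> is below a cell of \<open>D\<close>, hence strictly below an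
      element of the antichain \<open>\<Delta>\<close>.\<close>
    have xnot: "(i0, j0) \<notin> \<Delta>"
    proof
      assume "(i0, j0) \<in> \<Delta>"
      obtain p where "p \<in> \<Delta>" "pos_le (Suc cc, Suc dd) p" using cd(1) unfolding D_def pos_le_set_def by blast
      then show False using anti[OF \<open>(i0, j0) \<in> \<Delta>\<close>, of p] cd unfolding pos_le_def by auto
    qed
    have \<iota>0: "(i0, j0, 1) \<in> basis_index (length b) (length c) M"
      using i0 unfolding basis_index_def q_def r_def by auto
    have R0: "0 < R i0 j0" using cd unfolding pos_on_def by auto
    \<comment> \<open>All of \<open>\<Delta>\<close> reachable from \<open>x\<close>. By
      \<open>reach\<close>, every element of \<open>\<Delta>\<close> above a cell without slack
      belongs to \<open>Y\<close>.\<close>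
    define Y where "Y = {(k, l) \<in> \<Delta>. i0 < k \<and> j0 < l \<and> pos_on R i0 j0 (k - 1) (l - 1)}"
    have full: "(u, w) \<in> Y" if "D i j" "\<not> D' i j" "i0 \<le> i" "j0 \<le> j" "pos_on R i0 j0 i j" "R i j = 1"
      and u: "(u, w) \<in> \<Delta>" "i < u" "j < w" for i j u w
      using reach[OF that] u that(3,4) unfolding Y_def by auto
    show ?thesis
    proof (cases "Y = {}")
      case False
      show ?thesis
      proof (rule B_case[OF i0(2,4) \<iota>0 _ False])
        show "i0 < k \<and> k \<le> q \<and> j0 < l \<and> l \<le> r \<and> 0 < M k l \<and> pos_on R i0 j0 (k - 1) (l - 1)" if "(k, l) \<in> Y" for k l
          using that \<Delta>bd[of k l] unfolding Y_def by auto
        fix i j assume cell: "i0 \<le> i" "j0 \<le> j" "pos_on R i0 j0 i j" "D i j" "\<not> D' i j" "R i j = 1"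
        have "\<not> pos_le_set (i + 1, j + 1) (\<Delta> - Y)"
          using full[OF cell(4,5,1,2,3,6)] unfolding pos_le_set_def pos_le_def by auto
        then show "Y \<subseteq> \<Delta> \<and> \<not> pos_le_set (i + 1, j + 1) (\<Delta> - Y)" unfolding Y_def by blast
      qed (use xnot in blast)
    next
      case True
      \<comment> \<open>With \<open>Y\<close> empty there is no reachable cell without slack, so a
        single target vector is enough.\<close>
      obtain e g where eg: "i0 < e" "e \<le> q" "j0 < g" "g \<le> r" "pos_on R i0 j0 (e - 1) (g - 1)" "0 < mixed_diff R e g"
        by (rule forward_exists[of q r R i0 j0]) (use nonneg R_edge R_edge' R0 i0 in auto)
      show ?thesis
      proof (rule B_case[OF i0(2,4) \<iota>0, of "{(e, g)}"])
        show "i0 < k \<and> k \<le> q \<and> j0 < l \<and> l \<le> r \<and> 0 < M k l \<and> pos_on R i0 j0 (k - 1) (l - 1)"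
          if "(k, l) \<in> {(e, g)}" for k l
          using that eg md[of e g] by auto
        fix i j assume cell: "i0 \<le> i" "j0 \<le> j" "pos_on R i0 j0 i j" "D i j" "\<not> D' i j" "R i j = 1"
        obtain u w where "(u, w) \<in> \<Delta>" "i < u" "j < w"
          using cell(4) unfolding D_def pos_le_set_def pos_le_def by auto
        from full[OF cell(4,5,1,2,3,6) this] True
        show "{(e, g)} \<subseteq> \<Delta> \<and> \<not> pos_le_set (i + 1, j + 1) (\<Delta> - {(e, g)})" by blast
      qed (use xnot in auto)
    qed
  next
    case False
    then have DD': "D' i j" if "D i j" for i j using that by blast
    show ?thesis
    proof (cases "\<exists>i j. i \<le> q \<and> j \<le> r \<and> 0 < R i j")
      case False
      then have Rz: "R i j = 0" if "i \<le> q" "j \<le> r" for i j using nonneg[OF that] that by force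
      have MM': "M k l = M' k l" if kl: "k \<in> {1..q}" "l \<in> {1..r}" for k l
      proof -
        have "mixed_diff R k l = 0" unfolding mixed_diff_def using Rz kl by auto
        then show ?thesis using md[of k l] kl by simp
      qed
      have a': "adapted b c M' v B C" using a adapted_cong[of b c M M' v B C] MM' unfolding q_def r_def by blast
      have d2: "antichain_decoration q r M' \<Delta>"
      proof -
        have "0 < M' k l" if "(k, l) \<in> \<Delta>" for k l using \<Delta>bd[OF that] MM'[of k l] by auto
        then show ?thesis using d unfolding antichain_decoration_def by blast
      qed
      have sub: "pos_le_set p \<Delta>'" if "p \<in> \<Delta>" for p
      proof -
        obtain k l where p: "p = (k, l)" by (cases p)
        have "D' (k - 1) (l - 1)" using DD' D\<Delta> that unfolding p by blast
        then show ?thesis using \<Delta>bd[of k l] that unfolding p D'_def by simp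
      qed
      obtain f where f: "square_zero_map f"
        "\<And>t. t \<noteq> 0 \<Longrightarrow> move f (\<lambda>x. 0) (\<lambda>x. 0) (A, B, C) t \<in> triple_orbit b c M' \<Delta>'"
        by (rule same_matrix_degeneration[OF a' d2[unfolded q_def r_def] d'[unfolded q_def r_def] A sub])
          (assumption | rule that)+
      show ?thesis
      proof (rule in_closure_if_moves[OF inf less.prems(1) f(1) square_zero_map_zero square_zero_map_zero])
        fix t :: 'a assume "t \<noteq> 0"
        then show "move f (\<lambda>x. 0) (\<lambda>x. 0) T t \<in> zariski_topology b c closure_of ?F"
          using f(2) move_triple_flags[OF f(1) square_zero_map_zero square_zero_map_zero less.prems(1)]
          unfolding T by (intro in_closure_of_member) auto
      qed
    next
      case True
      then obtain ci cj where cell: "ci \<le> q" "cj \<le> r" "0 < R ci cj" by blast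
      show ?thesis
      proof (cases "\<exists>k l. 0 < k \<and> k \<le> q \<and> 0 < l \<and> l \<le> r \<and> 0 < M k l \<and> 0 < R k l \<and> \<not> ((k, l) \<in> \<Delta> \<and> M k l = 1)")
        case True
        then obtain i0 j0 where i0: "0 < i0" "i0 \<le> q" "0 < j0" "j0 \<le> r" "0 < M i0 j0"
          and R0: "0 < R i0 j0" and free: "\<not> ((i0, j0) \<in> \<Delta> \<and> M i0 j0 = 1)" by blast
        \<comment> \<open>At a position of \<open>\<Delta>\<close> the vector with
          \<open>k = 1\<close> is a summand of the generator of \<open>A\<close>; there the entry of
          \<open>M\<close> is at least \<open>2\<close>, so the second vector is available.\<close>
        define k0 :: nat where "k0 = (if (i0, j0) \<in> \<Delta> then 2 else 1)"
        have \<iota>0: "(i0, j0, k0) \<in> basis_index (length b) (length c) M"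
          using i0 free unfolding basis_index_def q_def r_def k0_def by auto
        obtain e g where eg: "i0 < e" "e \<le> q" "j0 < g" "g \<le> r" "pos_on R i0 j0 (e - 1) (g - 1)" "0 < mixed_diff R e g"
          by (rule forward_exists[of q r R i0 j0]) (use nonneg R_edge R_edge' R0 i0 in auto)
        show ?thesis
        proof (rule B_case[OF i0(2,4) \<iota>0, of "{(e, g)}"])
          show "k0 \<noteq> 1" if "(i0, j0) \<in> \<Delta>" using that unfolding k0_def by simp
          show "i0 < k \<and> k \<le> q \<and> j0 < l \<and> l \<le> r \<and> 0 < M k l \<and> pos_on R i0 j0 (k - 1) (l - 1)"
            if "(k, l) \<in> {(e, g)}" for k l
            using that eg md[of e g] by auto
        qed (use DD' in auto)
      next
        case False
        then have supp: "(k, l) \<in> \<Delta> \<and> M k l = 1"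
          if "0 < k" "k \<le> q" "0 < l" "l \<le> r" "0 < M k l" "0 < R k l" for k l using that by blast
        \<comment> \<open>A positive cell yields an entry with \<open>M > M'\<close>, which is
          forced into \<open>\<Delta>\<close>. Together with the target \<open>(i1, j1)\<close>
          chosen from it, it makes \<open>X\<close> nonempty.\<close>
        obtain k l where kl: "0 < k" "k \<le> ci" "0 < l" "l \<le> cj" "pos_on R k l ci cj" "0 < mixed_diff R k l"
          by (rule backward_exists[of ci cj R]) (use nonneg cell R_edge R_edge' in auto)
        have Rkl: "0 < R k l" using kl unfolding pos_on_def by auto
        have kl\<Delta>: "(k, l) \<in> \<Delta>" using supp[of k l] md[of k l] kl cell Rkl by auto
        obtain i1 j1 where tgt: "k < i1" "i1 \<le> q" "l < j1" "j1 \<le> r" "pos_on R k l (i1 - 1) (j1 - 1)" "0 < mixed_diff R i1 j1"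
          by (rule forward_exists[of q r R k l]) (use nonneg R_edge R_edge' Rkl kl cell in auto)
        have My: "0 < M i1 j1" using md[of i1 j1] tgt by auto
        interpret blocked_cells R q r i1 j1 M M' \<Delta> D'
        proof unfold_locales
          fix k l k' l' assume *: "(k, l) \<in> \<Delta>" "(k', l') \<in> \<Delta>" "(k, l) \<noteq> (k', l')"
          then show "k < k' \<and> l' < l \<or> k' < k \<and> l < l'"
            using anti[OF *(1,2)] anti[OF *(2,1)] unfolding pos_le_def fst_conv snd_conv
            by (metis linorder_le_cases not_le)
        next
          fix k l assume *: "(k, l) \<in> \<Delta>"
          then have "D' (k - 1) (l - 1)" using DD' D\<Delta> by blast
          then obtain k' l' where p: "(k', l') \<in> \<Delta>'" "k \<le> k'" "l \<le> l'"
            using \<Delta>bd[OF *] unfolding D'_def pos_le_set_def pos_le_def by auto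
          have "D' i j" if "i < k'" "j < l'" for i j
            using p(1) that unfolding D'_def pos_le_set_def pos_le_def by (intro bexI[of _ "(k', l')"]) auto
          then show "\<exists>k' l'. k \<le> k' \<and> k' \<le> q \<and> l \<le> l' \<and> l' \<le> r \<and> 0 < M' k' l' \<and> (\<forall>i j. i < k' \<longrightarrow> j < l' \<longrightarrow> D' i j)"
            using \<Delta>'bd[OF p(1)] p by blast
        next
          show "0 \<le> R i j" if "i \<le> q" "j \<le> r" for i j by (rule nonneg[OF that])
          show "R 0 j = 0" if "j \<le> r" for j by (rule R_edge(2)[OF that])
          show "R i 0 = 0" if "i \<le> q" for i by (rule R_edge'(2)[OF that])
          show "i1 \<le> q" "j1 \<le> r" using tgt by auto
          show "D' i' j'" if "D' i j" "i' \<le> i" "j' \<le> j" for i j i' j' by (rule D'down[OF that])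
          show "0 < k \<and> k \<le> q \<and> 0 < l \<and> l \<le> r" if "(k, l) \<in> \<Delta>" for k l using \<Delta>bd[OF that] by blast
          show "mixed_diff R k l = int (M k l) - int (M' k l)" if "0 < k" "k \<le> q" "0 < l" "l \<le> r" for k l
            by (rule md[OF that(1,3)])
          show "(k, l) \<in> \<Delta> \<and> M k l = 1"
            if "0 < k" "k \<le> q" "0 < l" "l \<le> r" "0 < M k l" "0 < R k l" for k l by (rule supp[OF that])
        qed
        obtain \<beta> :: "nat \<times> nat \<Rightarrow> 'a" and \<gamma> :: 'a where \<beta>: "\<And>x. x \<in> X \<Longrightarrow> \<beta> x \<noteq> 0"
          and gap: "\<And>i j. bad i j \<Longrightarrow> (\<Sum>x\<in>{x \<in> X. snd x \<le> j}. \<beta> x) = \<gamma>"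
          using gap_coefficients[OF inf] by metis
        have klX: "(k, l) \<in> X" using kl\<Delta> tgt unfolding X_def by auto
        have X\<Delta>: "X \<subseteq> \<Delta>" and Xlt: "\<And>x. x \<in> X \<Longrightarrow> fst x < i1 \<and> snd x < j1" unfolding X_def by auto
        have y': "i1 \<le> length b" "j1 \<le> length c" using tgt unfolding q_def r_def by auto
        obtain fA f where f: "square_zero_map fA" "square_zero_map f"
          and m1: "\<And>t i j. \<lbrakk>t \<noteq> 0; i \<le> length b; j \<le> length c\<rbrakk> \<Longrightarrow>
             sum_dim (A, B, C) i j \<le> sum_dim (move_AC fA f (A, B, C) t) i j"
          and m2: "\<And>t x. \<lbrakk>t \<noteq> 0; x \<in> X\<rbrakk> \<Longrightarrow>
             sum_dim (A, B, C) (fst x) (snd x) < sum_dim (move_AC fA f (A, B, C) t) (fst x) (snd x)"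
          and m3: "\<And>t i j x. \<lbrakk>t \<noteq> 0; i < i1; j < j1; x \<in> X; fst x \<le> i; snd x \<le> j\<rbrakk> \<Longrightarrow>
             dims_le_Suc (A, B, C) (move_AC fA f (A, B, C) t) i j"
          and m4: "\<And>t i j. \<lbrakk>t \<noteq> 0; i < i1; j < j1; \<not> (\<exists>x\<in>X. fst x \<le> i \<and> snd x \<le> j)\<rbrakk> \<Longrightarrow>
             sum_dim (move_AC fA f (A, B, C) t) i j = sum_dim (A, B, C) i j \<and>
             total_dim (move_AC fA f (A, B, C) t) i j \<le> sum_dim (A, B, C) i j + 1 \<and>
             ((\<Sum>x\<in>{x \<in> X. snd x \<le> j}. \<beta> x) = \<gamma> \<longrightarrow>
               total_dim (move_AC fA f (A, B, C) t) i j = total_dim (A, B, C) i j)"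
          and m5: "\<And>t i j. \<lbrakk>t \<noteq> 0; i \<le> length b; j \<le> length c; \<not> (i < i1 \<and> j < j1)\<rbrakk> \<Longrightarrow>
             same_dims (A, B, C) (move_AC fA f (A, B, C) t) i j"
        proof (rule move_C_step[where \<gamma> = \<gamma>, OF a d[unfolded q_def r_def] A y' My _ X\<Delta> Xlt \<beta>])
          show "X \<noteq> {}" using klX by blast
        qed (assumption | erule (1) that)+
        have kle: "k \<le> q" "l \<le> r" using kl cell by auto
        show ?thesis
        proof (rule step[OF f(1) square_zero_map_zero f(2) _ kle])
          fix t :: 'a and i j assume t: "t \<noteq> 0" and ij: "i \<le> q" "j \<le> r"
          have ij': "i \<le> length b" "j \<le> length c" using ij unfolding q_def r_def .
          show "sum_dim T i j \<le> sum_dim (move_AC fA f T t) i j" unfolding T by (rule m1[OF t ij'])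
          show "int (sum_dim (move_AC fA f T t) i j) \<le> int (sum_dim T i j) + R i j \<and>
            int (total_dim (move_AC fA f T t) i j) \<le> int (total_dim T i j) + R i j + (if D' i j then 1 else 0) - (if D i j then 1 else 0)"
          proof (cases "i < i1 \<and> j < j1")
            case False
            then show ?thesis using m5[OF t ij' False] nn[OF ij] unfolding T by linarith
          next
            case True
            then have lt: "i < i1" "j < j1" by auto
            show ?thesis
            proof (cases "\<exists>x\<in>X. fst x \<le> i \<and> snd x \<le> j")
              case True
              then obtain x where x: "x \<in> X" "fst x \<le> i" "snd x \<le> j" by blast
              have "0 < R i j" using X_pos[of "fst x" "snd x" i j] x lt by simp
              then show ?thesis using m3[OF t lt x] DD'[of i j] unfolding T by auto
            next
              case False
              \<comment> \<open>At a bad cell the choice of coefficients keeps both dimensions. At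
                any other cell \<open>R > 0\<close> or \<open>D'\<close> leaves room for the sum
                with \<open>A\<close> to exceed \<open>B_i + C_j\<close> by one.\<close>
              note m = m4[OF t lt False]
              show ?thesis
              proof (cases "bad i j")
                case True
                then show ?thesis using m gap[OF True] nn[OF ij] unfolding T by auto
              next
                case False
                then have "0 < R i j \<or> D' i j" using lt nonneg[OF ij] unfolding bad_def by force
                moreover have "int (total_dim T i j) = int (sum_dim T i j) + (if D i j then 1 else 0)"
                  using sumT[OF ij] totT[OF ij] by (simp split: if_splits)
                ultimately show ?thesis using m nonneg[OF ij] unfolding T by (auto split: if_splits)
              qed
            qed
          qed
        next
          fix t :: 'a assume "t \<noteq> 0"
          then show "sum_dim T k l < sum_dim (move_AC fA f T t) k l" using m2[OF _ klX] unfolding T by simp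
        qed
      qed
    qed
  qed
qed


section \<open>The two orders agree\<close>

text \<open>Any bijection from the index set to \<open>Basis\<close> works, as the cardinalities
  agree. It is needed because an inclusion between orbit and closure says nothing about an empty
  orbit.\<close>

lemma exists_orbit_element:
  assumes tr: "transport_matrix b c M" and n: "sum_list b = dim UNIV"
  obtains A B C where "(A, B, C) \<in> triple_orbit b c M \<Delta>"
proof -
  let ?I = "basis_index (length b) (length c) M"
  have "{\<iota> \<in> ?I. fst \<iota> \<le> length b \<and> fst (snd \<iota>) \<le> length c} = ?I" unfolding basis_index_def by auto
  then have "card ?I = rank_num M (length b) (length c)"
    using card_basis_index_rank[of "length b" "length b" "length c" "length c" M] by simp
  also have "\<dots> = dim UNIV" using rank_num_full_row[OF tr order_refl] n by simp
  finally have c: "card ?I = dim UNIV" .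
  then have "card ?I = card Basis" using dim_UNIV unfolding dimension_def by simp
  then obtain v where v: "bij_betw v ?I Basis"
    using finite_same_card_bij[OF finite_basis_index finite_Basis] by blast
  then have "v ` ?I = Basis" by (rule bij_betw_imp_surj_on)
  then have "indexed_basis ?I v"
    using c span_Basis by (intro indexed_basis_if_spanning finite_basis_index) auto
  then have "adapted b c M v
      (map (\<lambda>i. span (v ` {\<iota> \<in> ?I. fst \<iota> \<le> i})) [0..<length b + 1])
      (map (\<lambda>j. span (v ` {\<iota> \<in> ?I. fst (snd \<iota>) \<le> j})) [0..<length c + 1])"
    unfolding adapted_def by (auto simp del: upt_Suc simp: nth_append)
  then show ?thesis using that unfolding triple_orbit_iff by blast
qed

text \<open>Sums are used in the proof and intersections in the theorem; the dimension formula
  converts one into the other, applied to \<open>B_i\<close>, \<open>C_j\<close> and then to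
  \<open>A\<close> and their sum.\<close>

lemma orbit_dims:
  assumes T: "(A, B, C) \<in> triple_orbit b c M \<Delta>" and d: "decorated_matrix b c M \<Delta>"
  shows "(A, B, C) \<in> triple_flags b c"
    and "\<lbrakk>i \<le> length b; j \<le> length c\<rbrakk> \<Longrightarrow>
      dim (B ! i \<union> C ! j) + rank_num M i j = sum_list (take i b) + sum_list (take j c)"
    and "\<lbrakk>i \<le> length b; j \<le> length c\<rbrakk> \<Longrightarrow>
      dim (A \<union> (B ! i \<union> C ! j)) + rank_num_dec M \<Delta> i j = sum_list (take i b) + sum_list (take j c) + 1"
    and "\<lbrakk>i \<le> length b; j \<le> length c\<rbrakk> \<Longrightarrow> dim (B ! i \<inter> C ! j) = rank_num M i j"
    and "\<lbrakk>i \<le> length b; j \<le> length c\<rbrakk> \<Longrightarrow>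
      dim (B ! i \<inter> C ! j) + dim (A \<inter> {x + y | x y. x \<in> B ! i \<and> y \<in> C ! j}) = rank_num_dec M \<Delta> i j"
proof -
  note dm = decorated_matrix_antichain[OF d]
  obtain v where a: "adapted b c M v B C" and A: "A = span {\<Sum>(i, j)\<in>\<Delta>. v (i, j, 1)}"
    using T unfolding triple_orbit_iff by blast
  show TF: "(A, B, C) \<in> triple_flags b c" by (rule adapted_triple_flags[OF a dm A])
  assume ij: "i \<le> length b" "j \<le> length c"
  show s: "dim (B ! i \<union> C ! j) + rank_num M i j = sum_list (take i b) + sum_list (take j c)"
    by (rule adapted_dims(3)[OF a dm(1) ij])
  show t: "dim (A \<union> (B ! i \<union> C ! j)) + rank_num_dec M \<Delta> i j = sum_list (take i b) + sum_list (take j c) + 1"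
    by (rule decoration_dim[OF a dm(2,1) ij A])
  have sub: "subspace (B ! i)" "subspace (C ! j)" using adapted_subspaces[OF a] ij by auto
  let ?S = "{x + y | x y. x \<in> B ! i \<and> y \<in> C ! j}"
  have S: "span (B ! i \<union> C ! j) = ?S" by (rule span_Un_subspaces[OF sub])
  have dS: "dim ?S = dim (B ! i \<union> C ! j)" unfolding S[symmetric] by (rule dim_span)
  show r: "dim (B ! i \<inter> C ! j) = rank_num M i j"
    using dim_sums_Int[OF sub] dS s adapted_dims(1,2)[OF a dm(1) ij] by linarith
  have A1: "subspace A" "dim A = 1" using TF unfolding triple_flags_def lines_def by auto
  have subS: "subspace ?S" unfolding S[symmetric] by (rule subspace_span)
  have "span (A \<union> X) = span (A \<union> span X)" for X
    unfolding span_Un span_span ..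
  then have "span (A \<union> (B ! i \<union> C ! j)) = span (A \<union> ?S)" unfolding S[symmetric] .
  then have "dim (A \<union> (B ! i \<union> C ! j)) = dim {x + y | x y. x \<in> A \<and> y \<in> ?S}"
    using span_Un_subspaces[OF A1(1) subS] dim_span by metis
  then have "dim (A \<union> (B ! i \<union> C ! j)) + dim (A \<inter> ?S) = 1 + dim ?S"
    using dim_sums_Int[OF A1(1) subS] A1(2) by simp
  then show "dim (B ! i \<inter> C ! j) + dim (A \<inter> ?S) = rank_num_dec M \<Delta> i j"
    using r s t dS by linarith
qed

text \<open>Dimensions of sums are constant on an orbit. So one point of the smaller orbit and
  semicontinuity give the rank inequalities, and conversely these make every point of the smaller
  orbit \<open>rank_bounded\<close>.\<close>

theorem deg_le_iff_rk_le:
  assumes inf: "infinite (UNIV :: 'a set)" and n: "sum_list b = dim UNIV"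
    and d: "decorated_matrix b c M \<Delta>" and d': "decorated_matrix b c M' \<Delta>'"
  shows "deg_le b c M \<Delta> M' \<Delta>' \<longleftrightarrow> rk_le b c M \<Delta> M' \<Delta>'"
proof
  assume deg: "deg_le b c M \<Delta> M' \<Delta>'"
  obtain A B C where T: "(A, B, C) \<in> triple_orbit b c M \<Delta>"
    by (rule exists_orbit_element[OF decorated_matrix_antichain(1)[OF d] n])
  then have cl: "(A, B, C) \<in> zariski_topology b c closure_of triple_orbit b c M' \<Delta>'"
    using deg unfolding deg_le_def by blast
  show "rk_le b c M \<Delta> M' \<Delta>'" unfolding rk_le_def
  proof (intro ballI)
    fix i j assume "i \<in> {0..length b}" "j \<in> {0..length c}"
    then have ij: "i \<le> length b" "j \<le> length c" by auto
    have xs: "{FlagB i, FlagC j} \<subseteq> components b c" "{Line, FlagB i, FlagC j} \<subseteq> components b c"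
      using ij unfolding components_def by auto
    obtain A' B' C' where "(A', B', C') \<in> triple_orbit b c M' \<Delta>'"
      by (rule exists_orbit_element[OF decorated_matrix_antichain(1)[OF d'] n])
    note T' = this
    \<comment> \<open>The bound is taken from one element of the target orbit; it holds on the whole
      orbit because the dimension depends only on the rank number.\<close>
    have "dim (\<Union>x\<in>{FlagB i, FlagC j}. component_space (A, B, C) x) \<le> dim (B' ! i \<union> C' ! j)"
    proof (rule dim_sum_semicontinuous[OF xs(1) cl])
      fix T'' assume T'': "T'' \<in> triple_orbit b c M' \<Delta>'"
      obtain A'' B'' C'' where e: "T'' = (A'', B'', C'')" by (cases T'')
      show "dim (\<Union>x\<in>{FlagB i, FlagC j}. component_space T'' x) \<le> dim (B' ! i \<union> C' ! j)"
        using orbit_dims(2)[OF T''[unfolded e] d' ij] orbit_dims(2)[OF T' d' ij] unfolding e by simp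
    qed
    then have "dim (B ! i \<union> C ! j) \<le> dim (B' ! i \<union> C' ! j)" by simp
    moreover have "dim (\<Union>x\<in>{Line, FlagB i, FlagC j}. component_space (A, B, C) x) \<le> dim (A' \<union> (B' ! i \<union> C' ! j))"
    proof (rule dim_sum_semicontinuous[OF xs(2) cl])
      fix T'' assume T'': "T'' \<in> triple_orbit b c M' \<Delta>'"
      obtain A'' B'' C'' where e: "T'' = (A'', B'', C'')" by (cases T'')
      show "dim (\<Union>x\<in>{Line, FlagB i, FlagC j}. component_space T'' x) \<le> dim (A' \<union> (B' ! i \<union> C' ! j))"
        using orbit_dims(3)[OF T''[unfolded e] d' ij] orbit_dims(3)[OF T' d' ij] unfolding e by simp
    qed
    then have "dim (A \<union> (B ! i \<union> C ! j)) \<le> dim (A' \<union> (B' ! i \<union> C' ! j))" by simp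
    ultimately show "rank_num M' i j \<le> rank_num M i j \<and> rank_num_dec M' \<Delta>' i j \<le> rank_num_dec M \<Delta> i j"
      using orbit_dims(2,3)[OF T d ij] orbit_dims(2,3)[OF T' d' ij] by linarith
  qed
next
  assume rk: "rk_le b c M \<Delta> M' \<Delta>'"
  show "deg_le b c M \<Delta> M' \<Delta>'" unfolding deg_le_def
  proof
    fix T assume T: "T \<in> triple_orbit b c M \<Delta>"
    obtain A B C where Te: "T = (A, B, C)" by (cases T)
    show "T \<in> zariski_topology b c closure_of triple_orbit b c M' \<Delta>'"
    proof (rule rank_bounded_in_closure[OF inf decorated_matrix_antichain[OF d']])
      show "T \<in> triple_flags b c" using orbit_dims(1)[OF T[unfolded Te] d] unfolding Te .
      show "rank_bounded b c M' \<Delta>' T" unfolding rank_bounded_def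
      proof (intro allI impI)
        fix i j assume ij: "i \<le> length b" "j \<le> length c"
        have "rank_num M' i j \<le> rank_num M i j" "rank_num_dec M' \<Delta>' i j \<le> rank_num_dec M \<Delta> i j"
          using rk ij unfolding rk_le_def by auto
        then show "sum_dim T i j + rank_num M' i j \<le> sum_list (take i b) + sum_list (take j c) \<and>
          total_dim T i j + rank_num_dec M' \<Delta>' i j \<le> sum_list (take i b) + sum_list (take j c) + 1"
          using orbit_dims(2,3)[OF T[unfolded Te] d ij] unfolding Te by simp
      qed
    qed
  qed
qed

end

theorem mainTheorem1:
  fixes scale :: "'k::field \<Rightarrow> 'v::ab_group_add \<Rightarrow> 'v"
    and E :: "'v set"
    and n :: nat
    and b c :: "nat list"
    and M M' :: "nat \<Rightarrow> nat \<Rightarrow> nat"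
    and \<Delta> \<Delta>' :: "(nat \<times> nat) set"
  assumes "infinite (UNIV :: 'k set)"
    and "finite_dimensional_vector_space scale E"
    and "vector_space.dim scale (UNIV :: 'v set) = n"
    and "composition n b" and "composition n c"
    and "decorated_matrix b c M \<Delta>" and "decorated_matrix b c M' \<Delta>'"
  shows "(flag_space.deg_le scale E b c M \<Delta> M' \<Delta>' \<longleftrightarrow>
            rk_le b c M \<Delta> M' \<Delta>') \<and>
         (\<forall>A B C A' B' C'.
            (A, B, C) \<in> flag_space.triple_orbit scale b c M \<Delta> \<longrightarrow>
            (A', B', C') \<in> flag_space.triple_orbit scale b c M' \<Delta>' \<longrightarrow>
            (flag_space.deg_le scale E b c M \<Delta> M' \<Delta>' \<longleftrightarrow>
             (\<forall>i\<in>{0..length b}. \<forall>j\<in>{0..length c}.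
                vector_space.dim scale (B ! i \<inter> C ! j) \<ge>
                  vector_space.dim scale (B' ! i \<inter> C' ! j) \<and>
                vector_space.dim scale (B ! i \<inter> C ! j) +
                    vector_space.dim scale (A \<inter> {x + y | x y. x \<in> B ! i \<and> y \<in> C ! j}) \<ge>
                  vector_space.dim scale (B' ! i \<inter> C' ! j) +
                    vector_space.dim scale (A' \<inter> {x + y | x y. x \<in> B' ! i \<and> y \<in> C' ! j}))))"
proof -
  interpret flag_space scale E
    using assms(2) by (rule flag_space.intro)
  have n: "sum_list b = dim UNIV" using assms(3,4) unfolding composition_def by simp
  note iff = deg_le_iff_rk_le[OF assms(1) n assms(6,7)]
  have "(deg_le b c M \<Delta> M' \<Delta>' \<longleftrightarrow>
      (\<forall>i\<in>{0..length b}. \<forall>j\<in>{0..length c}.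
        dim (B ! i \<inter> C ! j) \<ge> dim (B' ! i \<inter> C' ! j) \<and>
        dim (B ! i \<inter> C ! j) + dim (A \<inter> {x + y | x y. x \<in> B ! i \<and> y \<in> C ! j}) \<ge>
        dim (B' ! i \<inter> C' ! j) + dim (A' \<inter> {x + y | x y. x \<in> B' ! i \<and> y \<in> C' ! j})))"
    if T: "(A, B, C) \<in> triple_orbit b c M \<Delta>" and T': "(A', B', C') \<in> triple_orbit b c M' \<Delta>'"
    for A B C A' B' C'
    unfolding iff rk_le_def
    using orbit_dims(4,5)[OF T assms(6)] orbit_dims(4,5)[OF T' assms(7)]
    by (intro ball_cong refl) simp
  then show ?thesis using iff by blast
qed

end
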